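(* Let $q\ge 2$, $k\ge 1$, $t\ge 3$ be integers, $\varepsilon>0$ a constant, and let $P:[q]^k\to\{0,1\}$ be $(t-1)$-wise uniform supporting. Let $\mathcal{I}$ be a random instance of $\mathrm{CSP}(P)$ with $n$ variables and $m\le n^{t/2-\varepsilon}$ constraints. Then there is $r=\Omega(n^{\varepsilon/(t-2)})$ such that, with high probability, $\mathrm{StaticLS}_+^r(R_{\mathcal{I}})$ is nonempty.
   Context: $P$ is $s$-wise uniform supporting if there is a distribution $\mu$ on $[q]^k$ supported on $P^{-1}(1)$ such that $\Pr_{z\sim\mu}[z_T=\alpha]=q^{-|T|}$ for all $T\subseteq[k]$ with $1\le|T|\le s$ and all $\alpha\in[q]^T$. An instance of $\mathrm{CSP}(P)$ on variables $x_1,\dots,x_n\in[q]$ is a multiset of constraints $(c,S)$, $c\in[q]^k$, $S\in[n]^k$, meaning $P(x_S+c)=1$ (componentwise addition mod $q$). A random instance has its $m$ constraints chosen independently and uniformly from all $q^kn^k$ pairs. "With high probability" means with probability $1-o(1)$ as $n\to\infty$ with $q,k,t,\varepsilon,P$ fixed. Boolean encoding: variables $x_{i,a}$ ($i\in[n]$, $a\in[q]$). $P_{01}(z)=\sum_{\beta\in[q]^k}P(\beta)\prod_{j\in[k]}z_{j,\beta_j}$; for $(c,S)$, $x^{(c)}_{S\times[q]}$ has $(j,a)$-entry $x_{S_j,(a+c_j)\bmod q}$; $R_{\mathcal{I}}=\{P_{01}(x^{(c)}_{S\times[q]})=1:(c,S)\in\mathcal{I}\}$. $\mathbf{1}_{\{x_T=\alpha\}}(x)=\prod_{i\in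 T}x_{i,\alpha_i}$; degree means multilinear degree. A family $\{D_S\}_{S\subseteq[n],|S|\le r}$ of distributions $D_S$ on $[q]^S$ is $r$-locally consistent if for $T\subseteq S$, $|S|\le r$, the marginal of $D_S$ on $T$ is $D_T$. For a polynomial $p$ in the $x_{i,a}$ involving a set $V$ of at most $r$ indices, $\mathbb{E}_D[p]=\mathbb{E}_{y\sim D_V}[p(z(y))]$ with $z(y)_{i,a}=\mathbf{1}[y_i=a]$. $\mathrm{SA}^r(R_{\mathcal{I}})$: $r$-locally consistent families with $\mathbb{E}_D[\mathbf{1}_{\{x_T=\alpha\}}(x)(P_{01}(x^{(c)}_{S\times[q]})-1)]=0$ for all $(c,S)\in\mathcal{I}$, $T\subseteq[n]$, $\alpha\in[q]^T$ for which this polynomial has degree $\le r$. $\mathrm{StaticLS}_+^r(R_{\mathcal{I}})$: families in $\mathrm{SA}^r(R_{\mathcal{I}})$ such that for every $X\subseteq[n]$ with $|X|\le r-2$ and every $\alpha\in[q]^X$, the symmetric matrix $M_{X,\alpha}$ indexed by $\{0\}\cup([n]\times[q])$ with $M_{X,\alpha}(0,0)=D_X(X=\alpha)$, $M_{X,\alpha}(0,(i,a))=D_{\{i\}\cup X}(x_i=a\wedge X=\alpha)$, $M_{X,\alpha}((i,a),(j,b))=D_{\{i,j\}\cup X}(x_i=a\wedge x_j=b\wedge X=\alpha)$ is positive semidefinite (here $D_U(\cdot)$ denotes probability under $D_U$ of the event). *)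

theory Defs
  imports
    "HOL-Probability.Probability"
    "HOL-Library.Poly_Mapping"
    "HOL-Library.Landau_Symbols"
begin

text \<open>
  Throughout, \<open>[q]\<close>, \<open>[k]\<close>, \<open>[n]\<close> are the sets \<open>{..<q}\<close>, \<open>{..<k}\<close>, \<open>{..<n}\<close> of natural numbers,
  and \<open>[q]\<^sup>T\<close> is the set of extensional functions below. A predicate \<open>P\<close> is only ever
  evaluated on \<open>[q]\<^sup>k\<close>.
\<close>

abbreviation assignments :: "nat \<Rightarrow> nat set \<Rightarrow> (nat \<Rightarrow> nat) set" where
  "assignments q T \<equiv> T \<rightarrow>\<^sub>E {..<q}"

definition uniform_supporting :: "nat \<Rightarrow> nat \<Rightarrow> nat \<Rightarrow> ((nat \<Rightarrow> nat) \<Rightarrow> bool) \<Rightarrow> bool" where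
  "uniform_supporting s q k P \<longleftrightarrow>
     (\<exists>\<mu> :: (nat \<Rightarrow> nat) pmf.
        set_pmf \<mu> \<subseteq> {z \<in> assignments q {..<k}. P z} \<and>
        (\<forall>T. T \<subseteq> {..<k} \<and> 1 \<le> card T \<and> card T \<le> s \<longrightarrow>
           (\<forall>\<alpha> \<in> assignments q T.
              measure_pmf.prob \<mu> {z. restrict z T = \<alpha>} = 1 / real q ^ card T)))"


subsection \<open>Random instances\<close>

text \<open>The pair \<open>(c, S)\<close> with \<open>c \<in> [q]\<^sup>k\<close> and \<open>S \<in> [n]\<^sup>k\<close>; entries of \<open>S\<close> may repeat.\<close>

type_synonym csp_constraint = "(nat \<Rightarrow> nat) \<times> (nat \<Rightarrow> nat)"

definition all_constraints :: "nat \<Rightarrow> nat \<Rightarrow> nat \<Rightarrow> csp_constraint set" where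
  "all_constraints q k n = ({..<k} \<rightarrow>\<^sub>E {..<q}) \<times> ({..<k} \<rightarrow>\<^sub>E {..<n})"

definition random_instance :: "nat \<Rightarrow> nat \<Rightarrow> nat \<Rightarrow> nat \<Rightarrow> csp_constraint multiset pmf" where
  "random_instance q k n m =
     map_pmf mset (replicate_pmf m (pmf_of_set (all_constraints q k n)))"


subsection \<open>Polynomials in the variables \<open>x\<^sub>i\<^sub>,\<^sub>a\<close>\<close>

type_synonym var = "nat \<times> nat"
type_synonym polyn = "(var \<Rightarrow>\<^sub>0 nat) \<Rightarrow>\<^sub>0 real"

definition pvar :: "nat \<Rightarrow> nat \<Rightarrow> polyn" where
  "pvar i a = Poly_Mapping.single (Poly_Mapping.single (i, a) 1) 1"

definition peval :: "polyn \<Rightarrow> (var \<Rightarrow> real) \<Rightarrow> real" where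
  "peval p z = (\<Sum>m \<in> Poly_Mapping.keys p.
      Poly_Mapping.lookup p m *
      (\<Prod>v \<in> Poly_Mapping.keys m. z v ^ Poly_Mapping.lookup m v))"

definition pdegree :: "polyn \<Rightarrow> nat" where
  "pdegree p = Max (insert 0
     ((\<lambda>m. \<Sum>v \<in> Poly_Mapping.keys m. Poly_Mapping.lookup m v) ` Poly_Mapping.keys p))"

definition pindices :: "polyn \<Rightarrow> nat set" where
  "pindices p = (\<Union>m \<in> Poly_Mapping.keys p. fst ` Poly_Mapping.keys m)"

text \<open>
  Reduction modulo the relations \<open>x\<^sup>2 = x\<close>: every positive exponent is replaced by 1 and
  coefficients of monomials that become equal are added up. The multilinear degree of \<open>p\<close> is
  \<open>pdegree (multilinear p)\<close>.
\<close>

definition multilinear :: "polyn \<Rightarrow> polyn" where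
  "multilinear p = (\<Sum>m \<in> Poly_Mapping.keys p.
      Poly_Mapping.single (\<Sum>v \<in> Poly_Mapping.keys m. Poly_Mapping.single v 1)
        (Poly_Mapping.lookup p m))"

definition P01 ::
  "nat \<Rightarrow> nat \<Rightarrow> ((nat \<Rightarrow> nat) \<Rightarrow> bool) \<Rightarrow> (nat \<Rightarrow> nat \<Rightarrow> 'a) \<Rightarrow> 'a :: comm_ring_1" where
  "P01 q k P z =
     (\<Sum>\<beta> \<in> assignments q {..<k}. of_bool (P \<beta>) * (\<Prod>j<k. z j (\<beta> j)))"

definition shifted_vars :: "nat \<Rightarrow> csp_constraint \<Rightarrow> nat \<Rightarrow> nat \<Rightarrow> polyn" where
  "shifted_vars q = (\<lambda>(c, S) j a. pvar (S j) ((a + c j) mod q))"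

text \<open>A polynomial \<open>p\<close> in this set stands for the equation \<open>p = 1\<close>.\<close>

definition R_inst ::
  "nat \<Rightarrow> nat \<Rightarrow> ((nat \<Rightarrow> nat) \<Rightarrow> bool) \<Rightarrow> csp_constraint multiset \<Rightarrow> polyn set" where
  "R_inst q k P I = {P01 q k P (shifted_vars q (c, S)) |c S. (c, S) \<in># I}"

definition indicator_poly :: "nat set \<Rightarrow> (nat \<Rightarrow> nat) \<Rightarrow> polyn" where
  "indicator_poly T \<alpha> = (\<Prod>i\<in>T. pvar i (\<alpha> i))"


subsection \<open>The Sherali--Adams and static LS+ relaxations\<close>

text \<open>Only the values \<open>D S\<close> with \<open>S \<subseteq> [n]\<close> and \<open>|S| \<le> r\<close> of a family \<open>D\<close> are relevant.\<close>

type_synonym dist_family = "nat set \<Rightarrow> (nat \<Rightarrow> nat) pmf"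

definition locally_consistent :: "nat \<Rightarrow> nat \<Rightarrow> nat \<Rightarrow> dist_family \<Rightarrow> bool" where
  "locally_consistent q n r D \<longleftrightarrow>
     (\<forall>S. S \<subseteq> {..<n} \<and> card S \<le> r \<longrightarrow>
        set_pmf (D S) \<subseteq> assignments q S \<and>
        (\<forall>T. T \<subseteq> S \<longrightarrow> map_pmf (\<lambda>y. restrict y T) (D S) = D T))"

definition local_expectation :: "dist_family \<Rightarrow> polyn \<Rightarrow> real" where
  "local_expectation D p =
     measure_pmf.expectation (D (pindices p))
       (\<lambda>y. peval p (\<lambda>(i, a). of_bool (y i = a)))"

text \<open>
  The polynomial is put into multilinear form before its expectation is taken. For \<open>p\<close> in
  \<open>R_inst q k P I\<close>, degree at most \<open>r\<close> then implies that at most \<open>r\<close> indices occur in it: all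
  monomials of \<open>p\<close> have the same index set.
\<close>

definition SA :: "nat \<Rightarrow> nat \<Rightarrow> nat \<Rightarrow> polyn set \<Rightarrow> dist_family set" where
  "SA q n r R = {D. locally_consistent q n r D \<and>
     (\<forall>p \<in> R. \<forall>T. T \<subseteq> {..<n} \<longrightarrow> (\<forall>\<alpha> \<in> assignments q T.
        pdegree (multilinear (indicator_poly T \<alpha> * (p - 1))) \<le> r \<longrightarrow>
        local_expectation D (multilinear (indicator_poly T \<alpha> * (p - 1))) = 0))}"

text \<open>The row and column \<open>0\<close> is \<open>None\<close>.\<close>

fun moment_matrix ::
  "dist_family \<Rightarrow> nat set \<Rightarrow> (nat \<Rightarrow> nat) \<Rightarrow> var option \<Rightarrow> var option \<Rightarrow> real" where
  "moment_matrix D X \<alpha> None None =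
     measure_pmf.prob (D X) {y. \<forall>l\<in>X. y l = \<alpha> l}"
| "moment_matrix D X \<alpha> None (Some (i, a)) =
     measure_pmf.prob (D ({i} \<union> X)) {y. y i = a \<and> (\<forall>l\<in>X. y l = \<alpha> l)}"
| "moment_matrix D X \<alpha> (Some (i, a)) None =
     measure_pmf.prob (D ({i} \<union> X)) {y. y i = a \<and> (\<forall>l\<in>X. y l = \<alpha> l)}"
| "moment_matrix D X \<alpha> (Some (i, a)) (Some (j, b)) =
     measure_pmf.prob (D ({i, j} \<union> X)) {y. y i = a \<and> y j = b \<and> (\<forall>l\<in>X. y l = \<alpha> l)}"

definition psd_on :: "'i set \<Rightarrow> ('i \<Rightarrow> 'i \<Rightarrow> real) \<Rightarrow> bool" where
  "psd_on J M \<longleftrightarrow>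
     (\<forall>a\<in>J. \<forall>b\<in>J. M a b = M b a) \<and>
     (\<forall>v :: 'i \<Rightarrow> real. 0 \<le> (\<Sum>a\<in>J. \<Sum>b\<in>J. v a * M a b * v b))"

text \<open>\<open>card X + 2 \<le> r\<close> rather than \<open>card X \<le> r - 2\<close>, which would truncate for \<open>r < 2\<close>.\<close>

definition static_LS_plus :: "nat \<Rightarrow> nat \<Rightarrow> nat \<Rightarrow> polyn set \<Rightarrow> dist_family set" where
  "static_LS_plus q n r R = {D \<in> SA q n r R.
     \<forall>X. X \<subseteq> {..<n} \<and> card X + 2 \<le> r \<longrightarrow> (\<forall>\<alpha> \<in> assignments q X.
       psd_on (insert None (Some ` ({..<n} \<times> {..<q}))) (moment_matrix D X \<alpha>))}"

end

theory Submission
  imports Defs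
begin

text \<open>
  Fix a \<open>(t - 1)\<close>-wise uniform \<open>\<mu>\<close> supported on \<open>P\<close> and give an assignment \<open>y\<close> the weight
  \<open>w\<^sub>i y = q\<^sup>k \<mu>(y\<^sub>S - c)\<close> for the \<open>i\<close>-th constraint \<open>(c, S)\<close>. If fewer than \<open>t\<close> of the \<open>k\<close>
  positions of a constraint carry variables that occur elsewhere, averaging over its remaining
  variables turns \<open>w\<^sub>i\<close> into 1, so the constraint can be peeled off. A set \<open>D\<close> of constraints in
  which nothing can be peeled off relative to a set \<open>W\<close> of variables satisfies \<open>psi W D \<le> 0\<close>
  for the submodular quantity \<open>psi W D = (t - 2k)|D| + 2|Vs D - W|\<close>, where \<open>Vs D\<close> is the set of
  variables of \<open>D\<close>. In a random instance, \<open>psi {} D\<close> is with high probability at least a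
  constant times \<open>|D|\<close> for all sets \<open>D\<close> of \<open>O(r)\<close> constraints.

  Let \<open>cl S\<close> be the largest minimiser of \<open>psi S\<close>; it has \<open>O(|S|)\<close> elements, and constraints
  outside it can be added or removed without changing averages of functions on \<open>S\<close>. So the
  marginals on \<open>S\<close> of the densities \<open>\<Prod>i\<in>cl S. w\<^sub>i\<close> are locally consistent and satisfy the
  constraints.

  For positive semidefiniteness, condition on the values on \<open>Y = X \<union> Vs (cl X)\<close>. If \<open>y\<^sub>i\<close> and
  \<open>y\<^sub>j\<close> are then correlated, they are joined by a set \<open>D\<close> with \<open>psi Y D \<le> 2\<close> that does not split
  into two parts separating \<open>i\<close> from \<open>j\<close>. Submodularity and the integrality of \<open>psi\<close> imply that
  all variables in a connected component of the correlation graph lie in one common set with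
  \<open>psi Y D \<le> 2\<close>. Its weights define a genuine joint distribution, so each diagonal block of the
  covariance matrix is positive semidefinite.
\<close>

section \<open>Deficiency of sets of constraints\<close>

text \<open>\<open>sc i p\<close> is the variable in position \<open>p\<close> of constraint
  \<open>i\<close>. Only the incidence structure enters here; shifts and values come later.\<close>

locale incidence =
  fixes k t :: nat and sc :: "nat \<Rightarrow> nat \<Rightarrow> nat"
begin

definition Vs :: "nat set \<Rightarrow> nat set" where
  "Vs D = (\<Union>i\<in>D. sc i ` {..<k})"

text \<open>\<open>psi {} D\<close> is twice the exponent of \<open>n\<close> in the expected number
  of copies of the shape of \<open>D\<close> among about \<open>n powr (t / 2)\<close> random
  constraints: a constraint contributes \<open>t / 2 - k\<close>, a variable contributes 1. Doubling
  keeps the values integral, and variables in \<open>W\<close> count as already placed.\<close>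

definition psi :: "nat set \<Rightarrow> nat set \<Rightarrow> int" where
  "psi W D = (int t - 2 * int k) * int (card D) + 2 * int (card (Vs D - W))"

text \<open>Positions are counted, so a variable repeated inside a single constraint already has
  degree at least 2.\<close>

definition deg :: "nat set \<Rightarrow> nat \<Rightarrow> nat" where
  "deg D v = (\<Sum>i\<in>D. card {p. p < k \<and> sc i p = v})"

definition tight :: "nat set \<Rightarrow> nat set \<Rightarrow> bool" where
  "tight W D \<longleftrightarrow> (\<forall>i\<in>D. t \<le> card {p. p < k \<and> (sc i p \<in> W \<or> 2 \<le> deg D (sc i p))})"

lemma finite_Vs [simp]: "finite D \<Longrightarrow> finite (Vs D)"
  by (simp add: Vs_def)

lemma Vs_empty [simp]: "Vs {} = {}"
  by (simp add: Vs_def)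

lemma Vs_Un: "Vs (A \<union> B) = Vs A \<union> Vs B"
  by (auto simp: Vs_def)

lemma Vs_mono: "A \<subseteq> B \<Longrightarrow> Vs A \<subseteq> Vs B"
  by (auto simp: Vs_def)

lemma psi_empty [simp]: "psi W {} = 0"
  by (simp add: psi_def)

lemma psi_antimono:
  assumes "finite D" "W \<subseteq> W'"
  shows "psi W' D \<le> psi W D"
  unfolding psi_def using assms by (auto intro!: card_mono)

text \<open>Chain rule: once \<open>A\<close> is placed, its variables cost nothing for
  \<open>B\<close>.\<close>

lemma psi_Un_disjoint:
  assumes "finite A" "finite B" "A \<inter> B = {}"
  shows "psi W (A \<union> B) = psi W A + psi (W \<union> Vs A) B"
proof -
  have "Vs (A \<union> B) - W = (Vs A - W) \<union> (Vs B - (W \<union> Vs A))"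
    by (auto simp: Vs_Un)
  then have "card (Vs (A \<union> B) - W) = card (Vs A - W) + card (Vs B - (W \<union> Vs A))"
    using assms by (simp only:) (intro card_Un_disjoint, auto)
  then show ?thesis
    using assms by (simp add: psi_def card_Un_disjoint algebra_simps)
qed

text \<open>Submodularity with its exact surplus. A variable outside \<open>W\<close> that
  \<open>A\<close> and \<open>B\<close> share without a common constraint carrying it is counted
  twice on the right and once in the union. This surplus of 2 per variable later forces linked sets
  to merge.\<close>

lemma psi_Un_Int:
  assumes "finite A" "finite B"
  shows "psi W (A \<union> B) + psi W (A \<inter> B) + 2 * int (card (Vs A \<inter> Vs B - Vs (A \<inter> B) - W))
    = psi W A + psi W B"
proof -
  have "card (Vs A - W) + card (Vs B - W)
      = card ((Vs A - W) \<union> (Vs B - W)) + card ((Vs A - W) \<inter> (Vs B - W))"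
    using assms by (intro card_Un_Int) auto
  moreover have "(Vs A - W) \<union> (Vs B - W) = Vs (A \<union> B) - W"
    by (auto simp: Vs_Un)
  moreover have "(Vs A - W) \<inter> (Vs B - W)
      = (Vs (A \<inter> B) - W) \<union> (Vs A \<inter> Vs B - Vs (A \<inter> B) - W)"
    using Vs_mono[of "A \<inter> B" A] Vs_mono[of "A \<inter> B" B] by auto
  moreover have "card ((Vs (A \<inter> B) - W) \<union> (Vs A \<inter> Vs B - Vs (A \<inter> B) - W))
      = card (Vs (A \<inter> B) - W) + card (Vs A \<inter> Vs B - Vs (A \<inter> B) - W)"
    using assms by (intro card_Un_disjoint) auto
  ultimately have "card (Vs A - W) + card (Vs B - W) = card (Vs (A \<union> B) - W)
      + (card (Vs (A \<inter> B) - W) + card (Vs A \<inter> Vs B - Vs (A \<inter> B) - W))"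
    by metis
  then have c: "int (card (Vs A - W)) + int (card (Vs B - W)) = int (card (Vs (A \<union> B) - W))
      + int (card (Vs (A \<inter> B) - W)) + int (card (Vs A \<inter> Vs B - Vs (A \<inter> B) - W))"
    by simp
  have d: "int (card A) + int (card B) = int (card (A \<union> B)) + int (card (A \<inter> B))"
    using card_Un_Int[OF assms] by simp
  have "psi W A + psi W B = (int t - 2 * int k) * (int (card A) + int (card B))
      + 2 * (int (card (Vs A - W)) + int (card (Vs B - W)))"
    by (simp add: psi_def algebra_simps)
  also have "\<dots> = psi W (A \<union> B) + psi W (A \<inter> B)
      + 2 * int (card (Vs A \<inter> Vs B - Vs (A \<inter> B) - W))"
    unfolding c d by (simp add: psi_def algebra_simps)
  finally show ?thesis ..
qed

lemma psi_empty_le: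
  assumes "finite D" "finite W"
  shows "psi {} D \<le> psi W D + 2 * int (card W)"
proof -
  have "card (Vs D) \<le> card ((Vs D - W) \<union> W)"
    using assms by (intro card_mono) auto
  also have "\<dots> \<le> card (Vs D - W) + card W"
    by (rule card_Un_le)
  finally show ?thesis by (simp add: psi_def)
qed

lemma deg_Diff: "finite D \<Longrightarrow> B \<subseteq> D \<Longrightarrow> deg D v = deg B v + deg (D - B) v"
  unfolding deg_def by (simp add: sum.subset_diff[of B D])

lemma deg_pos_iff: "finite D \<Longrightarrow> 0 < deg D v \<longleftrightarrow> v \<in> Vs D"
proof -
  assume "finite D"
  then have "deg D v = 0 \<longleftrightarrow> v \<notin> Vs D"
    unfolding deg_def Vs_def by (auto simp: card_eq_0_iff)
  then show ?thesis by auto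
qed

lemma sum_deg:
  assumes "finite D"
  shows "(\<Sum>i\<in>D. card {p. p < k \<and> Q (sc i p)}) = (\<Sum>v\<in>Vs D. if Q v then deg D v else 0)"
proof -
  have "card {p. p < k \<and> Q (sc i p)} = (\<Sum>v\<in>Vs D. if Q v then card {p. p < k \<and> sc i p = v} else 0)"
    if "i \<in> D" for i
  proof -
    have "(\<Sum>v\<in>Vs D. \<Sum>p\<in>{p \<in> {p. p < k \<and> Q (sc i p)}. sc i p = v}. 1::nat)
        = (\<Sum>p\<in>{p. p < k \<and> Q (sc i p)}. 1)"
      using that assms by (intro sum.group) (auto simp: Vs_def)
    moreover have "(\<Sum>p\<in>{p \<in> {p. p < k \<and> Q (sc i p)}. sc i p = v}. 1::nat)
        = (if Q v then card {p. p < k \<and> sc i p = v} else 0)" for v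
      by (auto intro!: arg_cong[where f = card] simp: card_eq_0_iff)
    ultimately show ?thesis by simp
  qed
  then have "(\<Sum>i\<in>D. card {p. p < k \<and> Q (sc i p)})
      = (\<Sum>i\<in>D. \<Sum>v\<in>Vs D. if Q v then card {p. p < k \<and> sc i p = v} else 0)"
    by (rule sum.cong[OF refl])
  also have "\<dots> = (\<Sum>v\<in>Vs D. \<Sum>i\<in>D. if Q v then card {p. p < k \<and> sc i p = v} else 0)"
    by (rule sum.swap)
  also have "\<dots> = (\<Sum>v\<in>Vs D. if Q v then deg D v else 0)"
    by (rule sum.cong[OF refl]) (simp add: deg_def)
  finally show ?thesis .
qed

text \<open>Double counting of positions. Tightness bounds \<open>t * card B\<close> by the degrees
  of the variables satisfying \<open>Q\<close>, and \<open>k * card B\<close> is the sum of all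
  degrees, so \<open>psi Y B\<close> is at most a sum of charges over variables. A variable in
  \<open>Y\<close> or of degree at least 2 in \<open>B\<close> has charge at most 0. A variable
  outside \<open>Y\<close> of degree 1 has charge 1 if \<open>Q\<close> holds and 0 otherwise; in
  the former case it lies in \<open>Z\<close> or recurs in \<open>D - B\<close>.\<close>

lemma psi_le_of_tight:
  assumes fin: "finite D" and tight: "tight (Y \<union> Z) D" and sub: "B \<subseteq> D"
  shows "psi Y B \<le> int (card {v \<in> Vs B - Y. deg B v = 1 \<and> (v \<in> Z \<or> v \<in> Vs (D - B))})"
proof -
  have finB: "finite B" using fin sub by (rule finite_subset[rotated])
  define Q where "Q v \<longleftrightarrow> v \<in> Y \<union> Z \<or> 2 \<le> deg D v" for v
  have "t * card B = (\<Sum>i\<in>B. t)" by simp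
  also have "\<dots> \<le> (\<Sum>i\<in>B. card {p. p < k \<and> Q (sc i p)})"
    using tight sub unfolding tight_def Q_def by (intro sum_mono) blast
  also have "\<dots> = (\<Sum>v\<in>Vs B. if Q v then deg B v else 0)"
    by (rule sum_deg[OF finB])
  finally have "int (t * card B) \<le> int (\<Sum>v\<in>Vs B. if Q v then deg B v else 0)"
    by (simp only: of_nat_le_iff)
  also have "\<dots> = (\<Sum>v\<in>Vs B. if Q v then int (deg B v) else 0)"
    unfolding of_nat_sum by (rule sum.cong) auto
  finally have 1: "int t * int (card B) \<le> (\<Sum>v\<in>Vs B. if Q v then int (deg B v) else 0)"
    by simp
  have "k * card B = (\<Sum>v\<in>Vs B. deg B v)"
    using sum_deg[OF finB, of "\<lambda>_. True"] by (simp add: mult.commute)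
  then have 2: "int k * int (card B) = (\<Sum>v\<in>Vs B. int (deg B v))"
    by (simp flip: of_nat_mult of_nat_sum)
  have 3: "int (card (Vs B - Y)) = (\<Sum>v\<in>Vs B. if v \<in> Y then 0 else 1)"
    using finB by (subst sum.If_cases) (auto simp: Diff_eq)
  have 4: "int (card {v \<in> Vs B - Y. deg B v = 1 \<and> (v \<in> Z \<or> v \<in> Vs (D - B))})
      = (\<Sum>v\<in>Vs B. if v \<notin> Y \<and> deg B v = 1 \<and> (v \<in> Z \<or> v \<in> Vs (D - B)) then 1 else 0)"
    using finB by (subst sum.If_cases) (auto intro!: arg_cong[where f = card])
  have "psi Y B \<le> (\<Sum>v\<in>Vs B. if Q v then int (deg B v) else 0) - 2 * (\<Sum>v\<in>Vs B. int (deg B v))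
      + 2 * (\<Sum>v\<in>Vs B. if v \<in> Y then 0 else 1)"
    using 1 2 3 by (simp add: psi_def algebra_simps)
  also have "\<dots> = (\<Sum>v\<in>Vs B. (if Q v then int (deg B v) else 0) - 2 * int (deg B v)
      + 2 * (if v \<in> Y then 0 else 1))"
    by (simp add: sum.distrib sum_subtractf sum_distrib_left)
  also have "\<dots> \<le> (\<Sum>v\<in>Vs B. if v \<notin> Y \<and> deg B v = 1 \<and> (v \<in> Z \<or> v \<in> Vs (D - B)) then 1 else 0)"
  proof (rule sum_mono)
    fix v assume "v \<in> Vs B"
    then have "1 \<le> deg B v" using deg_pos_iff[OF finB, of v] by simp
    moreover have "deg D v = deg B v + deg (D - B) v" using deg_Diff[OF fin sub] .
    moreover have "v \<in> Vs (D - B) \<longleftrightarrow> 0 < deg (D - B) v"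
      using fin by (simp add: deg_pos_iff)
    ultimately show "(if Q v then int (deg B v) else 0) - 2 * int (deg B v)
      + 2 * (if v \<in> Y then 0 else 1)
      \<le> (if v \<notin> Y \<and> deg B v = 1 \<and> (v \<in> Z \<or> v \<in> Vs (D - B)) then 1 else 0)"
      by (auto simp: Q_def)
  qed
  finally show ?thesis using 4 by simp
qed

end

section \<open>Weighted averages and peeling\<close>

definition depends_on :: "nat set \<Rightarrow> ((nat \<Rightarrow> nat) \<Rightarrow> 'a) \<Rightarrow> bool" where
  "depends_on W f \<longleftrightarrow> (\<forall>y y'. (\<forall>x\<in>W. y x = y' x) \<longrightarrow> f y = f y')"

lemma depends_onD: "depends_on W f \<Longrightarrow> (\<And>x. x \<in> W \<Longrightarrow> y x = y' x) \<Longrightarrow> f y = f y'"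
  unfolding depends_on_def by blast

lemma depends_onI: "(\<And>y y'. (\<And>x. x \<in> W \<Longrightarrow> y x = y' x) \<Longrightarrow> f y = f y') \<Longrightarrow> depends_on W f"
  unfolding depends_on_def by blast

lemma depends_on_mono: "depends_on W f \<Longrightarrow> W \<subseteq> W' \<Longrightarrow> depends_on W' f"
  unfolding depends_on_def by blast

lemma depends_on_mult:
  "depends_on W f \<Longrightarrow> depends_on W g \<Longrightarrow> depends_on W (\<lambda>y. f y * (g y :: real))"
  unfolding depends_on_def by (intro allI impI arg_cong2[where f = times]) blast+

lemma depends_on_const: "depends_on W (\<lambda>_. c)"
  by (simp add: depends_on_def)

definition agrees :: "nat set \<Rightarrow> (nat \<Rightarrow> nat) \<Rightarrow> (nat \<Rightarrow> nat) \<Rightarrow> real" where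
  "agrees Y \<eta> y = of_bool (\<forall>x\<in>Y. y x = \<eta> x)"

lemma depends_on_agrees: "depends_on Y (agrees Y \<eta>)"
  by (rule depends_onI) (simp add: agrees_def)

lemma override_on_assignments:
  assumes "y \<in> assignments q N" "u \<in> assignments q N'" "V \<subseteq> N" "V \<subseteq> N'"
  shows "override_on y u V \<in> assignments q N"
proof (rule PiE_I)
  fix x assume "x \<in> N"
  then show "override_on y u V x \<in> {..<q}"
    using assms by (cases "x \<in> V") (auto simp: PiE_iff)
next
  fix x assume "x \<notin> N"
  then show "override_on y u V x = undefined"
    using assms by (cases "x \<in> V") (auto simp: PiE_iff extensional_def)
qed

text \<open>Resampling the coordinates in \<open>V\<close> preserves uniform averages, because
  exchanging the old values on \<open>V\<close> with the new ones is an involution on the pairs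
  \<open>(y, u)\<close>.\<close>

lemma sum_override_on:
  fixes G :: "(nat \<Rightarrow> nat) \<Rightarrow> real"
  assumes V: "V \<subseteq> N" and fin: "finite N"
  shows "(\<Sum>y\<in>assignments q N. \<Sum>u\<in>assignments q V. G (override_on y u V))
    = real q ^ card V * (\<Sum>y\<in>assignments q N. G y)"
proof -
  have finV: "finite V" using V fin by (rule finite_subset)
  have ov: "restrict (override_on y u V) V = u" if "u \<in> assignments q V" for y u
    using that by (auto simp: PiE_iff override_on_def extensional_def fun_eq_iff)
  have ov2: "override_on (override_on y u V) (restrict y V) V = y" for y u :: "nat \<Rightarrow> nat"
    by (auto simp: override_on_def fun_eq_iff)
  have re: "y \<in> V \<rightarrow> {..<q}" if "y \<in> assignments q N" for y
    using that V by (auto simp: PiE_iff)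
  have "(\<Sum>y\<in>assignments q N. \<Sum>u\<in>assignments q V. G (override_on y u V))
      = (\<Sum>(y, u)\<in>assignments q N \<times> assignments q V. G (override_on y u V))"
    by (rule sum.cartesian_product)
  also have "\<dots> = (\<Sum>(y, u)\<in>assignments q N \<times> assignments q V. G y)"
    by (rule sum.reindex_bij_witness[where
          i = "\<lambda>(y, u). (override_on y u V, restrict y V)" and
          j = "\<lambda>(y, u). (override_on y u V, restrict y V)"])
      (simp_all add: ov ov2 re override_on_assignments[OF _ _ V order_refl] split_beta mem_Times_iff)
  also have "\<dots> = (\<Sum>y\<in>assignments q N. \<Sum>u\<in>assignments q V. G y)"
    by (rule sum.cartesian_product[symmetric])
  also have "\<dots> = real q ^ card V * (\<Sum>y\<in>assignments q N. G y)"
    using finV by (simp add: card_PiE sum_distrib_left)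
  finally show ?thesis .
qed

text \<open>Conditional independence given \<eta>, with denominators cleared. Two copies
  \<open>y\<close> and \<open>y'\<close> exchange their coordinates in \<open>B\<close>. Both agree
  with \<eta> on \<open>Y\<close>, and \<open>A\<close> meets \<open>B\<close> only inside
  \<open>Y\<close>, so \<open>F\<close> keeps its value while \<open>G\<close> moves to the other
  copy.\<close>

lemma sum_agrees_product:
  fixes F G :: "(nat \<Rightarrow> nat) \<Rightarrow> real" and q :: nat and \<eta> :: "nat \<Rightarrow> nat"
  assumes F: "depends_on (Y \<union> A) F" and G: "depends_on (Y \<union> B) G" and AB: "A \<inter> B \<subseteq> Y"
    and B: "B \<subseteq> N"
  defines "S \<equiv> (\<lambda>f. \<Sum>y\<in>assignments q N. agrees Y \<eta> y * f y)"
  shows "S (\<lambda>y. F y * G y) * S (\<lambda>_. 1) = S F * S G"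
proof -
  let ?A = "assignments q N"
  let ?sw = "\<lambda>(y, y'). (override_on y y' B, override_on y' y B)"
  have sw: "?sw (?sw z) = z" for z :: "(nat \<Rightarrow> nat) \<times> (nat \<Rightarrow> nat)"
    by (cases z) (auto simp: override_on_def fun_eq_iff)
  have "S (\<lambda>y. F y * G y) * S (\<lambda>_. 1)
      = (\<Sum>(y, y')\<in>?A \<times> ?A. agrees Y \<eta> y * (F y * G y) * agrees Y \<eta> y')"
    by (simp add: S_def sum_product sum.cartesian_product)
  also have "\<dots> = (\<Sum>(y, y')\<in>?A \<times> ?A. agrees Y \<eta> y * F y * (agrees Y \<eta> y' * G y'))"
  proof (rule sum.reindex_bij_witness[where i = ?sw and j = ?sw])
    fix z assume z: "z \<in> ?A \<times> ?A"
    obtain y y' where zz: "z = (y, y')" by force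
    let ?u = "override_on y y' B" and ?v = "override_on y' y B"
    have ag: "agrees Y \<eta> ?u * agrees Y \<eta> ?v = agrees Y \<eta> y * agrees Y \<eta> y'"
      by (auto simp: agrees_def override_on_def split: if_splits)
    show "?sw (?sw z) = z" by (rule sw)
    show "?sw z \<in> ?A \<times> ?A"
      using z B by (simp add: zz override_on_assignments[where N' = N])
    show "(case ?sw z of (y, y') \<Rightarrow> agrees Y \<eta> y * F y * (agrees Y \<eta> y' * G y'))
        = (case z of (y, y') \<Rightarrow> agrees Y \<eta> y * (F y * G y) * agrees Y \<eta> y')"
    proof (cases "agrees Y \<eta> y * agrees Y \<eta> y' = 0")
      case True
      then show ?thesis using ag by (auto simp: zz)
    next
      case False
      then have eq: "y x = \<eta> x" "y' x = \<eta> x" if "x \<in> Y" for x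
        using that by (auto simp: agrees_def split: if_splits)
      have "F ?u = F y"
        using AB by (intro depends_onD[OF F]) (auto simp: override_on_def eq)
      moreover have "G ?v = G y"
        using eq by (intro depends_onD[OF G]) (auto simp: override_on_def eq)
      ultimately show ?thesis using ag by (simp add: zz algebra_simps)
    qed
  next
    fix z assume "z \<in> ?A \<times> ?A"
    then show "?sw z \<in> ?A \<times> ?A"
      using B by (simp add: split_beta mem_Times_iff override_on_assignments[where N' = N])
    show "?sw (?sw z) = z" by (rule sw)
  qed
  also have "\<dots> = S F * S G"
    by (simp add: S_def sum_product sum.cartesian_product)
  finally show ?thesis .
qed

text \<open>Subtraction modulo \<open>q\<close> is written as addition of \<open>q - s\<close>,
  which avoids truncation on the naturals.\<close>

lemma mod_shift_inverse:
  fixes a q s :: nat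
  assumes "a < q" "s < q"
  shows "((a + (q - s)) mod q + s) mod q = a" "((a + s) mod q + (q - s)) mod q = a"
proof -
  have "((a + (q - s)) mod q + s) mod q = (a + (q - s) + s) mod q" by (rule mod_add_left_eq)
  also have "a + (q - s) + s = a + q" using assms by simp
  finally show "((a + (q - s)) mod q + s) mod q = a" using assms by simp
  have "((a + s) mod q + (q - s)) mod q = (a + s + (q - s)) mod q" by (rule mod_add_left_eq)
  also have "a + s + (q - s) = a + q" using assms by simp
  finally show "((a + s) mod q + (q - s)) mod q = a" using assms by simp
qed

text \<open>Constraint \<open>i < m\<close> has scope \<open>sc i\<close> and shift
  \<open>sh i\<close>; indexing keeps repeated constraints apart. The uniformity assumption includes
  the empty \<open>T\<close>.\<close>

locale csp_instance = incidence k t sc for k t :: nat and sc :: "nat \<Rightarrow> nat \<Rightarrow> nat" +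
  fixes q n m :: nat and \<mu> :: "(nat \<Rightarrow> nat) pmf" and sh :: "nat \<Rightarrow> nat \<Rightarrow> nat"
  assumes q_pos: "0 < q"
    and supp: "set_pmf \<mu> \<subseteq> assignments q {..<k}"
    and unif: "\<And>T \<alpha>. T \<subseteq> {..<k} \<Longrightarrow> card T < t \<Longrightarrow> \<alpha> \<in> assignments q T \<Longrightarrow>
      measure_pmf.prob \<mu> {z. restrict z T = \<alpha>} = 1 / real q ^ card T"
    and sc_less: "\<And>i p. i < m \<Longrightarrow> p < k \<Longrightarrow> sc i p < n"
    and sh_less: "\<And>i p. i < m \<Longrightarrow> p < k \<Longrightarrow> sh i p < q"
begin

text \<open>The shift is subtracted because, in the Boolean encoding, the monomial of \<beta>
  selects \<open>y (sc i p) = \<beta> p + sh i p\<close> modulo \<open>q\<close>.\<close>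

definition pattern :: "nat \<Rightarrow> (nat \<Rightarrow> nat) \<Rightarrow> nat \<Rightarrow> nat" where
  "pattern i y = (\<lambda>p\<in>{..<k}. (y (sc i p) + (q - sh i p)) mod q)"

text \<open>The density of \<mu> relative to the uniform distribution on patterns, hence the factor
  \<open>real q ^ k\<close>.\<close>

definition w :: "nat \<Rightarrow> (nat \<Rightarrow> nat) \<Rightarrow> real" where
  "w i y = real q ^ k * pmf \<mu> (pattern i y)"

definition wt :: "nat set \<Rightarrow> (nat \<Rightarrow> nat) \<Rightarrow> real" where
  "wt D y = (\<Prod>i\<in>D. w i y)"

definition E :: "((nat \<Rightarrow> nat) \<Rightarrow> real) \<Rightarrow> real" where
  "E f = (\<Sum>y\<in>assignments q {..<n}. f y) / real q ^ n"

lemma Vs_subset: "D \<subseteq> {..<m} \<Longrightarrow> Vs D \<subseteq> {..<n}"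
  unfolding Vs_def using sc_less by auto

lemma wt_nonneg: "0 \<le> wt D y"
  by (simp add: wt_def w_def prod_nonneg)

lemma wt_empty [simp]: "wt {} y = 1"
  by (simp add: wt_def)

lemma wt_Un: "finite A \<Longrightarrow> finite B \<Longrightarrow> A \<inter> B = {} \<Longrightarrow> wt (A \<union> B) y = wt A y * wt B y"
  unfolding wt_def by (rule prod.union_disjoint)

lemma depends_on_w: "depends_on (sc i ` {..<k}) (w i)"
proof (rule depends_onI)
  fix y y' :: "nat \<Rightarrow> nat" assume "\<And>x. x \<in> sc i ` {..<k} \<Longrightarrow> y x = y' x"
  then have "pattern i y = pattern i y'" by (auto simp: pattern_def fun_eq_iff)
  then show "w i y = w i y'" by (simp add: w_def)
qed

lemma depends_on_wt: "depends_on (Vs D) (wt D)"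
proof (rule depends_onI)
  fix y y' :: "nat \<Rightarrow> nat" assume *: "\<And>x. x \<in> Vs D \<Longrightarrow> y x = y' x"
  show "wt D y = wt D y'"
    unfolding wt_def
  proof (rule prod.cong[OF refl])
    fix i assume "i \<in> D"
    then show "w i y = w i y'"
      using * by (intro depends_onD[OF depends_on_w]) (auto simp: Vs_def)
  qed
qed

lemma E_cong: "(\<And>y. y \<in> assignments q {..<n} \<Longrightarrow> f y = g y) \<Longrightarrow> E f = E g"
  by (simp add: E_def cong: sum.cong)

lemma E_add: "E (\<lambda>y. f y + g y) = E f + E g"
  by (simp add: E_def sum.distrib add_divide_distrib)

lemma E_cmult: "E (\<lambda>y. c * f y) = c * E f"
  by (simp add: E_def sum_distrib_left)

lemma E_sum: "E (\<lambda>y. \<Sum>i\<in>I. f i y) = (\<Sum>i\<in>I. E (f i))"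
  unfolding E_def by (subst sum.swap) (simp add: sum_divide_distrib)

lemma E_nonneg: "(\<And>y. 0 \<le> f y) \<Longrightarrow> 0 \<le> E f"
  by (simp add: E_def sum_nonneg)

lemma E_one [simp]: "E (\<lambda>_. 1) = 1"
  using q_pos by (simp add: E_def card_PiE)

text \<open>Only the positions outside \<open>J\<close> matter after averaging, and there are fewer than \<open>t\<close> of
  them. They may carry repeated variables.\<close>

lemma sum_w_override_on:
  assumes i: "i < m" and J: "J \<subseteq> {..<k}" "inj_on (sc i) J"
    and notJ: "\<And>p. p < k \<Longrightarrow> p \<notin> J \<Longrightarrow> sc i p \<notin> sc i ` J"
    and card: "card ({..<k} - J) < t"
  shows "(\<Sum>u\<in>assignments q (sc i ` J). w i (override_on y u (sc i ` J))) = real q ^ card (sc i ` J)"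
proof -
  let ?V = "sc i ` J" and ?R = "{..<k} - J"
  let ?Z = "{z \<in> assignments q {..<k}. restrict z ?R = restrict (pattern i y) ?R}"
  define f where "f u = pattern i (override_on y u ?V)" for u
  \<comment> \<open>\<open>g\<close> inverts \<open>f\<close>: it adds the shifts back to read the
    values on \<open>?V\<close> off a pattern. Injectivity of \<open>sc i\<close> on
    \<open>J\<close> gives every variable of \<open>?V\<close> exactly one position in
    \<open>J\<close>.\<close>
  define g where "g z = (\<lambda>v\<in>?V. (z (the_inv_into J (sc i) v) + sh i (the_inv_into J (sc i) v)) mod q)"
    for z :: "nat \<Rightarrow> nat"
  have finZ: "finite ?Z" by (rule finite_subset[of _ "assignments q {..<k}"]) (auto intro!: finite_PiE)
  have inv: "the_inv_into J (sc i) (sc i p) = p" if "p \<in> J" for p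
    using that J by (simp add: the_inv_into_f_f)
  have "(\<Sum>u\<in>assignments q ?V. pmf \<mu> (f u)) = (\<Sum>z\<in>?Z. pmf \<mu> z)"
  proof (rule sum.reindex_bij_witness[where i = g and j = f])
    fix u assume u: "u \<in> assignments q ?V"
    show "g (f u) = u"
    proof
      fix v
      show "g (f u) v = u v"
      proof (cases "v \<in> ?V")
        case True
        then obtain p where p: "p \<in> J" "v = sc i p" by blast
        have "u v < q" using u True by (auto simp: PiE_iff)
        then show ?thesis
          using p J i sh_less[of i p] mod_shift_inverse(1)[of "u v" q "sh i p"]
          by (auto simp: g_def f_def inv pattern_def override_on_def)
      next
        case False
        then show ?thesis using u by (simp add: g_def PiE_iff extensional_def)
      qed
    qed
    show "f u \<in> ?Z"
      using q_pos notJ by (auto simp: f_def pattern_def override_on_def fun_eq_iff)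
    show "pmf \<mu> (f u) = pmf \<mu> (f u)" ..
  next
    fix z assume z: "z \<in> ?Z"
    show "f (g z) = z"
    proof
      fix p
      show "f (g z) p = z p"
      proof (cases "p < k")
        case pk: True
        have zq: "z p < q" using z pk by (auto simp: PiE_iff)
        show ?thesis
        proof (cases "p \<in> J")
          case True
          then show ?thesis
            using pk zq i sh_less[of i p] mod_shift_inverse(2)[of "z p" q "sh i p"]
            by (auto simp: g_def f_def inv pattern_def override_on_def)
        next
          case False
          then have "restrict z ?R p = restrict (pattern i y) ?R p" using z by auto
          then show ?thesis
            using False pk notJ[of p] by (simp add: f_def pattern_def override_on_def)
        qed
      next
        case False
        then show ?thesis using z by (auto simp: f_def pattern_def PiE_iff extensional_def)
      qed
    qed
    show "g z \<in> assignments q ?V"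
      using q_pos by (auto simp: g_def)
  qed
  also have "\<dots> = measure_pmf.prob \<mu> ?Z"
    using finZ by (simp add: measure_measure_pmf_finite)
  \<comment> \<open>The support of \<mu> consists of extensional assignments, so the first condition
    in \<open>?Z\<close> holds almost surely.\<close>
  also have "\<dots> = measure_pmf.prob \<mu> {z. restrict z ?R = restrict (pattern i y) ?R}"
    using supp by (intro measure_pmf.finite_measure_eq_AE) (auto simp: AE_measure_pmf_iff)
  also have "\<dots> = 1 / real q ^ card ?R"
    using q_pos by (intro unif card) (auto simp: pattern_def PiE_iff)
  finally have "(\<Sum>u\<in>assignments q ?V. w i (override_on y u ?V)) = real q ^ k / real q ^ card ?R"
    by (simp add: w_def f_def flip: sum_distrib_left)
  also have "card ?R = k - card J"
    using J by (simp add: card_Diff_subset finite_subset)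
  also have "real q ^ k / real q ^ (k - card J) = real q ^ card J"
  proof -
    have "card J \<le> k" using J card_mono[of "{..<k}" J] by simp
    then have "real q ^ k = real q ^ card J * real q ^ (k - card J)"
      by (simp flip: power_add)
    then show ?thesis using q_pos by simp
  qed
  also have "card J = card ?V" using J by (simp add: card_image)
  finally show ?thesis .
qed

text \<open>The variables at the positions in \<open>J\<close> occur once in \<open>D\<close> and
  lie outside \<open>W\<close>. Resampling them changes neither \<open>f\<close> nor the other
  weights, and \<open>w i\<close> averages to 1 over them because fewer than \<open>t\<close>
  positions remain.\<close>

lemma E_peel:
  assumes D: "D \<subseteq> {..<m}" "i \<in> D" and f: "depends_on W f"
    and few: "card {p. p < k \<and> (sc i p \<in> W \<or> 2 \<le> deg D (sc i p))} < t"
  shows "E (\<lambda>y. f y * wt D y) = E (\<lambda>y. f y * wt (D - {i}) y)"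
proof -
  have finD: "finite D" using D(1) by (rule finite_subset) simp
  have i: "i < m" using D by auto
  define J where "J = {p. p < k \<and> sc i p \<notin> W \<and> deg D (sc i p) < 2}"
  let ?V = "sc i ` J"
  have V: "?V \<subseteq> {..<n}" using sc_less i by (auto simp: J_def)
  have degi: "deg D v = card {p. p < k \<and> sc i p = v} + deg (D - {i}) v" for v
    using deg_Diff[of D "{i}" v] finD D by (simp add: deg_def)
  have inj: "p' = p" if "p \<in> J" "p' < k" "sc i p' = sc i p" for p p'
  proof (rule ccontr)
    assume "p' \<noteq> p"
    then have "card {p, p'} = 2" by simp
    moreover have "card {p, p'} \<le> card {x. x < k \<and> sc i x = sc i p}"
      using that by (intro card_mono) (auto simp: J_def)
    ultimately have "2 \<le> deg D (sc i p)" using degi[of "sc i p"] by simp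
    then show False using that by (auto simp: J_def)
  qed
  have notin: "v \<notin> Vs (D - {i})" "v \<notin> W" if v: "v \<in> ?V" for v
  proof -
    obtain p where p: "p \<in> J" "v = sc i p" using v by blast
    have "1 \<le> card {x. x < k \<and> sc i x = v}"
      using p by (auto simp: J_def Suc_le_eq card_gt_0_iff)
    then have "deg (D - {i}) v = 0" using p degi[of v] by (auto simp: J_def)
    then show "v \<notin> Vs (D - {i})" using deg_pos_iff[of "D - {i}" v] finD by simp
    show "v \<notin> W" using p by (auto simp: J_def)
  qed
  define F where "F y = f y * wt (D - {i}) y" for y
  have F: "F (override_on y u ?V) = F y" for y u
  proof -
    have "f (override_on y u ?V) = f y"
      using notin(2) by (intro depends_onD[OF f]) (auto simp: override_on_def)
    moreover have "wt (D - {i}) (override_on y u ?V) = wt (D - {i}) y"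
      using notin(1) by (intro depends_onD[OF depends_on_wt]) (auto simp: override_on_def)
    ultimately show ?thesis by (simp add: F_def)
  qed
  have split: "f y * wt D y = F y * w i y" for y
    using finD D by (simp add: F_def wt_def prod.remove)
  have "real q ^ card ?V * (\<Sum>y\<in>assignments q {..<n}. F y * w i y)
      = (\<Sum>y\<in>assignments q {..<n}. \<Sum>u\<in>assignments q ?V.
          F (override_on y u ?V) * w i (override_on y u ?V))"
    by (rule sum_override_on[OF V, symmetric]) simp
  also have "\<dots> = (\<Sum>y\<in>assignments q {..<n}. F y *
      (\<Sum>u\<in>assignments q ?V. w i (override_on y u ?V)))"
    by (simp add: F sum_distrib_left)
  also have "\<dots> = (\<Sum>y\<in>assignments q {..<n}. F y * real q ^ card ?V)"
  proof -
    have "{..<k} - J = {p. p < k \<and> (sc i p \<in> W \<or> 2 \<le> deg D (sc i p))}"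
      by (auto simp: J_def)
    then have "(\<Sum>u\<in>assignments q ?V. w i (override_on y u ?V)) = real q ^ card ?V" for y
    proof (intro sum_w_override_on[OF i])
      show "J \<subseteq> {..<k}" by (auto simp: J_def)
      show "inj_on (sc i) J" by (rule inj_onI) (auto simp: J_def intro: inj)
      show "sc i p \<notin> sc i ` J" if "p < k" "p \<notin> J" for p
        using inj that by auto
      show "card ({..<k} - J) < t" using few by (simp add: \<open>{..<k} - J = _\<close>)
    qed
    then show ?thesis by simp
  qed
  also have "\<dots> = real q ^ card ?V * (\<Sum>y\<in>assignments q {..<n}. F y)"
    by (simp add: sum_distrib_left mult.commute[of "F _"])
  finally have "(\<Sum>y\<in>assignments q {..<n}. F y * w i y) = (\<Sum>y\<in>assignments q {..<n}. F y)"
    using q_pos by simp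
  then show ?thesis by (simp add: E_def split) (simp add: F_def)
qed

text \<open>Peel constraints one at a time until none qualifies; each removal preserves the averages
  of all functions of \<open>W\<close> simultaneously.\<close>

lemma tight_core:
  assumes "U \<subseteq> {..<m}"
  obtains D where "D \<subseteq> U" "tight W D"
    "\<And>f. depends_on W f \<Longrightarrow> E (\<lambda>y. f y * wt U y) = E (\<lambda>y. f y * wt D y)"
proof -
  have "finite U" using assms by (rule finite_subset) simp
  then have "\<exists>D\<subseteq>U. tight W D \<and>
      (\<forall>f. depends_on W f \<longrightarrow> E (\<lambda>y. f y * wt U y) = E (\<lambda>y. f y * wt D y))"
    using assms
  proof (induction U rule: finite_psubset_induct)
    case (psubset U)
    show ?case
    proof (cases "tight W U")
      case True
      then show ?thesis by blast
    next
      case False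
      then obtain i where i: "i \<in> U"
        "card {p. p < k \<and> (sc i p \<in> W \<or> 2 \<le> deg U (sc i p))} < t"
        by (auto simp: tight_def not_le)
      then obtain D where D: "D \<subseteq> U - {i}" "tight W D"
        "\<forall>f. depends_on W f \<longrightarrow> E (\<lambda>y. f y * wt (U - {i}) y) = E (\<lambda>y. f y * wt D y)"
        using psubset.IH[of "U - {i}"] psubset.prems by auto
      then show ?thesis
        using E_peel[OF psubset.prems i(1) _ i(2)] by (intro exI[of _ D]) auto
    qed
  qed
  then show ?thesis using that by blast
qed

text \<open>A tight set has nonpositive \<open>psi W\<close>, so under the positivity assumption the
  tight core of \<open>U\<close> is empty and all of \<open>U\<close> is peeled off.\<close>

lemma E_wt_removable:
  assumes U: "U \<subseteq> {..<m}" and pos: "\<And>D. D \<subseteq> U \<Longrightarrow> D \<noteq> {} \<Longrightarrow> 0 < psi W D"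
    and f: "depends_on W f"
  shows "E (\<lambda>y. f y * wt U y) = E f"
proof -
  obtain D where D: "D \<subseteq> U" "tight W D"
    "\<And>f. depends_on W f \<Longrightarrow> E (\<lambda>y. f y * wt U y) = E (\<lambda>y. f y * wt D y)"
    using tight_core[OF U, of W] by blast
  have "finite D" using D(1) U by (meson finite_lessThan finite_subset)
  then have "psi W D \<le> 0"
    using psi_le_of_tight[of D W "{}" D] D(2) by simp
  then have "D = {}" using pos[OF D(1)] by fastforce
  then show ?thesis using D(3)[OF f] by simp
qed

text \<open>The weights of \<open>A\<close> are absorbed into the test function, which remains a
  function of \<open>W\<close>; then \<open>B - A\<close> is removable.\<close>

lemma E_wt_extend:
  assumes A: "A \<subseteq> B" and B: "B \<subseteq> {..<m}" and W: "Vs A \<subseteq> W" and f: "depends_on W f"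
    and pos: "\<And>D. D \<subseteq> B - A \<Longrightarrow> D \<noteq> {} \<Longrightarrow> 0 < psi W D"
  shows "E (\<lambda>y. f y * wt B y) = E (\<lambda>y. f y * wt A y)"
proof -
  have "finite B" using B by (rule finite_subset) simp
  then have "wt B y = wt A y * wt (B - A) y" for y
    using wt_Un[of A "B - A" y] A finite_subset[OF A] by (simp add: Un_absorb1)
  then have "E (\<lambda>y. f y * wt B y) = E (\<lambda>y. (f y * wt A y) * wt (B - A) y)"
    by (simp add: mult.assoc)
  also have "\<dots> = E (\<lambda>y. f y * wt A y)"
    using B pos by (intro E_wt_removable[where W = W] depends_on_mult f
        depends_on_mono[OF depends_on_wt W]) auto
  finally show ?thesis .
qed

lemma E_agrees_product:
  assumes "depends_on (Y \<union> A) F" "depends_on (Y \<union> B) G" "A \<inter> B \<subseteq> Y" "B \<subseteq> {..<n}"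
  shows "E (\<lambda>y. agrees Y \<eta> y * (F y * G y)) * E (agrees Y \<eta>)
    = E (\<lambda>y. agrees Y \<eta> y * F y) * E (\<lambda>y. agrees Y \<eta> y * G y)"
  using sum_agrees_product[OF assms, of \<eta> q] by (simp add: E_def)

end

section \<open>Closures and local distributions\<close>

text \<open>The factor 3 leaves room for a closure of at most \<open>L * (r + 1)\<close> constraints
  together with twice as many others.\<close>

locale expanding_csp = csp_instance k t sc q n m \<mu> sh
  for k t :: nat and sc :: "nat \<Rightarrow> nat \<Rightarrow> nat" and q n m :: nat
    and \<mu> :: "(nat \<Rightarrow> nat) pmf" and sh :: "nat \<Rightarrow> nat \<Rightarrow> nat" +
  fixes L r :: nat
  assumes L_pos: "0 < L"
    and expanding: "\<And>D. D \<subseteq> {..<m} \<Longrightarrow> D \<noteq> {} \<Longrightarrow> card D \<le> 3 * (L * (r + 1)) \<Longrightarrow>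
    2 * int (card D) \<le> int L * psi {} D"
begin

definition b :: nat where "b = L * (r + 1)"

lemma finite_sub: "D \<subseteq> {..<m} \<Longrightarrow> finite D"
  by (rule finite_subset) auto

lemma psi_empty_pos:
  assumes "D \<subseteq> {..<m}" "D \<noteq> {}" "card D \<le> 3 * b"
  shows "0 < psi {} D"
proof -
  have "0 < card D" using assms finite_sub by (simp add: card_gt_0_iff)
  then have "0 < int L * psi {} D" using expanding[of D] assms by (simp add: b_def)
  then show ?thesis by (simp add: zero_less_mult_iff)
qed

text \<open>A gap in the possible sizes: expansion and \<open>psi {} D \<le> 2 + 2 * r\<close>
  improve the bound \<open>3 * b\<close> to \<open>b\<close>. Sets with small \<open>psi\<close> can
  therefore be merged repeatedly without their sizes growing.\<close>

lemma card_le_of_psi_le_two: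
  assumes "D \<subseteq> {..<m}" "card D \<le> 3 * b" "finite S" "card S \<le> r" "psi S D \<le> 2"
  shows "card D \<le> b"
proof (cases "D = {}")
  case False
  have "2 * int (card D) \<le> int L * psi {} D"
    using expanding[of D] False assms by (simp add: b_def)
  also have "\<dots> \<le> int L * (2 + 2 * int r)"
    using psi_empty_le[of D S] assms finite_sub by (intro mult_left_mono) force+
  finally have "int (card D) \<le> int (L * (r + 1))" by (simp add: algebra_simps)
  then show ?thesis unfolding b_def by (simp only: of_nat_le_iff)
qed simp

text \<open>The fourth clause makes small sets of constraints outside \<open>C\<close> removable.
  The fifth says that \<open>C\<close> cannot be cut back to a subset with smaller
  \<open>psi S\<close>; monotonicity in \<open>S\<close> rests on it.\<close>

definition is_closure :: "nat set \<Rightarrow> nat set \<Rightarrow> bool" where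
  "is_closure S C \<longleftrightarrow> C \<subseteq> {..<m} \<and> card C \<le> b \<and> psi S C \<le> 0 \<and>
     (\<forall>D. D \<subseteq> {..<m} - C \<longrightarrow> D \<noteq> {} \<longrightarrow> card D \<le> 2 * b \<longrightarrow> 0 < psi (S \<union> Vs C) D) \<and>
     (\<forall>D. D \<subseteq> C \<longrightarrow> psi (S \<union> Vs D) (C - D) \<le> 0)"

text \<open>A minimiser of \<open>psi S\<close> of maximal cardinality; the factor \<open>3 * b + 1\<close> makes the
  cardinality a tie-breaker.\<close>

lemma ex_closure:
  assumes S: "finite S" "card S \<le> r"
  shows "\<exists>C. is_closure S C"
proof -
  define F where "F C = (3 * int b + 1) * psi S C - int (card C)" for C
  define \<A> where "\<A> = {C. C \<subseteq> {..<m} \<and> card C \<le> 3 * b}"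
  have A: "finite \<A>" "{} \<in> \<A>" by (auto simp: \<A>_def)
  define C where "C = arg_min_on F \<A>"
  have CA: "C \<in> \<A>" unfolding C_def using A by (intro arg_min_if_finite) auto
  have min: "F C \<le> F D" if "D \<in> \<A>" for D
    unfolding C_def using A that by (intro arg_min_least) auto
  have Cm: "C \<subseteq> {..<m}" and Cb: "card C \<le> 3 * b" using CA by (auto simp: \<A>_def)
  have le: "psi S C \<le> psi S D" if "D \<in> \<A>" for D
  proof (rule ccontr)
    assume "\<not> ?thesis"
    then have "(3 * int b + 1) * (psi S D + 1) \<le> (3 * int b + 1) * psi S C"
      by (intro mult_left_mono) auto
    then show False using min[OF that] Cb by (simp add: F_def algebra_simps)
  qed
  have 0: "psi S C \<le> 0" using le[OF A(2)] by simp
  then have 1: "card C \<le> b" using card_le_of_psi_le_two[OF Cm Cb S] by simp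
  \<comment> \<open>Otherwise adjoining \<open>D\<close> would not raise \<open>psi S\<close> and
    would strictly lower \<open>F\<close>. The enlarged set still competes, since the size gap has
    reduced \<open>card C\<close> to at most \<open>b\<close>.\<close>
  have 2: "0 < psi (S \<union> Vs C) D" if D: "D \<subseteq> {..<m} - C" "D \<noteq> {}" "card D \<le> 2 * b" for D
  proof (rule ccontr)
    assume "\<not> ?thesis"
    moreover have fin: "finite C" "finite D" using Cm D(1) finite_sub[of C] finite_sub[of D] by auto
    moreover have "C \<inter> D = {}" using D by auto
    ultimately have "psi S (C \<union> D) \<le> psi S C" using psi_Un_disjoint[of C D S] by simp
    then have "(3 * int b + 1) * psi S (C \<union> D) \<le> (3 * int b + 1) * psi S C"
      by (intro mult_left_mono) auto
    moreover have card: "card (C \<union> D) = card C + card D"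
      using fin \<open>C \<inter> D = {}\<close> by (rule card_Un_disjoint)
    then have "C \<union> D \<in> \<A>" using Cm D 1 by (auto simp: \<A>_def)
    from min[OF this] have "F C \<le> F (C \<union> D)" .
    moreover have "0 < card D" using D fin by (simp add: card_gt_0_iff)
    ultimately show False unfolding F_def card of_nat_add by linarith
  qed
  have 3: "psi (S \<union> Vs D) (C - D) \<le> 0" if "D \<subseteq> C" for D
  proof -
    have fin: "finite C" using Cm finite_sub by auto
    then have fD: "finite D" using that by (rule rev_finite_subset)
    have "D \<in> \<A>" using that Cm Cb card_mono[OF fin that] by (auto simp: \<A>_def)
    moreover have "psi S C = psi S D + psi (S \<union> Vs D) (C - D)"
      using psi_Un_disjoint[of D "C - D" S] fin fD that by (simp add: Un_absorb1)
    ultimately show ?thesis using le[of D] by simp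
  qed
  show ?thesis using Cm 0 1 2 3 unfolding is_closure_def by blast
qed

definition cl :: "nat set \<Rightarrow> nat set" where
  "cl S = (SOME C. is_closure S C)"

lemma is_closure_cl: "finite S \<Longrightarrow> card S \<le> r \<Longrightarrow> is_closure S (cl S)"
  unfolding cl_def by (rule someI_ex) (rule ex_closure)

lemma cl_subset: "finite S \<Longrightarrow> card S \<le> r \<Longrightarrow> cl S \<subseteq> {..<m}"
  and card_cl: "finite S \<Longrightarrow> card S \<le> r \<Longrightarrow> card (cl S) \<le> b"
  and psi_cl: "finite S \<Longrightarrow> card S \<le> r \<Longrightarrow> psi S (cl S) \<le> 0"
  using is_closure_cl unfolding is_closure_def by blast+

lemma psi_cl_pos:
  "finite S \<Longrightarrow> card S \<le> r \<Longrightarrow> D \<subseteq> {..<m} - cl S \<Longrightarrow> D \<noteq> {} \<Longrightarrow> card D \<le> 2 * b \<Longrightarrow>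
    0 < psi (S \<union> Vs (cl S)) D"
  using is_closure_cl unfolding is_closure_def by blast

lemma psi_cl_Diff:
  "finite S \<Longrightarrow> card S \<le> r \<Longrightarrow> D \<subseteq> cl S \<Longrightarrow> psi (S \<union> Vs D) (cl S - D) \<le> 0"
  using is_closure_cl unfolding is_closure_def by blast

text \<open>By the fifth clause the part of \<open>cl S\<close> outside \<open>cl S'\<close> has
  nonpositive \<open>psi\<close> over \<open>S\<close> and the common part. Enlarging the base set
  only lowers \<open>psi\<close>, which contradicts the fourth clause for
  \<open>cl S'\<close>.\<close>

lemma cl_mono:
  assumes "S \<subseteq> S'" "finite S'" "card S' \<le> r"
  shows "cl S \<subseteq> cl S'"
proof (rule ccontr)
  assume "\<not> ?thesis"
  then have ne: "cl S - cl S' \<noteq> {}" by blast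
  have S: "finite S" "card S \<le> r"
    using assms finite_subset card_mono[of S' S] by auto
  have fin: "finite (cl S)" using cl_subset[OF S] finite_sub by blast
  have "psi (S' \<union> Vs (cl S')) (cl S - cl S') \<le> psi (S \<union> Vs (cl S \<inter> cl S')) (cl S - cl S')"
    using assms fin Vs_mono[of "cl S \<inter> cl S'" "cl S'"] by (intro psi_antimono) auto
  also have "\<dots> = psi (S \<union> Vs (cl S \<inter> cl S')) (cl S - (cl S \<inter> cl S'))"
    by (simp add: Diff_Int)
  also have "\<dots> \<le> 0" by (rule psi_cl_Diff[OF S]) auto
  finally show False
    using psi_cl_pos[OF assms(2,3) _ ne] cl_subset[OF S] card_cl[OF S]
      card_mono[OF fin, of "cl S - cl S'"] by fastforce
qed

lemma E_cl_extend:
  assumes S: "finite S" "card S \<le> r" and U: "U \<subseteq> {..<m}" "cl S \<subseteq> U" "card (U - cl S) \<le> 2 * b"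
    and f: "depends_on (S \<union> Vs (cl S)) f"
  shows "E (\<lambda>y. f y * wt U y) = E (\<lambda>y. f y * wt (cl S) y)"
proof (rule E_wt_extend[OF U(2,1) _ f])
  show "Vs (cl S) \<subseteq> S \<union> Vs (cl S)" by simp
  fix D assume D: "D \<subseteq> U - cl S" "D \<noteq> {}"
  have "finite (U - cl S)" using U finite_sub by blast
  then have "card D \<le> 2 * b" using D U card_mono[of "U - cl S" D] by linarith
  then show "0 < psi (S \<union> Vs (cl S)) D"
    using D U by (intro psi_cl_pos S) auto
qed

section \<open>Local distributions\<close>

lemma E_wt_eq_one:
  assumes "U \<subseteq> {..<m}" "card U \<le> b"
  shows "E (wt U) = 1"
proof -
  have "E (\<lambda>y. 1 * wt U y) = E (\<lambda>_. 1)"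
  proof (rule E_wt_removable[OF assms(1) _ depends_on_const])
    fix D assume D: "D \<subseteq> U" "D \<noteq> {}"
    then have "card D \<le> 3 * b"
      using card_mono[of U D] finite_sub[OF assms(1)] assms(2) by simp
    then show "0 < psi {} D" using D assms by (intro psi_empty_pos) auto
  qed
  then show ?thesis by simp
qed

text \<open>A probability distribution when \<open>card U \<le> b\<close>: the weights then have
  average exactly 1, so no normalising constant appears and different \<open>U\<close> can be
  compared directly.\<close>

definition joint :: "nat set \<Rightarrow> (nat \<Rightarrow> nat) pmf" where
  "joint U = embed_pmf (\<lambda>y. if y \<in> assignments q {..<n} then wt U y / real q ^ n else 0)"

definition local_dist :: dist_family where
  "local_dist S = map_pmf (\<lambda>y. restrict y S) (joint (cl S))"

lemma
  assumes "U \<subseteq> {..<m}" "card U \<le> b"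
  shows set_joint: "set_pmf (joint U) \<subseteq> assignments q {..<n}"
    and prob_joint: "measure_pmf.prob (joint U) A = E (\<lambda>y. of_bool (y \<in> A) * wt U y)"
proof -
  let ?A = "assignments q {..<n}"
  let ?f = "\<lambda>y. if y \<in> ?A then wt U y / real q ^ n else 0"
  have fin: "finite ?A" by (intro finite_PiE) auto
  have sum: "(\<Sum>y\<in>?A. ?f y) = 1"
    using E_wt_eq_one[OF assms] by (simp add: E_def sum_divide_distrib)
  have "(\<integral>\<^sup>+y. ennreal (?f y) \<partial>count_space UNIV) = (\<Sum>y\<in>?A. ennreal (?f y))"
    using fin by (intro nn_integral_count_space') auto
  also have "\<dots> = 1" using sum
    by (subst sum_ennreal) (auto simp: wt_nonneg)
  finally have *: "(\<integral>\<^sup>+y. ennreal (?f y) \<partial>count_space UNIV) = 1" .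
  have pmf: "pmf (joint U) y = ?f y" for y
    unfolding joint_def by (rule pmf_embed_pmf[OF _ *]) (simp add: wt_nonneg)
  show set: "set_pmf (joint U) \<subseteq> ?A"
    by (auto simp: set_pmf_iff pmf split: if_splits)
  have "measure_pmf.prob (joint U) A = measure_pmf.prob (joint U) (A \<inter> ?A)"
    using set by (intro measure_pmf.finite_measure_eq_AE) (auto simp: AE_measure_pmf_iff)
  also have "\<dots> = (\<Sum>y\<in>A \<inter> ?A. wt U y / real q ^ n)"
    using fin by (simp add: measure_measure_pmf_finite pmf)
  also have "\<dots> = (\<Sum>y\<in>?A. of_bool (y \<in> A) * wt U y / real q ^ n)"
    using fin by (intro sum.mono_neutral_cong_left) auto
  finally show "measure_pmf.prob (joint U) A = E (\<lambda>y. of_bool (y \<in> A) * wt U y)"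
    by (simp add: E_def flip: sum_divide_distrib)
qed

lemma prob_local_dist:
  assumes "S \<subseteq> {..<n}" "card S \<le> r"
  shows "measure_pmf.prob (local_dist S) A = E (\<lambda>y. of_bool (restrict y S \<in> A) * wt (cl S) y)"
proof -
  have S: "finite S" using assms finite_subset by blast
  show ?thesis
    unfolding local_dist_def measure_map_pmf
    using prob_joint[OF cl_subset[OF S assms(2)] card_cl[OF S assms(2)]] by simp
qed

text \<open>Closures are monotone, so \<open>cl S\<close> extends \<open>cl T\<close> by at most
  \<open>b\<close> constraints, and averages of functions of \<open>T\<close> do not see this
  extension.\<close>

lemma locally_consistent_local_dist: "locally_consistent q n r local_dist"
  unfolding locally_consistent_def
proof (intro allI impI conjI)
  fix S assume S: "S \<subseteq> {..<n} \<and> card S \<le> r"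
  then have Sf: "finite S" "card S \<le> r" using finite_subset by auto
  show "set_pmf (local_dist S) \<subseteq> assignments q S"
  proof
    fix z assume "z \<in> set_pmf (local_dist S)"
    then obtain y where "y \<in> assignments q {..<n}" "z = restrict y S"
      using set_joint[OF cl_subset[OF Sf] card_cl[OF Sf]] by (auto simp: local_dist_def)
    then show "z \<in> assignments q S" using S by (auto simp: PiE_iff)
  qed
next
  fix S T assume "S \<subseteq> {..<n} \<and> card S \<le> r" and TS: "T \<subseteq> S"
  then have S: "S \<subseteq> {..<n}" "card S \<le> r" by auto
  have Sf: "finite S" using S finite_subset by auto
  have T: "T \<subseteq> {..<n}" "finite T" "card T \<le> r"
    using S TS Sf card_mono[OF Sf TS] finite_subset by auto
  have fin: "finite (cl S)" using cl_subset[OF Sf S(2)] finite_sub by blast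
  show "map_pmf (\<lambda>y. restrict y T) (local_dist S) = local_dist T"
  proof (rule pmf_eqI)
    fix z
    have "pmf (map_pmf (\<lambda>y. restrict y T) (local_dist S)) z
        = E (\<lambda>y. of_bool (restrict (restrict y S) T = z) * wt (cl S) y)"
      by (simp add: pmf_map prob_local_dist[OF S])
    also have "\<dots> = E (\<lambda>y. of_bool (restrict y T = z) * wt (cl S) y)"
      using TS by (simp add: Int_absorb1)
    also have "\<dots> = E (\<lambda>y. of_bool (restrict y T = z) * wt (cl T) y)"
    proof (rule E_cl_extend[OF T(2,3) cl_subset[OF Sf S(2)] cl_mono[OF TS Sf S(2)]])
      show "card (cl S - cl T) \<le> 2 * b"
        using card_cl[OF Sf S(2)] card_mono[OF fin, of "cl S - cl T"] by auto
      show "depends_on (T \<union> Vs (cl T)) (\<lambda>y. of_bool (restrict y T = z))"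
        by (rule depends_on_mono[of T], rule depends_onI) (auto cong: restrict_cong)
    qed
    also have "\<dots> = pmf (local_dist T) z"
      using prob_local_dist[OF T(1,3), of "{z}"] by (simp add: measure_pmf_single)
    finally show "pmf (map_pmf (\<lambda>y. restrict y T) (local_dist S)) z = pmf (local_dist T) z" .
  qed
qed

text \<open>Adjoining constraint \<open>i\<close> to the closure leaves the probability of
  \<open>z\<close> unchanged. As this probability is positive, some \<open>y\<close> extending
  \<open>z\<close> has nonzero \<open>w i y\<close>, and its pattern is already determined by
  \<open>z\<close>.\<close>

lemma pattern_local_dist:
  assumes S: "S \<subseteq> {..<n}" "card S \<le> r" and i: "i < m" "sc i ` {..<k} \<subseteq> S"
    and z: "z \<in> set_pmf (local_dist S)"
  shows "pattern i z \<in> set_pmf \<mu>"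
proof -
  have Sf: "finite S" using S finite_subset by auto
  define f where "f y = (of_bool (restrict y S = z) :: real)" for y
  have bpos: "1 \<le> 2 * b" using L_pos by (simp add: b_def)
  have "0 < pmf (local_dist S) z" using z by (simp add: pmf_positive_iff)
  also have "pmf (local_dist S) z = E (\<lambda>y. f y * wt (cl S) y)"
    using prob_local_dist[OF S, of "{z}"] by (simp add: measure_pmf_single f_def)
  also have "\<dots> = E (\<lambda>y. f y * wt (insert i (cl S)) y)"
  proof (rule E_cl_extend[OF Sf S(2), symmetric])
    show "insert i (cl S) \<subseteq> {..<m}" using cl_subset[OF Sf S(2)] i by auto
    have "card (insert i (cl S) - cl S) \<le> card {i}" by (intro card_mono) auto
    then show "card (insert i (cl S) - cl S) \<le> 2 * b" using bpos by simp
    show "depends_on (S \<union> Vs (cl S)) f"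
      unfolding f_def by (rule depends_on_mono[of S], rule depends_onI) (auto cong: restrict_cong)
  qed auto
  finally have "(\<Sum>y\<in>assignments q {..<n}. f y * wt (insert i (cl S)) y) \<noteq> 0"
    by (auto simp: E_def)
  then obtain y where y: "f y * wt (insert i (cl S)) y \<noteq> 0"
    by (rule sum.not_neutral_contains_not_neutral)
  have fin: "finite (insert i (cl S))" using cl_subset[OF Sf S(2)] finite_sub by auto
  have "w i y \<noteq> 0" using y fin by (auto simp: wt_def)
  then have "pattern i y \<in> set_pmf \<mu>" by (auto simp: w_def set_pmf_iff)
  moreover have "restrict y S = z" using y by (auto simp: f_def)
  then have "y x = z x" if "x \<in> S" for x using that by auto
  then have "pattern i y = pattern i z"
    using i by (auto simp: pattern_def image_subset_iff fun_eq_iff)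
  ultimately show ?thesis by simp
qed

end

section \<open>Conditional covariances\<close>

text \<open>The matrix is block diagonal along the connected components of the graph of its nonzero
  entries, so its total is the sum of the block totals.\<close>

lemma sum_nonneg_of_classes:
  fixes \<kappa> :: "'a \<Rightarrow> 'a \<Rightarrow> real"
  assumes fin: "finite N" and sym: "\<And>i j. i \<in> N \<Longrightarrow> j \<in> N \<Longrightarrow> \<kappa> i j = \<kappa> j i"
  defines "R \<equiv> {(i, j). i \<in> N \<and> j \<in> N \<and> \<kappa> i j \<noteq> 0}"
  assumes nonneg: "\<And>i. i \<in> N \<Longrightarrow> 0 \<le> (\<Sum>j\<in>R\<^sup>* `` {i}. \<Sum>l\<in>R\<^sup>* `` {i}. \<kappa> j l)"
  shows "0 \<le> (\<Sum>i\<in>N. \<Sum>j\<in>N. \<kappa> i j)"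
proof -
  have "sym R" unfolding sym_def R_def using sym by auto
  then have symR: "(j, i) \<in> R\<^sup>*" if "(i, j) \<in> R\<^sup>*" for i j
    using that sym_rtrancl by (meson symD)
  have sub: "R\<^sup>* `` {i} \<subseteq> N" if "i \<in> N" for i
  proof
    fix j assume "j \<in> R\<^sup>* `` {i}"
    then have "(i, j) \<in> R\<^sup>*" by simp
    then show "j \<in> N" using that by induction (auto simp: R_def)
  qed
  define C where "C = (\<lambda>i. R\<^sup>* `` {i}) ` N"
  have UC: "\<Union>C = N" unfolding C_def using sub by auto
  have cls: "R\<^sup>* `` {j} = R\<^sup>* `` {i}" if "(i, j) \<in> R\<^sup>*" for i j
    using that symR[OF that] by (auto intro: rtrancl_trans)
  have eq: "A = R\<^sup>* `` {x}" if "A \<in> C" "x \<in> A" for A x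
    using that cls unfolding C_def by auto
  have disj: "A = B \<or> A \<inter> B = {}" if "A \<in> C" "B \<in> C" for A B
    using eq[OF that(1)] eq[OF that(2)] by blast
  have row: "(\<Sum>j\<in>N. \<kappa> i j) = (\<Sum>j\<in>A. \<kappa> i j)" if "A \<in> C" "i \<in> A" for A i
  proof (rule sum.mono_neutral_right[OF fin])
    show "A \<subseteq> N" using that UC by blast
    show "\<forall>j\<in>N - A. \<kappa> i j = 0"
    proof (rule ballI, rule ccontr)
      fix j assume j: "j \<in> N - A" "\<kappa> i j \<noteq> 0"
      then have "(i, j) \<in> R" using that UC by (auto simp: R_def)
      then show False using eq[OF that] j by blast
    qed
  qed
  have "(\<Sum>i\<in>N. \<Sum>j\<in>N. \<kappa> i j) = (\<Sum>i\<in>\<Union>C. \<Sum>j\<in>N. \<kappa> i j)" by (simp add: UC)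
  also have "\<dots> = (\<Sum>A\<in>C. \<Sum>i\<in>A. \<Sum>j\<in>N. \<kappa> i j)"
  proof -
    have "\<forall>A\<in>C. finite A" using UC fin by (metis Union_upper finite_subset)
    moreover have "\<forall>A\<in>C. \<forall>B\<in>C. A \<noteq> B \<longrightarrow> A \<inter> B = {}" using disj by blast
    ultimately show ?thesis by (subst sum.Union_disjoint) auto
  qed
  also have "\<dots> = (\<Sum>A\<in>C. \<Sum>i\<in>A. \<Sum>j\<in>A. \<kappa> i j)"
    by (rule sum.cong[OF refl], rule sum.cong[OF refl], rule row)
  also have "\<dots> \<ge> 0"
    unfolding C_def by (rule sum_nonneg) (auto intro: nonneg)
  finally show ?thesis .
qed

text \<open>\<eta> is a conditioning of positive mass on \<open>X\<close> and on all variables of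
  its closure. \<open>g i\<close> collects the coefficients that a test vector of the moment matrix
  assigns to variable \<open>i\<close>.\<close>

locale conditioned_csp = expanding_csp k t sc q n m \<mu> sh L r
  for k t :: nat and sc :: "nat \<Rightarrow> nat \<Rightarrow> nat" and q n m :: nat
    and \<mu> :: "(nat \<Rightarrow> nat) pmf" and sh :: "nat \<Rightarrow> nat \<Rightarrow> nat" and L r :: nat +
  fixes X :: "nat set" and \<eta> :: "nat \<Rightarrow> nat" and g :: "nat \<Rightarrow> nat \<Rightarrow> real"
  assumes X: "X \<subseteq> {..<n}" "card X + 2 \<le> r"
    and nonzero: "E (\<lambda>y. agrees (X \<union> Vs (cl X)) \<eta> y * wt (cl X) y) \<noteq> 0"
begin

abbreviation C :: "nat set" where "C \<equiv> cl X"

definition Y :: "nat set" where "Y = X \<union> Vs C"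

text \<open>Unnormalised conditional expectation: the normaliser is \<open>mass\<close>, and the
  identities below are kept free of division.\<close>

definition T :: "nat set \<Rightarrow> ((nat \<Rightarrow> nat) \<Rightarrow> real) \<Rightarrow> real" where
  "T D f = E (\<lambda>y. (agrees Y \<eta> y * f y) * wt D y)"

definition T2 :: "nat \<Rightarrow> nat \<Rightarrow> ((nat \<Rightarrow> nat) \<Rightarrow> real) \<Rightarrow> real" where
  "T2 i j = T (cl (X \<union> {i, j}))"

definition G :: "nat \<Rightarrow> (nat \<Rightarrow> nat) \<Rightarrow> real" where
  "G i y = g i (y i)"

definition mass :: real where "mass = T C (\<lambda>_. 1)"

text \<open>\<open>mass\<^sup>2\<close> times the covariance of \<open>G i\<close> and \<open>G j\<close> conditioned on \<open>\<eta>\<close>.\<close>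

definition kap :: "nat \<Rightarrow> nat \<Rightarrow> real" where
  "kap i j = mass * T2 i j (\<lambda>y. G i y * G j y) - T2 i i (G i) * T2 j j (G j)"

lemma Xr: "finite X" "card X \<le> r"
  using X finite_subset by auto

lemma Xij: "finite (X \<union> {i, j})" "card (X \<union> {i, j}) \<le> r"
proof -
  show "finite (X \<union> {i, j})" using Xr by simp
  have "card (X \<union> {i, j}) \<le> card X + card {i, j}" by (rule card_Un_le)
  also have "card {i, j} \<le> 2" by (simp add: card_insert_if)
  finally show "card (X \<union> {i, j}) \<le> r" using X by simp
qed

lemma C_sub: "C \<subseteq> cl (X \<union> {i, j})"
  by (intro cl_mono Xij) auto

lemma clm: "cl (X \<union> {i, j}) \<subseteq> {..<m}" "C \<subseteq> {..<m}"
  using cl_subset Xij Xr by auto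

lemma fin_cl: "finite (cl (X \<union> {i, j}))" "finite C"
  using clm finite_sub by auto

lemma depends_on_G: "i \<in> W \<Longrightarrow> depends_on W (G i)"
  by (rule depends_onI) (simp add: G_def)

lemma T_extend:
  assumes U: "U \<subseteq> {..<m}" "card U \<le> 2 * b" and f: "depends_on (Y \<union> {i, j}) f"
  shows "T (cl (X \<union> {i, j}) \<union> U) f = T2 i j f"
  unfolding T_def T2_def
proof (rule E_cl_extend[OF Xij])
  show "cl (X \<union> {i, j}) \<union> U \<subseteq> {..<m}" using clm U by auto
  have "card (cl (X \<union> {i, j}) \<union> U - cl (X \<union> {i, j})) \<le> card U"
    using U finite_sub by (intro card_mono) auto
  then show "card (cl (X \<union> {i, j}) \<union> U - cl (X \<union> {i, j})) \<le> 2 * b" using U by simp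
  have "depends_on (Y \<union> {i, j}) (\<lambda>y. agrees Y \<eta> y * f y)"
    by (intro depends_on_mult f depends_on_mono[OF depends_on_agrees]) auto
  then show "depends_on (X \<union> {i, j} \<union> Vs (cl (X \<union> {i, j}))) (\<lambda>y. agrees Y \<eta> y * f y)"
    by (rule depends_on_mono) (use Vs_mono[OF C_sub] in \<open>auto simp: Y_def\<close>)
qed auto

text \<open>Both sides equal the value for the union of the two closures involved, because extending
  either closure by the other leaves the averages in question unchanged.\<close>

lemma T2_left: "T2 i i (G i) = T2 i j (G i)"
proof -
  have "T2 i i (G i) = T (cl (X \<union> {i, i}) \<union> cl (X \<union> {i, j})) (G i)"
    using card_cl[OF Xij, of i j]
    by (intro T_extend[symmetric] clm depends_on_G) auto
  also have "\<dots> = T (cl (X \<union> {i, j}) \<union> cl (X \<union> {i, i})) (G i)"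
    by (simp add: Un_commute)
  also have "\<dots> = T2 i j (G i)"
    using card_cl[OF Xij, of i i]
    by (intro T_extend clm depends_on_G) auto
  finally show ?thesis .
qed

lemma T2_commute: "T2 i j = T2 j i"
  by (simp add: T2_def insert_commute)

lemma T2_right: "T2 j j (G j) = T2 i j (G j)"
  using T2_left[of j i] by (simp add: T2_commute)

lemma mass_eq: "mass = T2 i j (\<lambda>_. 1)"
  unfolding mass_def T2_def T_def
proof (rule E_cl_extend[OF Xr, symmetric])
  show "card (cl (X \<union> {i, j}) - C) \<le> 2 * b"
    using card_cl[OF Xij, of i j] card_mono[OF fin_cl(1), of "cl (X \<union> {i, j}) - C" i j] by auto
  show "depends_on (X \<union> Vs C) (\<lambda>y. agrees Y \<eta> y * 1)"
    unfolding Y_def by (intro depends_on_mult depends_on_agrees depends_on_const)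
qed (rule clm C_sub)+

lemma T_nonneg: "(\<And>y. 0 \<le> f y) \<Longrightarrow> 0 \<le> T D f"
  unfolding T_def by (intro E_nonneg mult_nonneg_nonneg wt_nonneg) (auto simp: agrees_def)

lemma mass_pos: "0 < mass"
  using nonzero T_nonneg[of "\<lambda>_. 1" C] by (auto simp: mass_def T_def Y_def less_le)

lemma T_add: "T D (\<lambda>y. f y + h y) = T D f + T D h"
  unfolding T_def E_add[symmetric] by (rule E_cong) (simp add: algebra_simps)

lemma T_cmult: "T D (\<lambda>y. c * f y) = c * T D f"
  unfolding T_def E_cmult[symmetric] by (rule E_cong) (simp add: algebra_simps)

lemma T_sum: "T D (\<lambda>y. \<Sum>i\<in>I. f i y) = (\<Sum>i\<in>I. T D (f i))"
  unfolding T_def E_sum[symmetric]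
  by (rule E_cong) (simp add: sum_distrib_left sum_distrib_right)

text \<open>Expand the nonnegative expectation of \<open>(mass * h y - T D h)\<^sup>2\<close> and
  cancel one factor \<open>mass\<close>.\<close>

lemma T_Cauchy_Schwarz:
  assumes "T D (\<lambda>_. 1) = mass"
  shows "(T D h)\<^sup>2 \<le> mass * T D (\<lambda>y. h y * h y)"
proof -
  let ?t = "T D h"
  have "0 \<le> T D (\<lambda>y. (mass * h y - ?t)\<^sup>2)" by (rule T_nonneg) simp
  also have "(\<lambda>y. (mass * h y - ?t)\<^sup>2)
      = (\<lambda>y. mass\<^sup>2 * (h y * h y) + ((- 2 * mass * ?t) * h y + ?t\<^sup>2 * 1))"
    by (auto simp: power2_eq_square algebra_simps)
  also have "T D \<dots> = mass\<^sup>2 * T D (\<lambda>y. h y * h y) + ((- 2 * mass * ?t) * ?t + ?t\<^sup>2 * mass)"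
    by (simp only: T_add T_cmult assms)
  also have "\<dots> = mass * (mass * T D (\<lambda>y. h y * h y) - ?t\<^sup>2)"
    by (simp add: power2_eq_square algebra_simps)
  finally show ?thesis using mass_pos by (simp add: zero_le_mult_iff)
qed

lemma kap_sym: "kap i j = kap j i"
  by (simp add: kap_def T2_commute[of j i] mult.commute)

text \<open>The size gap relative to \<open>Y\<close>: by the chain rule
  \<open>psi X (C \<union> D) = psi X C + psi Y D \<le> 2\<close>, so the gap over \<open>X\<close>
  applies to \<open>C \<union> D\<close>.\<close>

lemma card_le_of_psi_Y:
  assumes "D \<subseteq> {..<m} - C" "card D \<le> 2 * b" "psi Y D \<le> 2"
  shows "card D \<le> b"
proof -
  have D: "finite D" "C \<inter> D = {}" "D \<subseteq> {..<m}" using assms finite_sub by auto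
  have "card (C \<union> D) \<le> card C + card D" by (rule card_Un_le)
  then have "card (C \<union> D) \<le> 3 * b" using card_cl[OF Xr] assms by simp
  moreover have "psi X (C \<union> D) \<le> 2"
    using psi_Un_disjoint[OF fin_cl(2) D(1,2), of X] psi_cl[OF Xr] assms by (simp add: Y_def)
  ultimately have "card (C \<union> D) \<le> b"
    using clm D Xr by (intro card_le_of_psi_le_two[of _ X]) auto
  moreover have "card D \<le> card (C \<union> D)" using D fin_cl by (intro card_mono) auto
  ultimately show ?thesis by simp
qed

lemma psi_Y_pos: "D \<subseteq> {..<m} - C \<Longrightarrow> D \<noteq> {} \<Longrightarrow> card D \<le> 2 * b \<Longrightarrow> 0 < psi Y D"
  unfolding Y_def by (rule psi_cl_pos[OF Xr])

text \<open>Conditioning fixes all variables of \<open>C\<close>, so the weight of \<open>C\<close>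
  is a constant factor.\<close>

lemma T_Un:
  assumes "D \<subseteq> {..<m} - C"
  shows "T (C \<union> D) f = wt C \<eta> * E (\<lambda>y. agrees Y \<eta> y * (f y * wt D y))"
  unfolding T_def E_cmult[symmetric]
proof (rule E_cong)
  fix y
  have "finite D" "C \<inter> D = {}" using assms finite_sub by auto
  then have *: "wt (C \<union> D) y = wt C y * wt D y" by (intro wt_Un fin_cl)
  show "agrees Y \<eta> y * f y * wt (C \<union> D) y = wt C \<eta> * (agrees Y \<eta> y * (f y * wt D y))"
  proof (cases "agrees Y \<eta> y = 0")
    case False
    then have "wt C y = wt C \<eta>"
      by (intro depends_onD[OF depends_on_wt]) (auto simp: agrees_def Y_def)
    then show ?thesis using * by simp
  qed simp
qed

text \<open>If the constraints split into two parts with disjoint sets of free variables, then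
  \<open>y i\<close> and \<open>y j\<close> are conditionally independent.\<close>

lemma kap_eq_0:
  assumes AB: "A \<union> B \<subseteq> {..<m} - C" "A \<inter> B = {}"
    and sep: "({i} \<union> Vs A) \<inter> ({j} \<union> Vs B) \<subseteq> Y" and j: "j < n"
    and T: "\<And>f. depends_on (Y \<union> {i, j}) f \<Longrightarrow> T2 i j f = T (C \<union> (A \<union> B)) f"
  shows "kap i j = 0"
proof -
  let ?a = "agrees Y \<eta>"
  define \<kappa> where "\<kappa> = wt C \<eta>"
  have fin: "finite A" "finite B" using AB finite_sub[of A] finite_sub[of B] by auto
  have B: "{j} \<union> Vs B \<subseteq> {..<n}" using AB Vs_subset[of B] j by auto
  have split: "E (\<lambda>y. ?a y * ((f y * h y) * wt (A \<union> B) y)) * E ?a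
      = E (\<lambda>y. ?a y * (f y * wt A y)) * E (\<lambda>y. ?a y * (h y * wt B y))"
    if "depends_on {i} f" "depends_on {j} h" for f h
  proof -
    have "depends_on (Y \<union> ({i} \<union> Vs A)) (\<lambda>y. f y * wt A y)"
      by (intro depends_on_mult depends_on_mono[OF that(1)] depends_on_mono[OF depends_on_wt]) auto
    moreover have "depends_on (Y \<union> ({j} \<union> Vs B)) (\<lambda>y. h y * wt B y)"
      by (intro depends_on_mult depends_on_mono[OF that(2)] depends_on_mono[OF depends_on_wt]) auto
    ultimately have "E (\<lambda>y. ?a y * ((f y * wt A y) * (h y * wt B y))) * E ?a
      = E (\<lambda>y. ?a y * (f y * wt A y)) * E (\<lambda>y. ?a y * (h y * wt B y))"
      using sep B by (rule E_agrees_product)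
    then show ?thesis by (simp add: wt_Un[OF fin AB(2)] algebra_simps)
  qed
  have Gi: "depends_on {i} (G i)" and Gj: "depends_on {j} (G j)"
    by (simp_all add: depends_on_G)
  note dc = depends_on_const[of _ "1::real"]
  have T2: "T2 i j (\<lambda>y. f y * h y) = \<kappa> * E (\<lambda>y. ?a y * ((f y * h y) * wt (A \<union> B) y))"
    if "depends_on {i} f" "depends_on {j} h" for f h
    unfolding \<kappa>_def T_Un[OF AB(1), symmetric]
    by (intro T depends_on_mult depends_on_mono[OF that(1)] depends_on_mono[OF that(2)]) auto
  \<comment> \<open>Conditional moments of the two parts, without and with the test function. By
    independence each moment of the pair is one factor from \<open>A\<close> times one from
    \<open>B\<close>, up to \<kappa> and \<open>e\<close>.\<close>
  define a1 where "a1 = E (\<lambda>y. ?a y * (1 * wt A y))"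
  define ag where "ag = E (\<lambda>y. ?a y * (G i y * wt A y))"
  define b1 where "b1 = E (\<lambda>y. ?a y * (1 * wt B y))"
  define bg where "bg = E (\<lambda>y. ?a y * (G j y * wt B y))"
  define e where "e = E ?a"
  have mass: "mass = \<kappa> * e"
    using T_Un[of "{}" "\<lambda>_. 1"] by (simp add: mass_def \<kappa>_def e_def)
  then have ne: "\<kappa> \<noteq> 0" "e \<noteq> 0" using mass_pos by auto
  have 1: "T2 i j (\<lambda>y. G i y * G j y) * e = \<kappa> * (ag * bg)"
    using split[OF Gi Gj] unfolding T2[OF Gi Gj] ag_def bg_def e_def by simp
  have 2: "T2 i j (\<lambda>y. G i y * 1) * e = \<kappa> * (ag * b1)"
    using split[OF Gi dc] unfolding T2[OF Gi dc] ag_def b1_def e_def by simp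
  have 3: "T2 i j (\<lambda>y. 1 * G j y) * e = \<kappa> * (a1 * bg)"
    using split[OF dc Gj] unfolding T2[OF dc Gj] a1_def bg_def e_def by simp
  have 4: "T2 i j (\<lambda>y. 1 * 1) * e = \<kappa> * (a1 * b1)"
    using split[OF dc dc] unfolding T2[OF dc dc] a1_def b1_def e_def by simp
  have ab: "e * e = a1 * b1" using 4 mass mass_eq[of i j] ne by simp
  have "kap i j * (e * e) = \<kappa> * e * (T2 i j (\<lambda>y. G i y * G j y) * e) * e
      - (T2 i j (\<lambda>y. G i y * 1) * e) * (T2 i j (\<lambda>y. 1 * G j y) * e)"
    unfolding kap_def T2_left[of i j] T2_right[of j i] mass by (simp add: algebra_simps)
  also have "\<dots> = \<kappa> * \<kappa> * (ag * bg) * (e * e - a1 * b1)"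
    unfolding 1 2 3 by (simp add: algebra_simps)
  also have "\<dots> = 0" unfolding ab by simp
  finally show ?thesis using ne by simp
qed

text \<open>\<open>D\<close> is the tight core, over \<open>Y \<union> {i, j}\<close>, of the
  constraints that \<open>cl (X \<union> {i, j})\<close> adds to \<open>C\<close>. Tightness gives
  \<open>psi Y D \<le> 2\<close>, with one unit for each of \<open>i\<close>, \<open>j\<close> that
  has degree 1. The last property excludes the value 2 when a piece with \<open>psi\<close> at most
  1 contains \<open>i\<close> or \<open>j\<close>: its complement would separate the two variables
  and make \<open>kap i j\<close> vanish.\<close>

lemma link:
  assumes kap: "kap i j \<noteq> 0" and ij: "i \<noteq> j" "i < n" "j < n"
  obtains D where "D \<subseteq> {..<m} - C" "card D \<le> b" "i \<in> Vs D - Y" "j \<in> Vs D - Y" "psi Y D \<le> 2"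
    "\<forall>A\<subseteq>D. psi Y A \<le> 1 \<longrightarrow> i \<in> Vs A \<or> j \<in> Vs A \<longrightarrow> psi Y D \<le> 1"
proof -
  define U where "U = cl (X \<union> {i, j}) - C"
  have U: "U \<subseteq> {..<m}" using clm by (auto simp: U_def)
  obtain D where D: "D \<subseteq> U" "tight (Y \<union> {i, j}) D"
    and Dcore: "\<And>f. depends_on (Y \<union> {i, j}) f \<Longrightarrow> E (\<lambda>y. f y * wt U y) = E (\<lambda>y. f y * wt D y)"
    using tight_core[OF U, of "Y \<union> {i, j}"] by blast
  have finU: "finite U" and finD: "finite D" using U D(1) finite_sub by auto
  have Dm: "D \<subseteq> {..<m} - C" using D(1) U by (auto simp: U_def)
  have "card D \<le> card U" using finU D(1) by (rule card_mono)
  also have "card U \<le> card (cl (X \<union> {i, j}))" unfolding U_def by (intro card_mono fin_cl) auto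
  also have "\<dots> \<le> b" by (rule card_cl[OF Xij])
  finally have cD: "card D \<le> b" .
  have core: "T2 i j f = T (C \<union> D) f" if f: "depends_on (Y \<union> {i, j}) f" for f
  proof -
    have "T2 i j f = T (C \<union> U) f" using C_sub[of i j] by (simp add: T2_def U_def Un_absorb1)
    also have "\<dots> = wt C \<eta> * E (\<lambda>y. (agrees Y \<eta> y * f y) * wt U y)"
      using U by (subst T_Un) (auto simp: U_def mult.assoc)
    also have "E (\<lambda>y. (agrees Y \<eta> y * f y) * wt U y) = E (\<lambda>y. (agrees Y \<eta> y * f y) * wt D y)"
      by (intro Dcore depends_on_mult f depends_on_mono[OF depends_on_agrees]) auto
    also have "wt C \<eta> * \<dots> = T (C \<union> D) f"
      using Dm by (subst T_Un) (auto simp: mult.assoc)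
    finally show ?thesis .
  qed
  have core': "T2 j i f = T (C \<union> D) f" if f: "depends_on (Y \<union> {j, i}) f" for f
    using core[of f] f by (simp add: T2_commute[of j i] insert_commute)
  \<comment> \<open>If \<open>i\<close> is not a free variable of \<open>D\<close>, the split into
    the empty set and \<open>D\<close> already separates it from \<open>j\<close>.\<close>
  have i: "i \<in> Vs D - Y"
  proof (rule ccontr)
    assume "\<not> ?thesis"
    then have "kap i j = 0"
      using Dm core ij by (intro kap_eq_0[of "{}" D]) auto
    then show False using kap by simp
  qed
  have j: "j \<in> Vs D - Y"
  proof (rule ccontr)
    assume "\<not> ?thesis"
    then have "kap i j = 0"
      using Dm core ij by (intro kap_eq_0[of D "{}"]) auto
    then show False using kap by simp
  qed
  have psiD: "psi Y D \<le> int (card {v \<in> {i, j}. deg D v = 1})"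
  proof -
    have "psi Y D \<le> int (card {v \<in> Vs D - Y. deg D v = 1 \<and> (v \<in> {i, j} \<or> v \<in> Vs (D - D))})"
      by (rule psi_le_of_tight[OF finD D(2)]) simp
    also have "{v \<in> Vs D - Y. deg D v = 1 \<and> (v \<in> {i, j} \<or> v \<in> Vs (D - D))}
        = {v \<in> {i, j}. deg D v = 1}" using i j by auto
    finally show ?thesis .
  qed
  also have "\<dots> \<le> int (card {i, j})" by (simp del: Collect_conj_eq, intro card_mono) auto
  finally have psi2: "psi Y D \<le> 2" using ij by simp
  have red: "psi Y D \<le> 1"
    if A: "A \<subseteq> D" "psi Y A \<le> 1" and uv: "{u, v} = {i, j}" "u \<in> Vs A"
      and Tuv: "\<And>f. depends_on (Y \<union> {u, v}) f \<Longrightarrow> T2 u v f = T (C \<union> D) f"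
      and kuv: "kap u v \<noteq> 0" for A u v
  proof (rule ccontr)
    assume "\<not> ?thesis"
    then have psiD2: "2 \<le> psi Y D" by simp
    \<comment> \<open>The value 2 is reached only if both variables have degree 1, so each of them
      occurs in just one of \<open>A\<close> and \<open>B\<close>.\<close>
    have deg1: "deg D x = 1" if "x \<in> {i, j}" for x
    proof (rule ccontr)
      assume "deg D x \<noteq> 1"
      then have "{v \<in> {i, j}. deg D v = 1} \<subseteq> {i, j} - {x}" by auto
      then have "card {v \<in> {i, j}. deg D v = 1} \<le> card ({i, j} - {x})" by (intro card_mono) auto
      also have "\<dots> = 1" using that ij by auto
      finally show False using psiD psiD2 by simp
    qed
    define B where "B = D - A"
    have fA: "finite A" "finite B" using A finD finite_subset by (auto simp: B_def)
    have DAB: "D = A \<union> B" "A \<inter> B = {}" using A by (auto simp: B_def)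
    have degs: "deg D x = deg A x + deg B x" for x
      unfolding B_def using finD A(1) by (rule deg_Diff)
    have in_one: "x \<notin> Vs A \<or> x \<notin> Vs B" if "x \<in> {i, j}" for x
      using deg1[OF that] degs[of x] deg_pos_iff[OF fA(1), of x] deg_pos_iff[OF fA(2), of x]
      by linarith
    have uB: "u \<notin> Vs B" using in_one[of u] uv by blast
    \<comment> \<open>\<open>s\<close> counts the free variables shared by the two pieces.
      Submodularity gives \<open>psi Y B \<ge> 1 + 2 * s\<close>, while tightness gives at most
      \<open>s\<close>, plus 1 if \<open>v\<close> occurs in \<open>B\<close>. Hence
      \<open>s = 0\<close> and \<open>v\<close> is in \<open>B\<close>: the pieces separate
      \<open>u\<close> from \<open>v\<close>.\<close>
    define s where "s = card (Vs A \<inter> Vs B - Y)"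
    have psiB: "psi Y B \<ge> 1 + 2 * int s"
      using psi_Un_Int[OF fA, of Y] DAB psiD2 A(2) by (simp add: s_def)
    have "psi Y B \<le> int (card {x \<in> Vs B - Y. deg B x = 1 \<and> (x \<in> {i, j} \<or> x \<in> Vs (D - B))})"
      using finD D(2) by (rule psi_le_of_tight) (auto simp: B_def)
    also have "\<dots> \<le> int (card ((Vs A \<inter> Vs B - Y) \<union> ({v} \<inter> Vs B)))"
    proof -
      have "{x \<in> Vs B - Y. deg B x = 1 \<and> (x \<in> {i, j} \<or> x \<in> Vs (D - B))}
          \<subseteq> (Vs A \<inter> Vs B - Y) \<union> ({v} \<inter> Vs B)"
        using uB uv(1) DAB by (auto simp: Diff_Int_distrib2 Un_Diff Diff_triv)
      then show ?thesis using fA by (simp add: card_mono)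
    qed
    also have "\<dots> \<le> int s + int (card ({v} \<inter> Vs B))"
      unfolding s_def of_nat_add[symmetric] of_nat_le_iff by (rule card_Un_le)
    finally have "1 + int s \<le> int (card ({v} \<inter> Vs B))" using psiB by simp
    moreover have "card ({v} \<inter> Vs B) \<le> 1" using card_mono[of "{v}" "{v} \<inter> Vs B"] by simp
    ultimately have s0: "s = 0" and "card ({v} \<inter> Vs B) \<noteq> 0" by linarith+
    then have "v \<in> Vs B" by (cases "v \<in> Vs B") auto
    then have vA: "v \<notin> Vs A" using in_one[of v] uv by blast
    have "Vs A \<inter> Vs B \<subseteq> Y" using s0 fA by (auto simp: s_def)
    moreover have "u \<noteq> v" using uB \<open>v \<in> Vs B\<close> by auto
    ultimately have sep: "({u} \<union> Vs A) \<inter> ({v} \<union> Vs B) \<subseteq> Y" using uB vA by auto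
    have "v < n" using uv(1) ij by auto
    have "kap u v = 0"
      using Dm Tuv DAB by (intro kap_eq_0[OF _ _ sep \<open>v < n\<close>]) auto
    then show False using kuv by simp
  qed
  show thesis
  proof (rule that[OF Dm cD i j psi2], intro allI impI)
    fix A assume A: "A \<subseteq> D" "psi Y A \<le> 1" "i \<in> Vs A \<or> j \<in> Vs A"
    from A(3) show "psi Y D \<le> 1"
    proof
      assume "i \<in> Vs A"
      then show ?thesis using kap core by (intro red[OF A(1,2), of i j]) auto
    next
      assume "j \<in> Vs A"
      then show ?thesis
        using kap core' kap_sym by (intro red[OF A(1,2), of j i]) (auto simp: insert_commute)
    qed
  qed
qed

section \<open>Connected components of the correlation graph\<close>

definition linked :: "(nat \<times> nat) set" where
  "linked = {(i, j). i \<in> {..<n} \<and> j \<in> {..<n} \<and> kap i j \<noteq> 0}"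

text \<open>If one nonnegative weight yields all pair moments on \<open>K\<close>, then
  \<open>kap\<close> is a scaled covariance matrix there, and the double sum is the scaled variance
  of the sum of the \<open>G i\<close>.\<close>

lemma sum_kap_nonneg_of_joint:
  assumes "finite K" and mass: "T D (\<lambda>_. 1) = mass"
    and T2: "\<And>i j f. i \<in> K \<Longrightarrow> j \<in> K \<Longrightarrow> depends_on (Y \<union> {i, j}) f \<Longrightarrow> T2 i j f = T D f"
  shows "0 \<le> (\<Sum>i\<in>K. \<Sum>j\<in>K. kap i j)"
proof -
  let ?h = "\<lambda>y. \<Sum>i\<in>K. G i y"
  have dep: "depends_on (Y \<union> {i, j}) (G i)" "depends_on (Y \<union> {i, j}) (G j)" for i j
    by (simp_all add: depends_on_G)
  have "kap i j = mass * T D (\<lambda>y. G i y * G j y) - T D (G i) * T D (G j)"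
    if "i \<in> K" "j \<in> K" for i j
  proof -
    have "T2 i i (G i) = T D (G i)" "T2 j j (G j) = T D (G j)"
      by (rule T2[OF that(1) that(1) dep(1)], rule T2[OF that(2) that(2) dep(2)])
    then show ?thesis
      unfolding kap_def by (simp only: T2[OF that depends_on_mult[OF dep]])
  qed
  then have "(\<Sum>i\<in>K. \<Sum>j\<in>K. kap i j)
      = (\<Sum>i\<in>K. \<Sum>j\<in>K. mass * T D (\<lambda>y. G i y * G j y) - T D (G i) * T D (G j))"
    by (intro sum.cong refl) auto
  also have "\<dots> = mass * (\<Sum>i\<in>K. \<Sum>j\<in>K. T D (\<lambda>y. G i y * G j y))
      - (\<Sum>i\<in>K. T D (G i)) * (\<Sum>j\<in>K. T D (G j))"
    by (simp only: sum_subtractf sum_distrib_left[symmetric] sum_product)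
  also have "\<dots> = mass * T D (\<lambda>y. ?h y * ?h y) - (T D ?h)\<^sup>2"
    by (simp add: T_sum sum_product power2_eq_square)
  also have "\<dots> \<ge> 0" using T_Cauchy_Schwarz[OF mass, of ?h] by simp
  finally show ?thesis .
qed

text \<open>Among the small sets with \<open>psi Y H \<le> 2\<close> and \<open>i0\<close> among
  their free variables, take one of maximal cardinality. Every link that starts at a variable of
  \<open>H\<close> is absorbed by \<open>H\<close>, so \<open>H\<close> carries the whole component,
  and \<open>C \<union> H\<close> supplies a common joint weight for it.\<close>

lemma sum_kap_class_nonneg:
  assumes i0: "i0 < n"
  shows "0 \<le> (\<Sum>i\<in>linked\<^sup>* `` {i0}. \<Sum>j\<in>linked\<^sup>* `` {i0}. kap i j)"
proof (cases "\<exists>j. j \<noteq> i0 \<and> (i0, j) \<in> linked")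
  case False
  have "(i0, j) \<in> linked\<^sup>* \<Longrightarrow> j = i0" for j
    by (induction rule: rtrancl_induct) (use False in auto)
  then have K: "linked\<^sup>* `` {i0} = {i0}" by auto
  show ?thesis
    unfolding K by (rule sum_kap_nonneg_of_joint[of _ "cl (X \<union> {i0, i0})"])
      (use mass_eq[of i0 i0] in \<open>simp_all add: T2_def\<close>)
next
  case True
  then obtain j0 where "j0 \<noteq> i0" "(i0, j0) \<in> linked" by blast
  then have j0: "i0 \<noteq> j0" "j0 < n" "kap i0 j0 \<noteq> 0" by (auto simp: linked_def)
  define \<F> where "\<F> = {H. H \<subseteq> {..<m} - C \<and> card H \<le> b \<and> psi Y H \<le> 2 \<and> i0 \<in> Vs H - Y}"
  have "\<F> \<noteq> {}"
  proof -
    obtain D where "D \<subseteq> {..<m} - C" "card D \<le> b" "i0 \<in> Vs D - Y" "psi Y D \<le> 2"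
      by (rule link[OF j0(3) j0(1) i0 j0(2)])
    then have "D \<in> \<F>" by (simp add: \<F>_def)
    then show ?thesis by blast
  qed
  have "finite \<F>" unfolding \<F>_def by (rule finite_subset[of _ "Pow {..<m}"]) auto
  have "\<exists>H\<in>\<F>. \<forall>H'\<in>\<F>. card H' \<le> card H"
  proof -
    have "Max (card ` \<F>) \<in> card ` \<F>" using \<open>finite \<F>\<close> \<open>\<F> \<noteq> {}\<close> by (intro Max_in) auto
    then obtain H where "H \<in> \<F>" "card H = Max (card ` \<F>)" by auto
    then show ?thesis using \<open>finite \<F>\<close> by (intro bexI[of _ H]) auto
  qed
  then obtain H where H: "H \<in> \<F>" and max: "\<And>H'. H' \<in> \<F> \<Longrightarrow> card H' \<le> card H" by blast
  have Hm: "H \<subseteq> {..<m} - C" "card H \<le> b" "psi Y H \<le> 2" "i0 \<in> Vs H - Y"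
    using H by (auto simp: \<F>_def)
  have fH: "finite H" using Hm(1) finite_sub by auto
  \<comment> \<open>The union has at most \<open>2 * b\<close> constraints, the size gap brings it
    below \<open>b\<close>, and so it belongs to the family in which \<open>H\<close> is
    maximal.\<close>
  have absorb: "D \<subseteq> H" if D: "D \<subseteq> {..<m} - C" "card D \<le> b" "psi Y (D \<union> H) \<le> 2" for D
  proof -
    have fD: "finite D" using D(1) finite_sub by auto
    have "card (D \<union> H) \<le> card D + card H" by (rule card_Un_le)
    then have "card (D \<union> H) \<le> b"
      using D Hm by (intro card_le_of_psi_Y) auto
    then have "D \<union> H \<in> \<F>" using D Hm by (auto simp: \<F>_def Vs_Un)
    from max[OF this] have "H = D \<union> H"
      using fD fH by (intro card_seteq) auto
    then show ?thesis by blast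
  qed
  have K: "j \<in> Vs H - Y" if "(i0, j) \<in> linked\<^sup>*" for j
    using that
  proof (induction rule: rtrancl_induct)
    case base
    show ?case by (rule Hm(4))
  next
    case (step j l)
    show ?case
    proof (cases "j = l")
      case True
      then show ?thesis using step by simp
    next
      case False
      have jl: "kap j l \<noteq> 0" "j < n" "l < n" using step.hyps(2) by (auto simp: linked_def)
      obtain D where D: "D \<subseteq> {..<m} - C" "card D \<le> b" "j \<in> Vs D - Y" "l \<in> Vs D - Y" "psi Y D \<le> 2"
        and Dred: "\<forall>A\<subseteq>D. psi Y A \<le> 1 \<longrightarrow> j \<in> Vs A \<or> l \<in> Vs A \<longrightarrow> psi Y D \<le> 1"
        by (rule link[OF jl(1) False jl(2,3)])
      have fD: "finite D" using D(1) finite_sub by auto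
      let ?s = "int (card (Vs D \<inter> Vs H - Vs (D \<inter> H) - Y))"
      have sub: "psi Y (D \<union> H) + psi Y (D \<inter> H) + 2 * ?s = psi Y D + psi Y H"
        using fD fH by (rule psi_Un_Int)
      have cI: "card (D \<inter> H) \<le> 2 * b" using card_mono[OF fD, of "D \<inter> H"] D(2) by simp
      have pos: "0 < psi Y (D \<inter> H)" if "D \<inter> H \<noteq> {}"
        using D(1) that cI by (intro psi_Y_pos) auto
      \<comment> \<open>By submodularity a decrease of 2 from
        \<open>psi Y D + psi Y H \<le> 4\<close> suffices. If a common constraint carries
        \<open>j\<close>, then \<open>psi Y (D \<inter> H)\<close> is at least 2, or it is 1 and the
        last property of \<open>link\<close> lowers \<open>psi Y D\<close> to 1. If none does,
        \<open>j\<close> itself contributes a surplus of 2.\<close>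
      have "psi Y (D \<union> H) \<le> 2"
      proof (cases "j \<in> Vs (D \<inter> H)")
        case True
        then have "D \<inter> H \<noteq> {}" by auto
        then have p: "1 \<le> psi Y (D \<inter> H)" using pos by simp
        show ?thesis
        proof (cases "psi Y (D \<inter> H) \<le> 1")
          case le: True
          then have "psi Y D \<le> 1" using True by (intro Dred[rule_format, of "D \<inter> H"]) auto
          then show ?thesis using sub p Hm(3) by linarith
        next
          case False
          then show ?thesis using sub D(5) Hm(3) by linarith
        qed
      next
        case nin: False
        then have "j \<in> Vs D \<inter> Vs H - Vs (D \<inter> H) - Y" using D(3) step.IH by auto
        then have "0 < card (Vs D \<inter> Vs H - Vs (D \<inter> H) - Y)" using fD by (auto simp: card_gt_0_iff)
        moreover have "0 \<le> psi Y (D \<inter> H)" using pos by (cases "D \<inter> H = {}") auto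
        ultimately show ?thesis using sub D(5) Hm(3) by linarith
      qed
      then have "D \<subseteq> H" using D by (intro absorb) auto
      then show ?thesis using D(4) Vs_mono by blast
    qed
  qed
  have Ksub: "linked\<^sup>* `` {i0} \<subseteq> Vs H" using K by auto
  \<comment> \<open>Adding the closure of \<open>X \<union> {i, j}\<close> to
    \<open>C \<union> H\<close> changes nothing: a set of new constraints with nonpositive
    \<open>psi (Y \<union> Vs H)\<close> would have been absorbed by \<open>H\<close>.\<close>
  have Hext: "T (C \<union> H) f = T2 i j f"
    if f: "depends_on (Y \<union> {i, j}) f" and ij: "i \<in> Vs H" "j \<in> Vs H" for f i j
  proof -
    let ?U = "cl (X \<union> {i, j})"
    have "T (?U \<union> H) f = T (C \<union> H) f"
      unfolding T_def
    proof (rule E_wt_extend)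
      show "C \<union> H \<subseteq> ?U \<union> H" using C_sub by blast
      show "?U \<union> H \<subseteq> {..<m}" using clm Hm by auto
      show "Vs (C \<union> H) \<subseteq> Y \<union> Vs H" by (auto simp: Vs_Un Y_def)
      have "depends_on (Y \<union> {i, j}) (\<lambda>y. agrees Y \<eta> y * f y)"
        by (intro depends_on_mult f depends_on_mono[OF depends_on_agrees]) auto
      then show "depends_on (Y \<union> Vs H) (\<lambda>y. agrees Y \<eta> y * f y)"
        by (rule depends_on_mono) (use ij in auto)
      fix D assume D: "D \<subseteq> ?U \<union> H - (C \<union> H)" "D \<noteq> {}"
      show "0 < psi (Y \<union> Vs H) D"
      proof (rule ccontr)
        assume np: "\<not> ?thesis"
        have DU: "D \<subseteq> ?U" using D by auto
        have fD: "finite D" using DU fin_cl(1) by (rule finite_subset)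
        have "psi Y (H \<union> D) = psi Y H + psi (Y \<union> Vs H) D"
          using D by (intro psi_Un_disjoint fH fD) auto
        then have "psi Y (D \<union> H) \<le> 2" using np Hm(3) by (simp add: Un_commute)
        moreover have "card D \<le> b" using card_mono[OF fin_cl(1) DU] card_cl[OF Xij, of i j] by simp
        moreover have "D \<subseteq> {..<m} - C" using D clm by auto
        ultimately have "D \<subseteq> H" by (intro absorb) auto
        then show False using D by auto
      qed
    qed
    moreover have "T (?U \<union> H) f = T2 i j f"
      using Hm f by (intro T_extend) auto
    ultimately show ?thesis by simp
  qed
  show ?thesis
  proof (rule sum_kap_nonneg_of_joint[of _ "C \<union> H"])
    show "finite (linked\<^sup>* `` {i0})" using Ksub finite_Vs[OF fH] by (rule finite_subset)
    have "T (C \<union> H) (\<lambda>_. 1) = T2 i0 i0 (\<lambda>_. 1)"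
      using Hm(4) by (intro Hext depends_on_const) auto
    then show "T (C \<union> H) (\<lambda>_. 1) = mass" by (simp add: mass_eq[of i0 i0])
    show "T2 i j f = T (C \<union> H) f"
      if "i \<in> linked\<^sup>* `` {i0}" "j \<in> linked\<^sup>* `` {i0}" "depends_on (Y \<union> {i, j}) f" for i j f
      using Ksub that(1,2) by (intro Hext[OF that(3), symmetric]) blast+
  qed
qed

text \<open>Complete the square in \<open>v0\<close>: \<open>mass\<close> times the form is a square
  plus the sum of all covariances.\<close>

lemma conditional_form_nonneg:
  "0 \<le> v0\<^sup>2 * mass + 2 * v0 * (\<Sum>i<n. T2 i i (G i)) + (\<Sum>i<n. \<Sum>j<n. T2 i j (\<lambda>y. G i y * G j y))"
    (is "0 \<le> ?Q")
proof -
  have kap: "0 \<le> (\<Sum>i<n. \<Sum>j<n. kap i j)"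
  proof (rule sum_nonneg_of_classes)
    show "finite {..<n}" by simp
    show "kap i j = kap j i" for i j by (rule kap_sym)
    fix i assume "i \<in> {..<n}"
    then show "0 \<le> (\<Sum>j\<in>{(i, j). i \<in> {..<n} \<and> j \<in> {..<n} \<and> kap i j \<noteq> 0}\<^sup>* `` {i}.
        \<Sum>l\<in>{(i, j). i \<in> {..<n} \<and> j \<in> {..<n} \<and> kap i j \<noteq> 0}\<^sup>* `` {i}. kap j l)"
      using sum_kap_class_nonneg[of i] unfolding linked_def by simp
  qed
  have "(\<Sum>i<n. \<Sum>j<n. kap i j) = mass * (\<Sum>i<n. \<Sum>j<n. T2 i j (\<lambda>y. G i y * G j y))
      - (\<Sum>i<n. T2 i i (G i))\<^sup>2"
    by (simp only: kap_def sum_subtractf sum_distrib_left[symmetric] sum_product power2_eq_square)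
  then have "mass * ?Q = (v0 * mass + (\<Sum>i<n. T2 i i (G i)))\<^sup>2 + (\<Sum>i<n. \<Sum>j<n. kap i j)"
    by (simp add: power2_eq_square algebra_simps)
  then have "0 \<le> mass * ?Q" using kap by simp
  then show ?thesis using mass_pos by (simp add: zero_le_mult_iff)
qed

end

section \<open>Polynomial equations and moment matrices\<close>

definition reduce :: "(var \<Rightarrow>\<^sub>0 nat) \<Rightarrow> (var \<Rightarrow>\<^sub>0 nat)" where
  "reduce m = (\<Sum>v\<in>Poly_Mapping.keys m. Poly_Mapping.single v 1)"

lemma lookup_reduce: "Poly_Mapping.lookup (reduce m) v = of_bool (v \<in> Poly_Mapping.keys m)"
  by (simp add: reduce_def lookup_sum lookup_single when_def)

lemma keys_reduce: "Poly_Mapping.keys (reduce m) = Poly_Mapping.keys m"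
  by (auto simp: in_keys_iff lookup_reduce)

text \<open>A common index set for several polynomials makes the linearity of the reduction a
  termwise statement.\<close>

lemma multilinear_superset:
  assumes "finite A" "Poly_Mapping.keys p \<subseteq> A"
  shows "multilinear p = (\<Sum>m\<in>A. Poly_Mapping.single (reduce m) (Poly_Mapping.lookup p m))"
  unfolding multilinear_def reduce_def
  using assms by (intro sum.mono_neutral_left) (auto simp: in_keys_iff)

lemma multilinear_diff: "multilinear (p - p') = multilinear p - multilinear p'"
proof -
  let ?A = "Poly_Mapping.keys p \<union> Poly_Mapping.keys p'"
  have "Poly_Mapping.keys (p - p') \<subseteq> ?A" by (rule keys_diff)
  then show ?thesis
    by (simp add: multilinear_superset[of ?A] lookup_minus single_diff sum_subtractf)
qed

lemma multilinear_add: "multilinear (p + p') = multilinear p + multilinear p'"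
proof -
  let ?A = "Poly_Mapping.keys p \<union> Poly_Mapping.keys p'"
  have "Poly_Mapping.keys (p + p') \<subseteq> ?A" by (rule Poly_Mapping.keys_add)
  then show ?thesis
    by (simp add: multilinear_superset[of ?A] lookup_add single_add sum.distrib)
qed

lemma multilinear_single: "multilinear (Poly_Mapping.single m c) = Poly_Mapping.single (reduce m) c"
  by (subst multilinear_superset[of "{m}"]) auto

lemma multilinear_sum: "multilinear (\<Sum>i\<in>I. f i) = (\<Sum>i\<in>I. multilinear (f i))"
  by (induction I rule: infinite_finite_induct) (simp_all add: multilinear_add, simp_all add: multilinear_def)

lemma peval_superset:
  assumes "finite A" "Poly_Mapping.keys p \<subseteq> A"
  shows "peval p z = (\<Sum>m\<in>A. Poly_Mapping.lookup p m *
      (\<Prod>v \<in> Poly_Mapping.keys m. z v ^ Poly_Mapping.lookup m v))"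
  unfolding peval_def using assms by (intro sum.mono_neutral_left) (auto simp: in_keys_iff)

lemma peval_diff: "peval (p - p') z = peval p z - peval p' z"
proof -
  let ?A = "Poly_Mapping.keys p \<union> Poly_Mapping.keys p'"
  have "Poly_Mapping.keys (p - p') \<subseteq> ?A" by (rule keys_diff)
  then show ?thesis
    by (simp add: peval_superset[of ?A] lookup_minus left_diff_distrib sum_subtractf)
qed

lemma peval_add: "peval (p + p') z = peval p z + peval p' z"
proof -
  let ?A = "Poly_Mapping.keys p \<union> Poly_Mapping.keys p'"
  have "Poly_Mapping.keys (p + p') \<subseteq> ?A" by (rule Poly_Mapping.keys_add)
  then show ?thesis
    by (simp add: peval_superset[of ?A] lookup_add distrib_right sum.distrib)
qed

lemma peval_sum: "peval (\<Sum>i\<in>I. f i) z = (\<Sum>i\<in>I. peval (f i) z)"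
  by (induction I rule: infinite_finite_induct) (simp_all add: peval_add, simp_all add: peval_def)

lemma peval_single:
  "peval (Poly_Mapping.single m c) z = c * (\<Prod>v \<in> Poly_Mapping.keys m. z v ^ Poly_Mapping.lookup m v)"
  by (subst peval_superset[of "{m}"]) auto

lemma peval_single_reduce:
  "peval (Poly_Mapping.single (reduce m) c) (\<lambda>(i, a). of_bool (y i = a))
    = c * of_bool (\<forall>(i, a)\<in>Poly_Mapping.keys m. y i = a)"
proof -
  let ?K = "Poly_Mapping.keys m"
  have prod: "(\<Prod>v\<in>K. of_bool (Q v)) = (of_bool (\<forall>v\<in>K. Q v) :: real)" if "finite K"
    for K :: "var set" and Q
    using that by (induction K) auto
  have "(\<Prod>v\<in>?K. (case v of (i, a) \<Rightarrow> of_bool (y i = a)) ^ of_bool (v \<in> ?K))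
      = (\<Prod>v\<in>?K. of_bool (y (fst v) = snd v) :: real)"
    by (rule prod.cong) (auto split: prod.split)
  also have "\<dots> = of_bool (\<forall>(i, a)\<in>?K. y i = a)"
    by (subst prod) (auto simp: split_beta)
  finally show ?thesis by (simp add: peval_single keys_reduce lookup_reduce)
qed

lemma prod_single:
  "(\<Prod>i\<in>A. Poly_Mapping.single (f i) (1::real)) = Poly_Mapping.single (\<Sum>i\<in>A. f i :: var \<Rightarrow>\<^sub>0 nat) 1"
  by (induction A rule: infinite_finite_induct) (simp_all add: mult_single)

lemma keys_sum_single:
  "finite A \<Longrightarrow> Poly_Mapping.keys (\<Sum>i\<in>A. Poly_Mapping.single (f i) (Suc 0)) = f ` A"
  by (auto simp: in_keys_iff lookup_sum lookup_single when_def split: if_splits)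

lemma keys_add_nat:
  "Poly_Mapping.keys (a + b :: 'a \<Rightarrow>\<^sub>0 nat) = Poly_Mapping.keys a \<union> Poly_Mapping.keys b"
  by (auto simp: in_keys_iff lookup_add)

section \<open>Monomials of a constraint polynomial\<close>

definition mono_ind :: "nat set \<Rightarrow> (nat \<Rightarrow> nat) \<Rightarrow> (var \<Rightarrow>\<^sub>0 nat)" where
  "mono_ind T \<alpha> = (\<Sum>i\<in>T. Poly_Mapping.single (i, \<alpha> i) 1)"

definition mono_pat :: "nat \<Rightarrow> nat \<Rightarrow> csp_constraint \<Rightarrow> (nat \<Rightarrow> nat) \<Rightarrow> (var \<Rightarrow>\<^sub>0 nat)" where
  "mono_pat q k C \<beta> = (\<Sum>j<k. Poly_Mapping.single (snd C j, (\<beta> j + fst C j) mod q) 1)"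

lemma multilinear_constraint:
  "multilinear (indicator_poly T \<alpha> * (P01 q k P (shifted_vars q C) - 1))
    = (\<Sum>\<beta>\<in>assignments q {..<k}.
        Poly_Mapping.single (reduce (mono_ind T \<alpha> + mono_pat q k C \<beta>)) (of_bool (P \<beta>)))
      - Poly_Mapping.single (reduce (mono_ind T \<alpha>)) 1"
proof -
  have ind: "indicator_poly T \<alpha> = Poly_Mapping.single (mono_ind T \<alpha>) 1"
    by (simp add: indicator_poly_def pvar_def prod_single mono_ind_def)
  have "(\<Prod>j<k. shifted_vars q C j (\<beta> j)) = Poly_Mapping.single (mono_pat q k C \<beta>) 1" for \<beta>
    by (cases C) (simp add: shifted_vars_def pvar_def prod_single mono_pat_def)
  then have "P01 q k P (shifted_vars q C) = (\<Sum>\<beta>\<in>assignments q {..<k}.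
      Poly_Mapping.single (mono_pat q k C \<beta>) (of_bool (P \<beta>)))"
    unfolding P01_def by (intro sum.cong refl) auto
  then have "indicator_poly T \<alpha> * (P01 q k P (shifted_vars q C) - 1)
    = (\<Sum>\<beta>\<in>assignments q {..<k}.
        Poly_Mapping.single (mono_ind T \<alpha> + mono_pat q k C \<beta>) (of_bool (P \<beta>)))
      - Poly_Mapping.single (mono_ind T \<alpha>) 1"
    by (simp add: ind right_diff_distrib sum_distrib_left mult_single)
  then show ?thesis
    by (simp add: multilinear_diff multilinear_sum multilinear_single)
qed

context
  fixes q k :: nat and P :: "(nat \<Rightarrow> nat) \<Rightarrow> bool" and C :: csp_constraint
    and T :: "nat set" and \<alpha> :: "nat \<Rightarrow> nat"
  assumes finT: "finite T"
begin

abbreviation "cpoly \<equiv> multilinear (indicator_poly T \<alpha> * (P01 q k P (shifted_vars q C) - 1))"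

lemma indices_mono_ind: "fst ` Poly_Mapping.keys (reduce (mono_ind T \<alpha>)) = T"
  using finT by (simp add: keys_reduce mono_ind_def keys_sum_single image_image)

lemma indices_mono_pat:
  "fst ` Poly_Mapping.keys (reduce (mono_ind T \<alpha> + mono_pat q k C \<beta>)) = T \<union> snd C ` {..<k}"
  using finT by (simp add: keys_reduce keys_add_nat mono_ind_def mono_pat_def keys_sum_single
      image_image image_Un)

lemma lookup_cpoly:
  "Poly_Mapping.lookup cpoly x = (\<Sum>\<beta>\<in>assignments q {..<k}.
      of_bool (P \<beta> \<and> reduce (mono_ind T \<alpha> + mono_pat q k C \<beta>) = x))
      - of_bool (reduce (mono_ind T \<alpha>) = x)"
  unfolding multilinear_constraint lookup_minus lookup_sum lookup_single
  by (intro arg_cong2[where f = minus] sum.cong refl) (auto simp: when_def)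

lemma keys_cpoly:
  assumes "x \<in> Poly_Mapping.keys cpoly"
  shows "(\<exists>\<beta>. x = reduce (mono_ind T \<alpha> + mono_pat q k C \<beta>)) \<or> x = reduce (mono_ind T \<alpha>)"
proof (rule ccontr)
  assume "\<not> ?thesis"
  then have "Poly_Mapping.lookup cpoly x = 0"
    unfolding lookup_cpoly by (auto intro!: sum.neutral)
  then show False using assms by (simp add: in_keys_iff)
qed

text \<open>If the constraint has a variable outside \<open>T\<close>, its monomials cannot cancel against the
  monomial of \<open>T\<close>.\<close>

lemma full_key_cpoly:
  assumes sat: "\<beta>0 \<in> assignments q {..<k}" "P \<beta>0" and ne: "cpoly \<noteq> 0"
  obtains x where "x \<in> Poly_Mapping.keys cpoly" "fst ` Poly_Mapping.keys x = T \<union> snd C ` {..<k}"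
proof (cases "snd C ` {..<k} \<subseteq> T")
  case True
  then have T: "T \<union> snd C ` {..<k} = T" by auto
  obtain x where x: "x \<in> Poly_Mapping.keys cpoly"
    using ne by (metis all_not_in_conv keys_eq_empty)
  then have "fst ` Poly_Mapping.keys x = T \<union> snd C ` {..<k}"
    using keys_cpoly[OF x] by (elim disjE exE) (simp_all only: indices_mono_ind indices_mono_pat T)
  then show thesis using x that by blast
next
  case False
  \<comment> \<open>The monomial of a satisfying pattern. Other patterns may reduce to the same
    monomial, but they enter with nonnegative coefficients.\<close>
  let ?x = "reduce (mono_ind T \<alpha> + mono_pat q k C \<beta>0)"
  have "reduce (mono_ind T \<alpha>) \<noteq> ?x"
    using False indices_mono_ind indices_mono_pat[of \<beta>0] by auto
  moreover have "1 \<le> (\<Sum>\<beta>\<in>assignments q {..<k}.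
      (of_bool (P \<beta> \<and> reduce (mono_ind T \<alpha> + mono_pat q k C \<beta>) = ?x)) :: real)"
  proof -
    have "(\<Sum>\<beta>\<in>{\<beta>0}. (of_bool (P \<beta> \<and> reduce (mono_ind T \<alpha> + mono_pat q k C \<beta>) = ?x)) :: real)
      \<le> (\<Sum>\<beta>\<in>assignments q {..<k}. of_bool (P \<beta> \<and> reduce (mono_ind T \<alpha> + mono_pat q k C \<beta>) = ?x))"
      using sat by (intro sum_mono2 finite_PiE) auto
    then show ?thesis using sat by simp
  qed
  ultimately have "Poly_Mapping.lookup cpoly ?x \<noteq> 0"
    unfolding lookup_cpoly by simp
  then show thesis using that[of ?x] indices_mono_pat by (simp add: in_keys_iff)
qed

text \<open>Some surviving monomial involves every index. It is multilinear, so its degree is its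
  number of variables and bounds the number of indices. Thus degree at most \<open>r\<close>
  guarantees that a local distribution on all these indices is available.\<close>

lemma pindices_cpoly:
  assumes "\<beta>0 \<in> assignments q {..<k}" "P \<beta>0" "cpoly \<noteq> 0"
  shows "pindices cpoly = T \<union> snd C ` {..<k}" "card (T \<union> snd C ` {..<k}) \<le> pdegree cpoly"
proof -
  obtain x where x: "x \<in> Poly_Mapping.keys cpoly" "fst ` Poly_Mapping.keys x = T \<union> snd C ` {..<k}"
    using full_key_cpoly[OF assms] .
  have sub: "fst ` Poly_Mapping.keys x' \<subseteq> T \<union> snd C ` {..<k}" if "x' \<in> Poly_Mapping.keys cpoly" for x'
    using keys_cpoly[OF that]
    by (elim disjE exE) (simp_all only: indices_mono_ind indices_mono_pat Un_upper1 order_refl)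
  show "pindices cpoly = T \<union> snd C ` {..<k}"
    unfolding pindices_def
  proof (rule antisym)
    show "T \<union> snd C ` {..<k} \<subseteq> (\<Union>m\<in>Poly_Mapping.keys cpoly. fst ` Poly_Mapping.keys m)"
      unfolding x(2)[symmetric] by (rule UN_upper[OF x(1)])
  qed (rule UN_least, rule sub)
  have "\<exists>x0. x = reduce x0" using keys_cpoly[OF x(1)] by auto
  then have "(\<Sum>v\<in>Poly_Mapping.keys x. Poly_Mapping.lookup x v) = card (Poly_Mapping.keys x)"
    by (auto simp: lookup_reduce keys_reduce)
  moreover have "(\<Sum>v\<in>Poly_Mapping.keys x. Poly_Mapping.lookup x v) \<le> pdegree cpoly"
    unfolding pdegree_def using x(1) by (intro Max_ge) auto
  moreover have "card (fst ` Poly_Mapping.keys x) \<le> card (Poly_Mapping.keys x)"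
    by (rule card_image_le) simp
  ultimately show "card (T \<union> snd C ` {..<k}) \<le> pdegree cpoly" using x(2) by simp
qed

text \<open>Only the pattern of \<open>y\<close> contributes to the sum over \<beta>, and
  \<open>P\<close> accepts it, so the sum equals the indicator that is subtracted.\<close>

lemma peval_cpoly:
  assumes q: "0 < q" and y: "\<And>j. j < k \<Longrightarrow> y (snd C j) < q" and c: "\<And>j. j < k \<Longrightarrow> fst C j < q"
    and P: "P (\<lambda>j\<in>{..<k}. (y (snd C j) + (q - fst C j)) mod q)"
  shows "peval cpoly (\<lambda>(i, a). of_bool (y i = a)) = 0"
proof -
  let ?\<beta> = "\<lambda>j\<in>{..<k}. (y (snd C j) + (q - fst C j)) mod q"
  let ?A = "\<forall>i\<in>T. y i = \<alpha> i"
  have eq: "(\<forall>j<k. y (snd C j) = (\<beta> j + fst C j) mod q) \<longleftrightarrow> \<beta> = ?\<beta>"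
    if \<beta>: "\<beta> \<in> assignments q {..<k}" for \<beta>
  proof
    assume *: "\<forall>j<k. y (snd C j) = (\<beta> j + fst C j) mod q"
    show "\<beta> = ?\<beta>"
    proof
      fix j
      show "\<beta> j = ?\<beta> j"
      proof (cases "j < k")
        case True
        have "\<beta> j < q" using \<beta> True by (auto simp: PiE_iff)
        then show ?thesis using * True c mod_shift_inverse(2)[of "\<beta> j" q "fst C j"] by simp
      next
        case False
        then show ?thesis using \<beta> by (auto simp: PiE_iff extensional_def)
      qed
    qed
  next
    assume \<beta>: "\<beta> = ?\<beta>"
    show "\<forall>j<k. y (snd C j) = (\<beta> j + fst C j) mod q"
    proof (intro allI impI)
      fix j assume j: "j < k"
      then show "y (snd C j) = (\<beta> j + fst C j) mod q"
        unfolding \<beta> by (simp del: add_diff_assoc add: mod_shift_inverse(1)[OF y[OF j] c[OF j]])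
    qed
  qed
  have "peval cpoly (\<lambda>(i, a). of_bool (y i = a)) = (\<Sum>\<beta>\<in>assignments q {..<k}.
      of_bool (P \<beta>) * of_bool (?A \<and> (\<forall>j<k. y (snd C j) = (\<beta> j + fst C j) mod q))) - of_bool ?A"
    using finT by (simp add: multilinear_constraint peval_diff peval_sum peval_single_reduce
        mono_ind_def mono_pat_def keys_add_nat keys_sum_single ball_Un) (simp add: Ball_def)
  also have "\<dots> = (\<Sum>\<beta>\<in>assignments q {..<k}. if \<beta> = ?\<beta> then of_bool ?A else 0) - of_bool ?A"
    using P by (intro arg_cong2[where f = minus] sum.cong refl) (auto simp: eq)
  also have "\<dots> = 0"
    using q by (subst sum.delta) (auto intro!: finite_PiE)
  finally show ?thesis .
qed

end

section \<open>Membership of the local distributions in the two relaxations\<close>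

context expanding_csp
begin

text \<open>Every assignment in the support of a local distribution satisfies the constraints whose
  scope it covers, so the polynomial vanishes pointwise there.\<close>

lemma local_dist_in_SA:
  assumes cs: "\<And>i. i < m \<Longrightarrow> snd (cs i) = sc i \<and> fst (cs i) = sh i"
    and P: "set_pmf \<mu> \<subseteq> {z. P z}"
    and R: "R \<subseteq> {P01 q k P (shifted_vars q (cs i)) |i. i < m}"
  shows "local_dist \<in> SA q n r R"
  unfolding SA_def
proof (intro CollectI conjI ballI allI impI locally_consistent_local_dist)
  fix p T \<alpha>
  assume "p \<in> R" and T: "T \<subseteq> {..<n}"
    and deg: "pdegree (multilinear (indicator_poly T \<alpha> * (p - 1))) \<le> r"
  then obtain i where i: "i < m" and p: "p = P01 q k P (shifted_vars q (cs i))" using R by auto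
  let ?p = "multilinear (indicator_poly T \<alpha> * (p - 1))"
  let ?U = "T \<union> sc i ` {..<k}"
  have finT: "finite T" using T finite_subset by auto
  obtain \<beta>0 where "\<beta>0 \<in> set_pmf \<mu>" using set_pmf_not_empty[of \<mu>] by blast
  then have \<beta>0: "\<beta>0 \<in> assignments q {..<k}" "P \<beta>0" using supp P by auto
  show "local_expectation local_dist ?p = 0"
  \<comment> \<open>Under complete cancellation the index set is empty and carries no information
    about the scope, so this case is separate.\<close>
  proof (cases "?p = 0")
    case True
    then show ?thesis by (simp add: local_expectation_def peval_def)
  next
    case False
    have ind: "pindices ?p = ?U" and "card ?U \<le> pdegree ?p"
      using pindices_cpoly[OF finT \<beta>0 False[unfolded p]] cs[OF i] by (simp_all add: p)
    then have U: "?U \<subseteq> {..<n}" "card ?U \<le> r" using T sc_less[OF i] deg by auto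
    show ?thesis
      unfolding local_expectation_def ind
    proof (rule integral_eq_zero_AE, unfold AE_measure_pmf_iff, rule ballI)
      fix y assume y: "y \<in> set_pmf (local_dist ?U)"
      have pat: "pattern i y \<in> set_pmf \<mu>"
        by (rule pattern_local_dist[OF U i _ y]) auto
      have "y \<in> assignments q ?U"
        using locally_consistent_local_dist U y unfolding locally_consistent_def by blast
      then have "y (sc i j) < q" if "j < k" for j using that by (auto simp: PiE_iff)
      then show "peval ?p (\<lambda>(i, a). of_bool (y i = a)) = 0"
        unfolding p using pat P cs[OF i] sh_less[OF i] q_pos
        by (intro peval_cpoly[OF finT]) (auto simp: pattern_def)
    qed
  qed
qed

text \<open>Split the event that \<open>y\<close> equals \<alpha> on \<open>X\<close> according to
  the values \<eta> on \<open>Y\<close>. The quadratic form becomes the sum over \<eta> of the forms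
  treated in \<open>conditional_form_nonneg\<close>.\<close>

lemma psd_moment_matrix:
  assumes X: "X \<subseteq> {..<n}" "card X + 2 \<le> r"
  shows "psd_on (insert None (Some ` ({..<n} \<times> {..<q}))) (moment_matrix local_dist X \<alpha>)"
  unfolding psd_on_def
proof (intro conjI ballI allI)
  fix a b
  show "moment_matrix local_dist X \<alpha> a b = moment_matrix local_dist X \<alpha> b a"
  proof (cases a; cases b)
    fix s s' assume ab: "a = Some s" "b = Some s'"
    obtain i c j d where s: "s = (i, c)" "s' = (j, d)" by (cases s, cases s')
    have "{i, j} \<union> X = {j, i} \<union> X" by auto
    moreover have "{y. y i = c \<and> y j = d \<and> (\<forall>l\<in>X. y l = \<alpha> l)}
        = {y. y j = d \<and> y i = c \<and> (\<forall>l\<in>X. y l = \<alpha> l)}" by auto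
    ultimately show ?thesis unfolding ab s moment_matrix.simps by simp
  qed auto
next
  fix v :: "var option \<Rightarrow> real"
  let ?M = "moment_matrix local_dist X \<alpha>" and ?S = "{..<n} \<times> {..<q}"
  define v0 where "v0 = v None"
  define g where "g i a = v (Some (i, a))" for i a
  define G where "G i y = g i (y i)" for i and y :: "nat \<Rightarrow> nat"
  define Y where "Y = X \<union> Vs (cl X)"
  define Ext where "Ext = {\<eta> \<in> assignments q Y. \<forall>l\<in>X. \<eta> l = \<alpha> l}"
  have Xf: "finite X" "card X \<le> r" using X finite_subset by auto
  have Yn: "Y \<subseteq> {..<n}" using X Vs_subset[OF cl_subset[OF Xf]] by (auto simp: Y_def)
  have "finite Y" using Yn finite_subset by blast
  then have finExt: "finite Ext"
    unfolding Ext_def by (intro finite_subset[OF Collect_restrict]) (auto intro: finite_PiE)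
  \<comment> \<open>Writing one index as the pair \<open>{i, i}\<close> treats first moments like
    second moments.\<close>
  have Xi: "{i} \<union> X = X \<union> {i, i}" "{i, j} \<union> X = X \<union> {i, j}" for i j by auto
  have Xij: "X \<union> {i, j} \<subseteq> {..<n}" "card (X \<union> {i, j}) \<le> r" if "i < n" "j < n" for i j
  proof -
    show "X \<union> {i, j} \<subseteq> {..<n}" using that X by auto
    have "card (X \<union> {i, j}) \<le> card X + card {i, j}" by (rule card_Un_le)
    also have "card {i, j} \<le> 2" by (simp add: card_insert_if)
    finally show "card (X \<union> {i, j}) \<le> r" using X by simp
  qed
  have M0: "?M None None = E (\<lambda>y. agrees X \<alpha> y * wt (cl X) y)"
    by (simp add: prob_local_dist[OF X(1) Xf(2)] agrees_def)
  have M1: "?M None (Some (i, a)) = E (\<lambda>y. of_bool (y i = a) * (agrees X \<alpha> y * wt (cl (X \<union> {i, i})) y))"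
    and M1': "?M (Some (i, a)) None = ?M None (Some (i, a))" if "i < n" for i a
    unfolding moment_matrix.simps Xi prob_local_dist[OF Xij[OF that that]]
    by (rule E_cong, simp add: agrees_def of_bool_conj) simp
  have M2: "?M (Some (i, a)) (Some (j, b))
      = E (\<lambda>y. of_bool (y i = a) * of_bool (y j = b) * (agrees X \<alpha> y * wt (cl (X \<union> {i, j})) y))"
    if "i < n" "j < n" for i a j b
    unfolding moment_matrix.simps Xi prob_local_dist[OF Xij[OF that]]
    by (rule E_cong) (simp add: agrees_def of_bool_conj)
  have ag: "agrees X \<alpha> y = (\<Sum>\<eta>\<in>Ext. agrees Y \<eta> y)" if "y \<in> assignments q {..<n}" for y
  proof -
    have "agrees Y \<eta> y = (if \<eta> = restrict y Y then 1 else 0)" if "\<eta> \<in> Ext" for \<eta>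
    proof -
      have "(\<forall>x\<in>Y. y x = \<eta> x) \<longleftrightarrow> \<eta> = restrict y Y"
        using that by (auto simp: Ext_def PiE_iff extensional_def fun_eq_iff)
      then show ?thesis by (simp add: agrees_def)
    qed
    then have "(\<Sum>\<eta>\<in>Ext. agrees Y \<eta> y) = of_bool (restrict y Y \<in> Ext)"
      using finExt by (simp add: sum.delta)
    also have "restrict y Y \<in> Ext \<longleftrightarrow> (\<forall>l\<in>X. y l = \<alpha> l)"
    proof -
      have "X \<subseteq> Y" by (simp add: Y_def)
      moreover have "restrict y Y \<in> assignments q Y" using Yn that by (auto simp: PiE_iff)
      ultimately show ?thesis by (auto simp: Ext_def)
    qed
    finally show ?thesis by (simp add: agrees_def)
  qed
  have pick: "(\<Sum>a<q. g i a * of_bool (y i = a)) = G i y" if "y \<in> assignments q {..<n}" "i < n" for i y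
  proof -
    have "y i < q" using that by (auto simp: PiE_iff)
    then show ?thesis by (simp add: G_def of_bool_def if_distrib sum.delta cong: if_cong)
  qed
  have S1: "(\<Sum>a<q. ?M None (Some (i, a)) * g i a)
      = (\<Sum>\<eta>\<in>Ext. E (\<lambda>y. agrees Y \<eta> y * G i y * wt (cl (X \<union> {i, i})) y))" if "i < n" for i
  proof -
    have "(\<Sum>a<q. ?M None (Some (i, a)) * g i a)
        = E (\<lambda>y. \<Sum>a<q. g i a * (of_bool (y i = a) * (agrees X \<alpha> y * wt (cl (X \<union> {i, i})) y)))"
      unfolding E_sum E_cmult by (simp only: M1[OF that] mult.commute)
    also have "\<dots> = E (\<lambda>y. \<Sum>\<eta>\<in>Ext. agrees Y \<eta> y * G i y * wt (cl (X \<union> {i, i})) y)"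
    proof (rule E_cong)
      fix y assume y: "y \<in> assignments q {..<n}"
      have "(\<Sum>a<q. g i a * (of_bool (y i = a) * (agrees X \<alpha> y * wt (cl (X \<union> {i, i})) y)))
          = (\<Sum>a<q. g i a * of_bool (y i = a)) * (agrees X \<alpha> y * wt (cl (X \<union> {i, i})) y)"
        by (simp only: sum_distrib_right mult.assoc)
      also have "\<dots> = (\<Sum>\<eta>\<in>Ext. agrees Y \<eta> y * G i y * wt (cl (X \<union> {i, i})) y)"
        unfolding pick[OF y that] ag[OF y] sum_distrib_left sum_distrib_right
        by (rule sum.cong) simp_all
      finally show "(\<Sum>a<q. g i a * (of_bool (y i = a) * (agrees X \<alpha> y * wt (cl (X \<union> {i, i})) y)))
          = (\<Sum>\<eta>\<in>Ext. agrees Y \<eta> y * G i y * wt (cl (X \<union> {i, i})) y)" .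
    qed
    finally show ?thesis unfolding E_sum .
  qed
  have S2: "(\<Sum>a<q. \<Sum>b<q. g i a * ?M (Some (i, a)) (Some (j, b)) * g j b)
      = (\<Sum>\<eta>\<in>Ext. E (\<lambda>y. agrees Y \<eta> y * (G i y * G j y) * wt (cl (X \<union> {i, j})) y))"
    if ij: "i < n" "j < n" for i j
  proof -
    let ?W = "\<lambda>y. agrees X \<alpha> y * wt (cl (X \<union> {i, j})) y"
    have "(\<Sum>a<q. \<Sum>b<q. g i a * ?M (Some (i, a)) (Some (j, b)) * g j b)
        = E (\<lambda>y. \<Sum>a<q. \<Sum>b<q. (g i a * g j b) * (of_bool (y i = a) * of_bool (y j = b) * ?W y))"
      unfolding E_sum E_cmult by (simp only: M2[OF ij] mult_ac)
    also have "\<dots> = E (\<lambda>y. \<Sum>\<eta>\<in>Ext. agrees Y \<eta> y * (G i y * G j y) * wt (cl (X \<union> {i, j})) y)"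
    proof (rule E_cong)
      fix y assume y: "y \<in> assignments q {..<n}"
      have "(\<Sum>a<q. \<Sum>b<q. (g i a * g j b) * (of_bool (y i = a) * of_bool (y j = b) * ?W y))
          = (\<Sum>a<q. g i a * of_bool (y i = a)) * (\<Sum>b<q. g j b * of_bool (y j = b)) * ?W y"
        unfolding sum_product unfolding sum_distrib_right
        by (intro sum.cong refl) (simp only: mult_ac)
      also have "\<dots> = (\<Sum>\<eta>\<in>Ext. agrees Y \<eta> y * (G i y * G j y) * wt (cl (X \<union> {i, j})) y)"
        unfolding pick[OF y ij(1)] pick[OF y ij(2)] ag[OF y] sum_distrib_left sum_distrib_right
        by (rule sum.cong) simp_all
      finally show "(\<Sum>a<q. \<Sum>b<q. (g i a * g j b) * (of_bool (y i = a) * of_bool (y j = b) * ?W y))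
          = (\<Sum>\<eta>\<in>Ext. agrees Y \<eta> y * (G i y * G j y) * wt (cl (X \<union> {i, j})) y)" .
    qed
    finally show ?thesis unfolding E_sum .
  qed
  define Q where "Q \<eta> = v0\<^sup>2 * E (\<lambda>y. agrees Y \<eta> y * wt (cl X) y)
      + 2 * v0 * (\<Sum>i<n. E (\<lambda>y. agrees Y \<eta> y * G i y * wt (cl (X \<union> {i, i})) y))
      + (\<Sum>i<n. \<Sum>j<n. E (\<lambda>y. agrees Y \<eta> y * (G i y * G j y) * wt (cl (X \<union> {i, j})) y))" for \<eta>
  have Q: "0 \<le> Q \<eta>" for \<eta>
  proof (cases "E (\<lambda>y. agrees Y \<eta> y * wt (cl X) y) = 0")
    case True
    \<comment> \<open>The weights of the larger closure have the same total mass 0 on the event of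
      \<eta>. Being nonnegative, they vanish pointwise there, and so do all moments in
      \<open>Q \<eta>\<close>.\<close>
    have zero: "E (\<lambda>y. agrees Y \<eta> y * f y * wt (cl (X \<union> {i, j})) y) = 0" if ij: "i < n" "j < n" for i j f
    proof -
      let ?U = "cl (X \<union> {i, j})"
      have fU: "finite (X \<union> {i, j})" using Xf by simp
      have U: "?U \<subseteq> {..<m}" by (rule cl_subset[OF fU Xij(2)[OF ij]])
      have "E (\<lambda>y. agrees Y \<eta> y * wt ?U y) = E (\<lambda>y. agrees Y \<eta> y * wt (cl X) y)"
      proof (rule E_cl_extend[OF Xf U])
        show "cl X \<subseteq> ?U" by (rule cl_mono[OF _ fU Xij(2)[OF ij]]) auto
        show "card (?U - cl X) \<le> 2 * b"
          using card_cl[OF fU Xij(2)[OF ij]] card_mono[OF finite_sub[OF U], of "?U - cl X"] by auto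
        show "depends_on (X \<union> Vs (cl X)) (agrees Y \<eta>)"
          unfolding Y_def by (rule depends_on_agrees)
      qed
      then have "(\<Sum>y\<in>assignments q {..<n}. agrees Y \<eta> y * wt ?U y) = 0"
        using True q_pos by (simp add: E_def)
      moreover have "finite (assignments q {..<n})" by (intro finite_PiE) auto
      ultimately have "agrees Y \<eta> y * wt ?U y = 0" if "y \<in> assignments q {..<n}" for y
        using that wt_nonneg by (subst (asm) sum_nonneg_eq_0_iff) (auto simp: agrees_def)
      then have "E (\<lambda>y. agrees Y \<eta> y * f y * wt ?U y) = E (\<lambda>_. 0)"
        by (intro E_cong) fastforce
      then show ?thesis by (simp add: E_def)
    qed
    have "Q \<eta> = v0\<^sup>2 * 0 + 2 * v0 * (\<Sum>i<n. 0) + (\<Sum>i<n. \<Sum>j<n. 0)"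
      unfolding Q_def True
      by (intro arg_cong2[where f = plus] arg_cong2[where f = times] sum.cong refl zero) auto
    then show ?thesis by simp
  next
    case False
    interpret cc: conditioned_csp k t sc q n m \<mu> sh L r X \<eta> g
      using X False by unfold_locales (auto simp: Y_def)
    have "cc.G = G" by (intro ext) (simp add: cc.G_def G_def)
    moreover have "cc.Y = Y" by (simp add: cc.Y_def Y_def)
    ultimately show ?thesis
      using cc.conditional_form_nonneg[of v0] by (simp add: Q_def cc.mass_def cc.T2_def cc.T_def)
  qed
  have sumJ: "(\<Sum>a\<in>insert None (Some ` ?S). f a) = f None + (\<Sum>i<n. \<Sum>a<q. f (Some (i, a)))"
    for f :: "var option \<Rightarrow> real"
  proof -
    have "(\<Sum>a\<in>insert None (Some ` ?S). f a) = f None + (\<Sum>a\<in>Some ` ?S. f a)"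
      by (rule sum.insert) auto
    also have "(\<Sum>a\<in>Some ` ?S. f a) = (\<Sum>s\<in>?S. f (Some s))"
      by (subst sum.reindex) auto
    also have "\<dots> = (\<Sum>i<n. \<Sum>a<q. f (Some (i, a)))"
      by (simp add: sum.cartesian_product case_prod_unfold)
    finally show ?thesis .
  qed
  have "(\<Sum>a\<in>insert None (Some ` ?S). \<Sum>b\<in>insert None (Some ` ?S). v a * ?M a b * v b)
      = v0\<^sup>2 * ?M None None + v0 * (\<Sum>i<n. \<Sum>a<q. ?M None (Some (i, a)) * g i a)
      + ((\<Sum>i<n. \<Sum>a<q. ?M (Some (i, a)) None * g i a) * v0
      + (\<Sum>i<n. \<Sum>a<q. \<Sum>j<n. \<Sum>b<q. g i a * ?M (Some (i, a)) (Some (j, b)) * g j b))"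
    unfolding sumJ v0_def g_def
    by (simp add: sum.distrib sum_distrib_left sum_distrib_right power2_eq_square algebra_simps
        del: moment_matrix.simps)
  also have "(\<Sum>i<n. \<Sum>a<q. ?M (Some (i, a)) None * g i a) = (\<Sum>i<n. \<Sum>a<q. ?M None (Some (i, a)) * g i a)"
    using M1' by (intro sum.cong refl) (simp del: moment_matrix.simps)
  also have "(\<Sum>i<n. \<Sum>a<q. ?M None (Some (i, a)) * g i a)
      = (\<Sum>i<n. \<Sum>\<eta>\<in>Ext. E (\<lambda>y. agrees Y \<eta> y * G i y * wt (cl (X \<union> {i, i})) y))"
    by (intro sum.cong refl S1) simp
  also have "(\<Sum>i<n. \<Sum>a<q. \<Sum>j<n. \<Sum>b<q. g i a * ?M (Some (i, a)) (Some (j, b)) * g j b)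
      = (\<Sum>i<n. \<Sum>j<n. \<Sum>a<q. \<Sum>b<q. g i a * ?M (Some (i, a)) (Some (j, b)) * g j b)"
    by (rule sum.cong[OF refl], rule sum.swap)
  also have "\<dots> = (\<Sum>i<n. \<Sum>j<n. \<Sum>\<eta>\<in>Ext.
      E (\<lambda>y. agrees Y \<eta> y * (G i y * G j y) * wt (cl (X \<union> {i, j})) y))"
    by (intro sum.cong refl S2) auto
  also have "?M None None = (\<Sum>\<eta>\<in>Ext. E (\<lambda>y. agrees Y \<eta> y * wt (cl X) y))"
    unfolding M0 E_sum[symmetric] by (rule E_cong) (simp only: ag sum_distrib_right)
  also have "v0\<^sup>2 * (\<Sum>\<eta>\<in>Ext. E (\<lambda>y. agrees Y \<eta> y * wt (cl X) y))
      + v0 * (\<Sum>i<n. \<Sum>\<eta>\<in>Ext. E (\<lambda>y. agrees Y \<eta> y * G i y * wt (cl (X \<union> {i, i})) y))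
      + ((\<Sum>i<n. \<Sum>\<eta>\<in>Ext. E (\<lambda>y. agrees Y \<eta> y * G i y * wt (cl (X \<union> {i, i})) y)) * v0
      + (\<Sum>i<n. \<Sum>j<n. \<Sum>\<eta>\<in>Ext. E (\<lambda>y. agrees Y \<eta> y * (G i y * G j y) * wt (cl (X \<union> {i, j})) y)))
      = (\<Sum>\<eta>\<in>Ext. Q \<eta>)"
  proof -
    have sw1: "(\<Sum>i<n. \<Sum>\<eta>\<in>Ext. h \<eta> i) = (\<Sum>\<eta>\<in>Ext. \<Sum>i<n. h \<eta> i)" for h :: "_ \<Rightarrow> _ \<Rightarrow> real"
      by (rule sum.swap)
    have sw2: "(\<Sum>i<n. \<Sum>j<n. \<Sum>\<eta>\<in>Ext. h \<eta> i j) = (\<Sum>\<eta>\<in>Ext. \<Sum>i<n. \<Sum>j<n. h \<eta> i j)"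
      for h :: "_ \<Rightarrow> _ \<Rightarrow> _ \<Rightarrow> real"
      by (simp only: sw1)
    show ?thesis
      unfolding Q_def sw1 sw2 by (simp add: sum.distrib sum_distrib_left sum_distrib_right mult_ac)
  qed
  also have "\<dots> \<ge> 0" by (rule sum_nonneg) (rule Q)
  finally show "0 \<le> (\<Sum>a\<in>insert None (Some ` ?S). \<Sum>b\<in>insert None (Some ` ?S). v a * ?M a b * v b)" .
qed

lemma local_dist_in_static_LS_plus:
  assumes "\<And>i. i < m \<Longrightarrow> snd (cs i) = sc i \<and> fst (cs i) = sh i"
    and "set_pmf \<mu> \<subseteq> {z. P z}"
    and "R \<subseteq> {P01 q k P (shifted_vars q (cs i)) |i. i < m}"
  shows "local_dist \<in> static_LS_plus q n r R"
  unfolding static_LS_plus_def using local_dist_in_SA[OF assms] psd_moment_matrix by blast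

end

section \<open>Expansion of random instances\<close>

lemma pair_pmf_of_set:
  assumes "finite A" "A \<noteq> {}" "finite B" "B \<noteq> {}"
  shows "pair_pmf (pmf_of_set A) (pmf_of_set B) = pmf_of_set (A \<times> B)"
proof (rule pmf_eqI)
  fix z
  show "pmf (pair_pmf (pmf_of_set A) (pmf_of_set B)) z = pmf (pmf_of_set (A \<times> B)) z"
    using assms by (cases z) (simp add: pmf_pair indicator_def card_cartesian_product)
qed

text \<open>Turns probabilities of independent draws into ratios of counts.\<close>

lemma replicate_pmf_of_set:
  assumes A: "finite A" "A \<noteq> {}"
  shows "replicate_pmf m (pmf_of_set A) = pmf_of_set {xs. set xs \<subseteq> A \<and> length xs = m}"
proof (induction m)
  case 0
  have "{xs. set xs \<subseteq> A \<and> length xs = 0} = {[]}" by auto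
  then show ?case by (simp add: pmf_of_set_singleton)
next
  case (Suc m)
  let ?B = "\<lambda>m. {xs. set xs \<subseteq> A \<and> length xs = m}"
  have fin: "finite (?B m)" for m using A by (intro finite_lists_length_eq)
  have ne: "?B m \<noteq> {}" for m
  proof -
    obtain a where "a \<in> A" using A by blast
    then have "replicate m a \<in> ?B m" by auto
    then show ?thesis by blast
  qed
  have "replicate_pmf (Suc m) (pmf_of_set A)
      = map_pmf (\<lambda>(x, xs). x # xs) (pair_pmf (pmf_of_set A) (pmf_of_set (?B m)))"
    by (simp add: Suc pair_pmf_def map_bind_pmf map_pmf_def bind_assoc_pmf bind_return_pmf)
  also have "\<dots> = map_pmf (\<lambda>(x, xs). x # xs) (pmf_of_set (A \<times> ?B m))"
    using A fin ne by (subst pair_pmf_of_set) auto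
  also have "\<dots> = pmf_of_set ((\<lambda>(x, xs). x # xs) ` (A \<times> ?B m))"
    using A fin ne by (intro map_pmf_of_set_inj) (auto simp: inj_on_def)
  also have "(\<lambda>(x, xs). x # xs) ` (A \<times> ?B m) = ?B (Suc m)"
    by (auto simp: length_Suc_conv image_iff)
  finally show ?case .
qed

text \<open>Each prescribed coincidence of an entry in \<open>R\<close> with one outside \<open>R\<close> costs a factor
  \<open>n\<close>: the entries in \<open>R\<close> may be changed freely without losing information.\<close>

lemma prob_coincidences:
  fixes h :: "nat \<times> nat \<Rightarrow> nat \<times> nat"
  assumes q: "0 < q" and n: "0 < n" and R: "R \<subseteq> {..<m} \<times> {..<k}"
    and h: "\<And>p. p \<in> R \<Longrightarrow> h p \<in> {..<m} \<times> {..<k} - R"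
  shows "measure_pmf.prob (replicate_pmf m (pmf_of_set (all_constraints q k n)))
      {xs. \<forall>p\<in>R. snd (xs ! fst p) (snd p) = snd (xs ! fst (h p)) (snd (h p))}
    \<le> 1 / real n ^ card R"
proof -
  let ?A = "all_constraints q k n" and ?B = "{xs. set xs \<subseteq> all_constraints q k n \<and> length xs = m}"
  let ?Ev = "{xs. \<forall>p\<in>R. snd (xs ! fst p) (snd p) = snd (xs ! fst (h p)) (snd (h p))}"
  have A: "finite ?A" unfolding all_constraints_def by (intro finite_cartesian_product finite_PiE) auto
  have "((\<lambda>_\<in>{..<k}. 0), (\<lambda>_\<in>{..<k}. 0)) \<in> ?A" using q n by (auto simp: all_constraints_def)
  then have A0: "?A \<noteq> {}" by blast
  have fB: "finite ?B" using A by (rule finite_lists_length_eq)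
  have cB: "0 < card ?B" using A A0 by (simp add: card_lists_length_eq card_gt_0_iff)
  have finR: "finite R" using R by (rule finite_subset) auto
  \<comment> \<open>\<open>\<Phi>\<close> overwrites the entries in \<open>R\<close> by arbitrary
    values \<open>u\<close>. On the event, the entry lost at \<open>p\<close> can still be read at
    \<open>h p\<close>, which lies outside \<open>R\<close>; this gives injectivity.\<close>
  define \<Phi> where "\<Phi> = (\<lambda>(xs :: csp_constraint list, u :: nat \<times> nat \<Rightarrow> nat).
    map (\<lambda>i. (fst (xs ! i), \<lambda>j\<in>{..<k}. if (i, j) \<in> R then u (i, j) else snd (xs ! i) j)) [0..<m])"
  have "inj_on \<Phi> ((?B \<inter> ?Ev) \<times> (R \<rightarrow>\<^sub>E {..<n}))"
  proof (rule inj_onI, clarify)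
    fix xs u xs' u'
    assume xs: "set xs \<subseteq> ?A" "m = length xs" and xs': "set xs' \<subseteq> ?A" "length xs' = length xs"
      and ev: "\<forall>p\<in>R. snd (xs ! fst p) (snd p) = snd (xs ! fst (h p)) (snd (h p))"
      and ev': "\<forall>p\<in>R. snd (xs' ! fst p) (snd p) = snd (xs' ! fst (h p)) (snd (h p))"
      and u: "u \<in> R \<rightarrow>\<^sub>E {..<n}" and u': "u' \<in> R \<rightarrow>\<^sub>E {..<n}" and eq: "\<Phi> (xs, u) = \<Phi> (xs', u')"
    have nth: "\<Phi> (xs, u) ! i = (fst (xs ! i), \<lambda>j\<in>{..<k}. if (i, j) \<in> R then u (i, j) else snd (xs ! i) j)"
      if "i < m" for i xs u
    proof -
      have "[0..<m] ! i = i" using that by simp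
      then show ?thesis using that by (simp only: \<Phi>_def prod.case nth_map length_upt diff_zero)
    qed
    have g: "(if (i, j) \<in> R then u (i, j) else snd (xs ! i) j)
        = (if (i, j) \<in> R then u' (i, j) else snd (xs' ! i) j)" if "i < m" "j < k" for i j
    proof -
      have "snd (\<Phi> (xs, u) ! i) j = snd (\<Phi> (xs', u') ! i) j" by (simp add: eq)
      then show ?thesis unfolding nth[OF that(1)] using that(2) by simp
    qed
    have f: "fst (xs ! i) = fst (xs' ! i)" if "i < m" for i
      using nth[OF that, of xs u] nth[OF that, of xs' u'] eq by auto
    have uu: "u = u'"
    proof (rule PiE_ext[OF u u'])
      fix p assume "p \<in> R"
      then show "u p = u' p" using g[of "fst p" "snd p"] R by (auto simp: mem_Times_iff)
    qed
    have out: "snd (xs ! i) j = snd (xs' ! i) j" if "i < m" "j < k" "(i, j) \<notin> R" for i j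
      using g[OF that(1,2)] that(3) by simp
    have s: "snd (xs ! i) j = snd (xs' ! i) j" if "i < m" "j < k" for i j
    proof (cases "(i, j) \<in> R")
      case True
      have "snd (xs ! i) j = snd (xs ! fst (h (i, j))) (snd (h (i, j)))" using ev True by force
      also have "\<dots> = snd (xs' ! fst (h (i, j))) (snd (h (i, j)))"
        using h[OF True] by (intro out) (auto simp: mem_Times_iff)
      also have "\<dots> = snd (xs' ! i) j" using ev' True by force
      finally show ?thesis .
    qed (rule out[OF that])
    have "xs = xs'"
    proof (rule nth_equalityI)
      show "length xs = length xs'" using xs' by simp
      fix i assume i: "i < length xs"
      have "xs ! i \<in> ?A" "xs' ! i \<in> ?A" using i xs xs' nth_mem by (metis subsetD)+
      then have "snd (xs ! i) \<in> {..<k} \<rightarrow>\<^sub>E {..<n}" "snd (xs' ! i) \<in> {..<k} \<rightarrow>\<^sub>E {..<n}"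
        by (auto simp: all_constraints_def mem_Times_iff)
      then have "snd (xs ! i) = snd (xs' ! i)"
        using s[of i] i xs(2) by (intro PiE_ext) auto
      then show "xs ! i = xs' ! i" using f[of i] i xs(2) by (simp add: prod_eq_iff)
    qed
    then show "xs = xs' \<and> u = u'" using uu by simp
  qed
  moreover have "\<Phi> ` ((?B \<inter> ?Ev) \<times> (R \<rightarrow>\<^sub>E {..<n})) \<subseteq> ?B"
  proof (rule image_subsetI, clarify)
    fix xs u assume xs: "set xs \<subseteq> ?A" "m = length xs" and u: "u \<in> R \<rightarrow>\<^sub>E {..<n}"
    have "xs ! i \<in> ?A" if "i < m" for i using that xs nth_mem by (metis subsetD)
    then have "fst (xs ! i) \<in> {..<k} \<rightarrow>\<^sub>E {..<q}" "snd (xs ! i) \<in> {..<k} \<rightarrow>\<^sub>E {..<n}" if "i < m" for i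
      using that by (auto simp: all_constraints_def mem_Times_iff)
    then have "(fst (xs ! i), \<lambda>j\<in>{..<k}. if (i, j) \<in> R then u (i, j) else snd (xs ! i) j) \<in> ?A"
      if "i < m" for i
      using that u by (auto simp: all_constraints_def PiE_iff)
    then show "set (\<Phi> (xs, u)) \<subseteq> ?A \<and> length (\<Phi> (xs, u)) = length xs"
      using xs(2) by (auto simp: \<Phi>_def)
  qed
  ultimately have "card ((?B \<inter> ?Ev) \<times> (R \<rightarrow>\<^sub>E {..<n})) \<le> card ?B"
    using fB by (intro card_inj_on_le[where f = \<Phi>])
  then have "card (?B \<inter> ?Ev) * n ^ card R \<le> card ?B"
    using finR by (simp add: card_cartesian_product card_PiE)
  then have "real (card (?B \<inter> ?Ev)) * real n ^ card R \<le> real (card ?B)"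
    unfolding of_nat_power[symmetric] of_nat_mult[symmetric] of_nat_le_iff .
  then have "real (card (?B \<inter> ?Ev)) / real (card ?B) \<le> 1 / real n ^ card R"
    using cB n by (simp add: field_simps)
  moreover have "measure_pmf.prob (replicate_pmf m (pmf_of_set ?A)) ?Ev
      = real (card (?B \<inter> ?Ev)) / real (card ?B)"
    unfolding replicate_pmf_of_set[OF A A0]
    using fB cB by (intro measure_pmf_of_set) (auto simp: card_gt_0_iff)
  ultimately show ?thesis by simp
qed

text \<open>Choose a representative position for each variable of \<open>D\<close>. At least
  \<open>a\<close> positions are not representatives; any \<open>a\<close> of them form a set
  \<open>R\<close> whose entries coincide with entries outside \<open>R\<close>. The union bound
  runs over \<open>R\<close> and over the maps \<open>h\<close> to representatives.\<close>

lemma prob_small_union: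
  assumes q: "0 < q" and n: "0 < n" and D: "D \<subseteq> {..<m}"
  shows "measure_pmf.prob (replicate_pmf m (pmf_of_set (all_constraints q k n)))
      {xs. card (incidence.Vs k (\<lambda>i. snd (xs ! i)) D) + a \<le> k * card D}
    \<le> real (k * card D choose a) * real (k * card D) ^ a / real n ^ a"
proof -
  let ?M = "replicate_pmf m (pmf_of_set (all_constraints q k n))"
  let ?Pos = "D \<times> {..<k}"
  let ?val = "\<lambda>(xs :: csp_constraint list) p. snd (xs ! fst p) (snd p)"
  define \<R> where "\<R> = {R. R \<subseteq> ?Pos \<and> card R = a}"
  define Ev where "Ev R h = {xs. \<forall>p\<in>R. ?val xs p = ?val xs (h p)}" for R and h :: "nat \<times> nat \<Rightarrow> nat \<times> nat"
  have fD: "finite D" using D by (rule finite_subset) auto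
  have fPos: "finite ?Pos" using fD by simp
  have cPos: "card ?Pos = k * card D" by (simp add: card_cartesian_product)
  have f\<R>: "finite \<R>" unfolding \<R>_def using fPos by simp
  have fR: "finite R" if "R \<in> \<R>" for R
  proof -
    have "R \<subseteq> ?Pos" using that by (simp add: \<R>_def)
    then show ?thesis using fPos by (rule finite_subset)
  qed
  have sub: "{xs. card (incidence.Vs k (\<lambda>i. snd (xs ! i)) D) + a \<le> k * card D}
      \<subseteq> (\<Union>R\<in>\<R>. \<Union>h\<in>R \<rightarrow>\<^sub>E (?Pos - R). Ev R h)"
  proof (rule subsetI, unfold mem_Collect_eq)
    fix xs :: "csp_constraint list"
    let ?V = "incidence.Vs k (\<lambda>i. snd (xs ! i)) D"
    assume le: "card ?V + a \<le> k * card D"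
    have V: "?V = ?val xs ` ?Pos"
      unfolding incidence.Vs_def by force
    define rep where "rep = inv_into ?Pos (?val xs)"
    have rep: "rep v \<in> ?Pos" "?val xs (rep v) = v" if "v \<in> ?V" for v
      unfolding rep_def using that inv_into_into[of v "?val xs" ?Pos] f_inv_into_f[of v "?val xs" ?Pos]
      by (simp_all only: V)
    have fV: "finite ?V" unfolding V using fPos by (rule finite_imageI)
    have "card (rep ` ?V) \<le> card ?V" using fV by (rule card_image_le)
    moreover have "rep ` ?V \<subseteq> ?Pos" using rep by blast
    then have "card (?Pos - rep ` ?V) = k * card D - card (rep ` ?V)"
      using fV cPos by (simp add: card_Diff_subset)
    ultimately have "a \<le> card (?Pos - rep ` ?V)" using le by linarith
    then obtain R where R: "R \<subseteq> ?Pos - rep ` ?V" "card R = a"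
      by (meson obtain_subset_with_card_n)
    define h where "h = (\<lambda>p\<in>R. rep (?val xs p))"
    have inV: "?val xs p \<in> ?V" if "p \<in> R" for p using that R unfolding V by blast
    have "R \<in> \<R>" using R by (auto simp: \<R>_def)
    moreover have "h \<in> R \<rightarrow>\<^sub>E (?Pos - R)"
    proof (rule PiE_I)
      fix p assume p: "p \<in> R"
      have "rep (?val xs p) \<in> ?Pos" using rep(1)[OF inV[OF p]] .
      moreover have "rep (?val xs p) \<notin> R" using R inV[OF p] by blast
      ultimately show "h p \<in> ?Pos - R" using p by (simp add: h_def)
    qed (simp add: h_def)
    moreover have "xs \<in> Ev R h"
      unfolding Ev_def using rep(2)[OF inV] by (simp add: h_def)
    ultimately show "xs \<in> (\<Union>R\<in>\<R>. \<Union>h\<in>R \<rightarrow>\<^sub>E (?Pos - R). Ev R h)" by blast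
  qed
  have one: "measure_pmf.prob ?M (Ev R h) \<le> 1 / real n ^ a"
    if R: "R \<in> \<R>" and h: "h \<in> R \<rightarrow>\<^sub>E (?Pos - R)" for R h
  proof -
    have "R \<subseteq> {..<m} \<times> {..<k}" "card R = a" using R D by (auto simp: \<R>_def)
    moreover have "h p \<in> {..<m} \<times> {..<k} - R" if "p \<in> R" for p
      using PiE_mem[OF h that] D by auto
    ultimately show ?thesis
      using prob_coincidences[OF q n, of R m k h] unfolding Ev_def by simp
  qed
  have "measure_pmf.prob ?M {xs. card (incidence.Vs k (\<lambda>i. snd (xs ! i)) D) + a \<le> k * card D}
      \<le> measure_pmf.prob ?M (\<Union>R\<in>\<R>. \<Union>h\<in>R \<rightarrow>\<^sub>E (?Pos - R). Ev R h)"
    by (rule measure_pmf.finite_measure_mono[OF sub]) simp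
  also have "\<dots> \<le> (\<Sum>R\<in>\<R>. measure_pmf.prob ?M (\<Union>h\<in>R \<rightarrow>\<^sub>E (?Pos - R). Ev R h))"
    using f\<R> by (intro measure_UNION_le) auto
  also have "\<dots> \<le> (\<Sum>R\<in>\<R>. real (k * card D) ^ a / real n ^ a)"
  proof (rule sum_mono)
    fix R assume R: "R \<in> \<R>"
    have fin: "finite (R \<rightarrow>\<^sub>E (?Pos - R))" using fR[OF R] fPos by (intro finite_PiE) auto
    have "measure_pmf.prob ?M (\<Union>h\<in>R \<rightarrow>\<^sub>E (?Pos - R). Ev R h)
        \<le> (\<Sum>h\<in>R \<rightarrow>\<^sub>E (?Pos - R). measure_pmf.prob ?M (Ev R h))"
      using fin by (intro measure_UNION_le) auto
    also have "\<dots> \<le> (\<Sum>h\<in>R \<rightarrow>\<^sub>E (?Pos - R). 1 / real n ^ a)"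
      by (intro sum_mono one R)
    also have "\<dots> = real (card (?Pos - R)) ^ a / real n ^ a"
      using fR[OF R] R by (simp add: card_PiE \<R>_def)
    also have "\<dots> \<le> real (k * card D) ^ a / real n ^ a"
    proof -
      have "card (?Pos - R) \<le> k * card D" unfolding cPos[symmetric] using fPos by (intro card_mono) auto
      then show ?thesis by (intro divide_right_mono power_mono) (auto simp flip: of_nat_mult)
    qed
    finally show "measure_pmf.prob ?M (\<Union>h\<in>R \<rightarrow>\<^sub>E (?Pos - R). Ev R h)
        \<le> real (k * card D) ^ a / real n ^ a" .
  qed
  also have "\<dots> = real (card \<R>) * real (k * card D) ^ a / real n ^ a" by simp
  also have "card \<R> = (k * card D choose a)"
    unfolding \<R>_def cPos[symmetric] using fPos by (rule n_subsets)
  finally show ?thesis .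
qed

definition nonexpanding :: "nat \<Rightarrow> nat \<Rightarrow> nat \<Rightarrow> nat \<Rightarrow> nat \<Rightarrow> csp_constraint list set" where
  "nonexpanding k t m L N = {xs. \<exists>D\<subseteq>{..<m}. D \<noteq> {} \<and> card D \<le> N \<and>
     int L * incidence.psi k t (\<lambda>i. snd (xs ! i)) {} D < 2 * int (card D)}"

text \<open>Failure of expansion for \<open>s\<close> constraints means that more than
  \<open>(t / 2 - 1 / L) * s\<close> positions are lost to coincidences; integrality allows the
  ceiling \<open>a s\<close>. The union bound groups the sets of constraints by size.\<close>

lemma prob_nonexpanding:
  fixes t :: nat
  assumes q: "0 < q" and n: "0 < n" and L: "0 < L"
  defines "a \<equiv> \<lambda>s. nat \<lceil>(real t / 2 - 1 / real L) * real s\<rceil>"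
  shows "measure_pmf.prob (replicate_pmf m (pmf_of_set (all_constraints q k n))) (nonexpanding k t m L N)
    \<le> (\<Sum>s=1..N. real (m choose s) * (real (k * s choose a s) * real (k * s) ^ a s / real n ^ a s))"
proof -
  let ?M = "replicate_pmf m (pmf_of_set (all_constraints q k n))"
  define \<D> where "\<D> = {D. D \<subseteq> {..<m} \<and> card D \<in> {1..N}}"
  define B where "B D = {xs :: csp_constraint list. card (incidence.Vs k (\<lambda>i. snd (xs ! i)) D) + a (card D) \<le> k * card D}"
    for D :: "nat set"
  let ?\<beta> = "\<lambda>s. real (k * s choose a s) * real (k * s) ^ a s / real n ^ a s"
  have f\<D>: "finite \<D>" unfolding \<D>_def by (rule finite_subset[of _ "Pow {..<m}"]) auto
  have "nonexpanding k t m L N \<subseteq> (\<Union>D\<in>\<D>. B D)"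
  proof (rule subsetI)
    fix xs assume "xs \<in> nonexpanding k t m L N"
    then obtain D where D: "D \<subseteq> {..<m}" "D \<noteq> {}" "card D \<le> N"
      and psi: "int L * incidence.psi k t (\<lambda>i. snd (xs ! i)) {} D < 2 * int (card D)"
      by (auto simp: nonexpanding_def)
    have "finite D" using D(1) by (rule finite_subset) auto
    then have "D \<in> \<D>" using D by (auto simp: \<D>_def Suc_le_eq card_gt_0_iff)
    let ?V = "real (card (incidence.Vs k (\<lambda>i. snd (xs ! i)) D))" and ?s = "real (card D)"
    have "real_of_int (int L * incidence.psi k t (\<lambda>i. snd (xs ! i)) {} D) < real_of_int (2 * int (card D))"
      using psi by (simp only: of_int_less_iff)
    then have "real L * ((real t - 2 * real k) * ?s + 2 * ?V) < 2 * ?s"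
      by (simp add: incidence.psi_def)
    then have "(real t - 2 * real k) * ?s + 2 * ?V < 2 * ?s / real L"
      using L by (simp add: field_simps)
    then have lt: "(real t / 2 - 1 / real L) * ?s < real k * ?s - ?V"
      by (simp add: field_simps)
    have "card (incidence.Vs k (\<lambda>i. snd (xs ! i)) D) \<le> k * card D"
    proof -
      have "incidence.Vs k (\<lambda>i. snd (xs ! i)) D = (\<lambda>p. snd (xs ! fst p) (snd p)) ` (D \<times> {..<k})"
        unfolding incidence.Vs_def by force
      then show ?thesis
        using \<open>finite D\<close> card_image_le[of "D \<times> {..<k}" "\<lambda>p. snd (xs ! fst p) (snd p)"]
        by (simp add: card_cartesian_product mult.commute)
    qed
    then have "real (k * card D - card (incidence.Vs k (\<lambda>i. snd (xs ! i)) D)) = real k * ?s - ?V"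
      by (simp add: of_nat_diff)
    then have "a (card D) \<le> k * card D - card (incidence.Vs k (\<lambda>i. snd (xs ! i)) D)"
      unfolding a_def nat_le_iff ceiling_le_iff using lt by simp
    then have "xs \<in> B D"
      using \<open>card (incidence.Vs k (\<lambda>i. snd (xs ! i)) D) \<le> k * card D\<close> by (simp add: B_def)
    then show "xs \<in> (\<Union>D\<in>\<D>. B D)" using \<open>D \<in> \<D>\<close> by blast
  qed
  then have "measure_pmf.prob ?M (nonexpanding k t m L N) \<le> measure_pmf.prob ?M (\<Union>D\<in>\<D>. B D)"
    by (intro measure_pmf.finite_measure_mono) auto
  also have "\<dots> \<le> (\<Sum>D\<in>\<D>. measure_pmf.prob ?M (B D))"
    using f\<D> by (intro measure_UNION_le) auto
  also have "\<dots> \<le> (\<Sum>D\<in>\<D>. ?\<beta> (card D))"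
    unfolding B_def by (intro sum_mono prob_small_union[OF q n]) (simp add: \<D>_def)
  also have "\<dots> = (\<Sum>s=1..N. \<Sum>D\<in>{D \<in> \<D>. card D = s}. ?\<beta> (card D))"
    using f\<D> by (intro sum.group[symmetric]) (auto simp: \<D>_def)
  also have "\<dots> = (\<Sum>s=1..N. real (m choose s) * ?\<beta> s)"
  proof (rule sum.cong[OF refl])
    fix s assume "s \<in> {1..N}"
    then have "{D \<in> \<D>. card D = s} = {D. D \<subseteq> {..<m} \<and> card D = s}" by (auto simp: \<D>_def)
    moreover have "(\<Sum>D\<in>{D \<in> \<D>. card D = s}. ?\<beta> (card D)) = real (card {D \<in> \<D>. card D = s}) * ?\<beta> s"
      by simp
    ultimately show "(\<Sum>D\<in>{D \<in> \<D>. card D = s}. ?\<beta> (card D)) = real (m choose s) * ?\<beta> s"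
      using n_subsets[of "{..<m}" s] by simp
  qed
  finally show ?thesis .
qed

section \<open>Asymptotics\<close>

text \<open>The left side is one term of the exponential series at \<open>s\<close>.\<close>

lemma power_div_fact_le_exp: "real s ^ s / fact s \<le> exp (real s)"
proof -
  have "(\<lambda>i. real s ^ i /\<^sub>R fact i) sums exp (real s)" by (rule exp_converges)
  then have "summable (\<lambda>i. real s ^ i /\<^sub>R fact i)" "suminf (\<lambda>i. real s ^ i /\<^sub>R fact i) = exp (real s)"
    by (simp_all add: sums_iff)
  then have "(\<Sum>i\<in>{s}. real s ^ i /\<^sub>R fact i) \<le> exp (real s)"
    using sum_le_suminf[of "\<lambda>i. real s ^ i /\<^sub>R fact i" "{s}"] by simp
  then show ?thesis by (simp add: divide_inverse mult.commute)
qed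

lemma binomial_le_exp_pow:
  assumes "0 < s"
  shows "real (m choose s) \<le> (exp 1 * real m / real s) ^ s"
proof -
  have "real (m choose s) * fact s \<le> real m ^ s"
    using binomial_fact_pow[of m s] by (metis of_nat_fact of_nat_le_iff of_nat_mult of_nat_power)
  then have "real (m choose s) \<le> real m ^ s / fact s" by (simp add: field_simps)
  also have "\<dots> = (real m / real s) ^ s * (real s ^ s / fact s)"
    using assms by (simp add: power_divide)
  also have "\<dots> \<le> (real m / real s) ^ s * exp (real s)"
    by (intro mult_left_mono power_div_fact_le_exp) auto
  also have "exp (real s) = exp 1 ^ s" by (simp flip: exp_of_nat_mult)
  also have "(real m / real s) ^ s * exp 1 ^ s = (exp 1 * real m / real s) ^ s"
    by (simp add: mult.commute flip: power_mult_distrib)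
  finally show ?thesis .
qed

text \<open>Bookkeeping of exponents of \<open>n\<close> for one constraint: \<open>m\<close> gives
  \<open>t / 2 - \<epsilon>\<close>, the power of \<open>s\<close> gives \<epsilon> / 2 since
  \<open>(\<epsilon> / (t - 2)) * (t / 2 - 1) = \<epsilon> / 2\<close>, and the coincidences give
  \<open>1 / L - t / 2\<close>. The total \<open>1 / L - \<epsilon> / 2\<close> is at most
  \<open>- \<epsilon> / 4\<close>.\<close>

lemma nonexpanding_term_le:
  fixes \<epsilon> B :: real and t L k n m s :: nat
  assumes s: "0 < s" and k: "0 < k" and ks: "k * s \<le> n" and t: "3 \<le> t" and \<epsilon>: "0 < \<epsilon>"
    and L: "0 < L" "1 / real L \<le> \<epsilon> / 4" and B: "0 < B"
    and m: "real m \<le> real n powr (real t / 2 - \<epsilon>)"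
    and sB: "real s \<le> B * real n powr (\<epsilon> / (real t - 2))"
  defines "a \<equiv> nat \<lceil>(real t / 2 - 1 / real L) * real s\<rceil>"
  shows "real (m choose s) * (real (k * s choose a) * real (k * s) ^ a / real n ^ a)
    \<le> (exp 1 * 2 ^ k * real k powr (real t / 2) * B powr (real t / 2 - 1) * real n powr (- \<epsilon> / 4)) ^ s"
proof -
  define \<theta> where "\<theta> = real t / 2 - 1 / real L"
  define x where "x = real (k * s) / real n"
  have n: "0 < n" using ks s k by (metis less_le_trans nat_0_less_mult_iff)
  have x: "0 < x" "x \<le> 1" using s k n ks by (auto simp: x_def simp flip: of_nat_mult)
  have "x ^ a = x powr real a" using x by (simp add: powr_realpow)
  \<comment> \<open>As \<open>x \<le> 1\<close>, dropping the ceiling from the exponent only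
    increases the power.\<close>
  also have "\<dots> \<le> x powr (\<theta> * real s)"
    using x by (intro powr_mono') (auto simp: a_def \<theta>_def real_nat_ceiling_ge)
  also have "\<dots> = (x powr \<theta>) ^ s"
    using x by (simp add: powr_powr[symmetric] powr_realpow)
  finally have xa: "x ^ a \<le> (x powr \<theta>) ^ s" .
  have "real (k * s choose a) \<le> real (2 ^ (k * s))"
    unfolding of_nat_le_iff by (rule binomial_le_pow2)
  then have ca: "real (k * s choose a) \<le> (2 ^ k) ^ s" by (simp add: power_mult)
  have "real (m choose s) * (real (k * s choose a) * real (k * s) ^ a / real n ^ a)
      = real (m choose s) * (real (k * s choose a) * x ^ a)"
    by (simp add: x_def power_divide)
  also have "\<dots> \<le> (exp 1 * real m / real s) ^ s * ((2 ^ k) ^ s * (x powr \<theta>) ^ s)"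
    using x by (intro mult_mono binomial_le_exp_pow s ca xa) auto
  also have "\<dots> = (exp 1 * real m / real s * (2 ^ k * x powr \<theta>)) ^ s"
    by (simp only: power_mult_distrib)
  also have "\<dots> \<le> (exp 1 * 2 ^ k * real k powr (real t / 2) * B powr (real t / 2 - 1)
      * real n powr (- \<epsilon> / 4)) ^ s"
  proof (rule power_mono)
    have "x powr \<theta> = real k powr \<theta> * real s powr \<theta> * real n powr (- \<theta>)"
      by (simp add: x_def powr_divide powr_mult powr_minus_divide)
    then have "exp 1 * real m / real s * (2 ^ k * x powr \<theta>)
        = exp 1 * 2 ^ k * (real k powr \<theta> * (real m * (real s powr \<theta> / real s) * real n powr (- \<theta>)))"
      by simp
    also have "real s powr \<theta> / real s = real s powr (\<theta> - 1)"
      using s by (simp add: powr_diff)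
    also have "exp 1 * 2 ^ k * (real k powr \<theta> * (real m * real s powr (\<theta> - 1) * real n powr (- \<theta>)))
        \<le> exp 1 * 2 ^ k * (real k powr (real t / 2) * (real n powr (real t / 2 - \<epsilon>)
          * (B powr (real t / 2 - 1) * real n powr (\<epsilon> / 2)) * real n powr (- \<theta>)))"
    proof -
      have "real s powr (\<theta> - 1) \<le> real s powr (real t / 2 - 1)"
        using s by (intro powr_mono) (auto simp: \<theta>_def)
      also have "\<dots> \<le> (B * real n powr (\<epsilon> / (real t - 2))) powr (real t / 2 - 1)"
        using t by (intro powr_mono2 sB) auto
      also have "\<dots> = B powr (real t / 2 - 1) * real n powr (\<epsilon> / (real t - 2) * (real t / 2 - 1))"
        using B by (simp add: powr_mult powr_powr)
      also have "\<epsilon> / (real t - 2) * (real t / 2 - 1) = \<epsilon> / 2"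
        using t by (simp add: field_simps)
      finally have "real s powr (\<theta> - 1) \<le> B powr (real t / 2 - 1) * real n powr (\<epsilon> / 2)" .
      moreover have "real k powr \<theta> \<le> real k powr (real t / 2)"
        using k by (intro powr_mono) (auto simp: \<theta>_def)
      ultimately show ?thesis
        using m by (intro mult_left_mono mult_mono mult_right_mono) auto
    qed
    also have "\<dots> = exp 1 * 2 ^ k * real k powr (real t / 2) * B powr (real t / 2 - 1)
        * (real n powr (real t / 2 - \<epsilon>) * real n powr (\<epsilon> / 2) * real n powr (- \<theta>))"
      by simp
    also have "real n powr (real t / 2 - \<epsilon>) * real n powr (\<epsilon> / 2) * real n powr (- \<theta>)
        = real n powr (1 / real L - \<epsilon> / 2)"
      by (simp add: \<theta>_def flip: powr_add)
    also have "exp 1 * 2 ^ k * real k powr (real t / 2) * B powr (real t / 2 - 1)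
        * real n powr (1 / real L - \<epsilon> / 2)
        \<le> exp 1 * 2 ^ k * real k powr (real t / 2) * B powr (real t / 2 - 1) * real n powr (- \<epsilon> / 4)"
      using L n by (intro mult_left_mono powr_mono) auto
    finally show "exp 1 * real m / real s * (2 ^ k * x powr \<theta>)
        \<le> exp 1 * 2 ^ k * real k powr (real t / 2) * B powr (real t / 2 - 1) * real n powr (- \<epsilon> / 4)" .
  qed (use x in auto)
  finally show ?thesis .
qed

lemma sum_powers_le:
  fixes \<rho> :: real
  assumes "0 \<le> \<rho>" "\<rho> \<le> 1 / 2"
  shows "(\<Sum>s=1..N. \<rho> ^ s) \<le> 2 * \<rho>"
proof -
  have "(\<Sum>s=1..N. \<rho> ^ s) \<le> 2 * \<rho> * (1 - (1 / 2) ^ N)"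
  proof (induction N)
    case (Suc N)
    have "\<rho> ^ N \<le> (1 / 2) ^ N" using assms by (intro power_mono)
    then have "\<rho> * \<rho> ^ N \<le> \<rho> * (1 / 2) ^ N" using assms by (intro mult_left_mono)
    then show ?case using Suc by (simp add: algebra_simps)
  qed simp
  also have "\<dots> \<le> 2 * \<rho> * 1" using assms by (intro mult_left_mono) auto
  finally show ?thesis by simp
qed

section \<open>From expansion to nonempty relaxations\<close>

lemma static_LS_plus_nonempty:
  fixes \<mu> :: "(nat \<Rightarrow> nat) pmf"
  assumes q: "0 < q" and t: "1 \<le> t" and L: "0 < L"
    and \<mu>: "set_pmf \<mu> \<subseteq> {z \<in> assignments q {..<k}. P z}"
    and unif: "\<forall>T. T \<subseteq> {..<k} \<and> 1 \<le> card T \<and> card T \<le> t - 1 \<longrightarrow>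
      (\<forall>\<alpha>\<in>assignments q T. measure_pmf.prob \<mu> {z. restrict z T = \<alpha>} = 1 / real q ^ card T)"
    and xs: "set xs \<subseteq> all_constraints q k n" "length xs = m"
    and exp: "xs \<notin> nonexpanding k t m L (3 * (L * (r + 1)))"
  shows "static_LS_plus q n r (R_inst q k P (mset xs)) \<noteq> {}"
proof -
  have mem: "fst (xs ! i) \<in> assignments q {..<k}" "snd (xs ! i) \<in> {..<k} \<rightarrow>\<^sub>E {..<n}" if "i < m" for i
  proof -
    have "xs ! i \<in> all_constraints q k n" using that xs nth_mem by blast
    then show "fst (xs ! i) \<in> assignments q {..<k}" "snd (xs ! i) \<in> {..<k} \<rightarrow>\<^sub>E {..<n}"
      by (auto simp: all_constraints_def mem_Times_iff)
  qed
  interpret expanding_csp k t "\<lambda>i. snd (xs ! i)" q n m \<mu> "\<lambda>i. fst (xs ! i)" L r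
  proof
    show "0 < q" "0 < L" by fact+
    show "set_pmf \<mu> \<subseteq> assignments q {..<k}" using \<mu> by auto
    show "measure_pmf.prob \<mu> {z. restrict z T = \<alpha>} = 1 / real q ^ card T"
      if T: "T \<subseteq> {..<k}" "card T < t" "\<alpha> \<in> assignments q T" for T \<alpha>
    \<comment> \<open>Uniform support speaks of nonempty \<open>T\<close> only; for the empty set
      the event is certain.\<close>
    proof (cases "T = {}")
      case True
      then have "{z. restrict z T = \<alpha>} = UNIV" using T by (auto simp: PiE_iff extensional_def fun_eq_iff)
      then show ?thesis using True by simp
    next
      case False
      have "finite T" using T(1) by (rule finite_subset) auto
      then have "1 \<le> card T" using False by (simp add: Suc_le_eq card_gt_0_iff)
      then show ?thesis using T unif by auto
    qed
    show "snd (xs ! i) p < n" if "i < m" "p < k" for i p using mem(2)[OF that(1)] that(2) by (auto simp: PiE_iff)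
    show "fst (xs ! i) p < q" if "i < m" "p < k" for i p using mem(1)[OF that(1)] that(2) by (auto simp: PiE_iff)
    show "2 * int (card D) \<le> int L * incidence.psi k t (\<lambda>i. snd (xs ! i)) {} D"
      if "D \<subseteq> {..<m}" "D \<noteq> {}" "card D \<le> 3 * (L * (r + 1))" for D
      using exp that unfolding nonexpanding_def by force
  qed
  have "local_dist \<in> static_LS_plus q n r (R_inst q k P (mset xs))"
  proof (rule local_dist_in_static_LS_plus[where cs = "\<lambda>i. xs ! i"])
    show "set_pmf \<mu> \<subseteq> {z. P z}" using \<mu> by auto
    show "R_inst q k P (mset xs) \<subseteq> {P01 q k P (shifted_vars q (xs ! i)) |i. i < m}"
    proof
      fix p assume "p \<in> R_inst q k P (mset xs)"
      then obtain C where "C \<in> set xs" "p = P01 q k P (shifted_vars q C)" by (auto simp: R_inst_def)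
      then show "p \<in> {P01 q k P (shifted_vars q (xs ! i)) |i. i < m}"
        using xs(2) by (auto simp: in_set_conv_nth)
    qed
  qed simp
  then show ?thesis by blast
qed

lemma prob_static_LS_plus_ge:
  assumes q: "0 < q" and t: "1 \<le> t" and L: "0 < L" and n: "0 < n"
    and unif: "uniform_supporting (t - 1) q k P"
  shows "1 - measure_pmf.prob (replicate_pmf m (pmf_of_set (all_constraints q k n)))
        (nonexpanding k t m L (3 * (L * (r + 1))))
    \<le> measure_pmf.prob (random_instance q k n m) {I. static_LS_plus q n r (R_inst q k P I) \<noteq> {}}"
proof -
  let ?A = "all_constraints q k n" and ?N = "nonexpanding k t m L (3 * (L * (r + 1)))"
  let ?M = "replicate_pmf m (pmf_of_set ?A)"
  obtain \<mu> where \<mu>: "set_pmf \<mu> \<subseteq> {z \<in> assignments q {..<k}. P z}"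
    "\<forall>T. T \<subseteq> {..<k} \<and> 1 \<le> card T \<and> card T \<le> t - 1 \<longrightarrow>
      (\<forall>\<alpha>\<in>assignments q T. measure_pmf.prob \<mu> {z. restrict z T = \<alpha>} = 1 / real q ^ card T)"
    using unif unfolding uniform_supporting_def by blast
  have A: "finite ?A" unfolding all_constraints_def by (intro finite_cartesian_product finite_PiE) auto
  have "((\<lambda>_\<in>{..<k}. 0), (\<lambda>_\<in>{..<k}. 0)) \<in> ?A" using q n by (auto simp: all_constraints_def)
  then have A0: "?A \<noteq> {}" by blast
  have "1 - measure_pmf.prob ?M ?N = measure_pmf.prob ?M (- ?N)"
    using measure_pmf.prob_compl[of ?N ?M] by (simp add: Compl_eq_Diff_UNIV)
  also have "\<dots> \<le> measure_pmf.prob ?M {xs. static_LS_plus q n r (R_inst q k P (mset xs)) \<noteq> {}}"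
  proof (rule measure_pmf.finite_measure_mono_AE)
    show "AE xs in ?M. xs \<in> - ?N \<longrightarrow> xs \<in> {xs. static_LS_plus q n r (R_inst q k P (mset xs)) \<noteq> {}}"
      unfolding AE_measure_pmf_iff
    proof (intro ballI impI CollectI)
      fix xs assume xs: "xs \<in> set_pmf ?M" "xs \<in> - ?N"
      then have "set xs \<subseteq> ?A" "length xs = m"
        using A A0 by (auto simp: set_replicate_pmf)
      then show "static_LS_plus q n r (R_inst q k P (mset xs)) \<noteq> {}"
        using xs(2) by (intro static_LS_plus_nonempty[OF q t L \<mu>]) auto
    qed
  qed simp
  also have "\<dots> = measure_pmf.prob (random_instance q k n m) {I. static_LS_plus q n r (R_inst q k P I) \<noteq> {}}"
    by (simp add: random_instance_def measure_map_pmf vimage_def)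
  finally show ?thesis .
qed

theorem theorem1p5:
  fixes q k t :: nat and \<epsilon> :: real and P :: "(nat \<Rightarrow> nat) \<Rightarrow> bool"
  assumes "q \<ge> 2" and "k \<ge> 1" and "t \<ge> 3" and "\<epsilon> > 0"
    and "uniform_supporting (t - 1) q k P"
  shows "\<exists>r :: nat \<Rightarrow> nat.
    (\<lambda>n. real (r n)) \<in> \<Omega>(\<lambda>n. real n powr (\<epsilon> / (real t - 2))) \<and>
    (\<forall>m :: nat \<Rightarrow> nat.
      (\<forall>n\<ge>1. real (m n) \<le> real n powr (real t / 2 - \<epsilon>)) \<longrightarrow>
      (\<lambda>n. measure_pmf.prob (random_instance q k n (m n))
             {I. static_LS_plus q n (r n) (R_inst q k P I) \<noteq> {}}) \<longlonglongrightarrow> 1)"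
proof -
  \<comment> \<open>Gives \<open>1 / L \<le> \<epsilon> / 4\<close>, so the slack in expansion costs
    only half of the available exponent \<epsilon> / 2.\<close>
  define L where "L = nat \<lceil>4 / \<epsilon>\<rceil>"
  have "0 < 4 / \<epsilon>" using \<open>\<epsilon> > 0\<close> by simp
  then have L0: "0 < L" unfolding L_def by linarith
  have "4 / \<epsilon> \<le> real L" unfolding L_def by (rule real_nat_ceiling_ge)
  then have L1: "1 / real L \<le> \<epsilon> / 4" using L0 \<open>\<epsilon> > 0\<close> by (simp add: field_simps)
  define \<gamma> where "\<gamma> = \<epsilon> / (real t - 2)"
  have \<gamma>: "0 < \<gamma>" using assms by (simp add: \<gamma>_def)
  \<comment> \<open>Chosen so that \<open>3 * L * c * k = 1 / 2\<close>: for
    \<open>\<gamma> \<le> 1\<close> the main part of \<open>k * N n\<close> is then at most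
    \<open>n / 2\<close>.\<close>
  define c where "c = 1 / (6 * real L * real k)"
  have c: "0 < c" using L0 assms by (simp add: c_def)
  define r where "r n = nat \<lceil>c * real n powr \<gamma>\<rceil>" for n
  define N where "N n = 3 * (L * (r n + 1))" for n
  \<comment> \<open>The additive 2 in \<open>N_le\<close> is absorbed using
    \<open>n powr \<gamma> \<ge> 1\<close>.\<close>
  define B where "B = 3 * real L * (c + 2)"
  have B: "0 < B" using L0 c by (simp add: B_def)
  define K where "K = exp 1 * 2 ^ k * real k powr (real t / 2) * B powr (real t / 2 - 1)"
  have K: "0 \<le> K" by (simp add: K_def)
  define \<rho> where "\<rho> n = K * real n powr (- \<epsilon> / 4)" for n
  have r_ge: "c * real n powr \<gamma> \<le> real (r n)" for n unfolding r_def by (rule real_nat_ceiling_ge)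
  have r_le: "real (r n) \<le> c * real n powr \<gamma> + 1" for n
  proof -
    have "0 \<le> c * real n powr \<gamma>" using c by simp
    then show ?thesis unfolding r_def by linarith
  qed
  have N_le: "real (N n) \<le> 3 * real L * (c * real n powr \<gamma> + 2)" for n
  proof -
    have "real (N n) = 3 * real L * (real (r n) + 1)" by (simp add: N_def algebra_simps)
    also have "\<dots> \<le> 3 * real L * (c * real n powr \<gamma> + 2)"
      using r_le[of n] by (intro mult_left_mono) auto
    finally show ?thesis .
  qed
  have N_B: "real (N n) \<le> B * real n powr \<gamma>" if "1 \<le> n" for n
  proof -
    have "1 \<le> real n powr \<gamma>" using that \<gamma> by (intro ge_one_powr_ge_zero) auto
    then have "3 * real L * (c * real n powr \<gamma> + 2) \<le> 3 * real L * (c * real n powr \<gamma> + 2 * real n powr \<gamma>)"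
      by (intro mult_left_mono) auto
    then show ?thesis using N_le[of n] by (simp add: B_def algebra_simps)
  qed
  have \<rho>_lim: "\<rho> \<longlonglongrightarrow> 0"
  proof -
    have "(\<lambda>n. real n powr (- \<epsilon> / 4)) \<longlonglongrightarrow> 0"
      using \<open>\<epsilon> > 0\<close> by (intro tendsto_neg_powr filterlim_real_sequentially) auto
    then show ?thesis unfolding \<rho>_def using tendsto_mult_right_zero by blast
  qed
  have lim: "(\<lambda>n. measure_pmf.prob (random_instance q k n (m n))
      {I. static_LS_plus q n (r n) (R_inst q k P I) \<noteq> {}}) \<longlonglongrightarrow> 1"
    if m: "\<forall>n\<ge>1. real (m n) \<le> real n powr (real t / 2 - \<epsilon>)" for m
  proof -
    \<comment> \<open>For \<open>\<gamma> \<le> 1\<close> the bound on \<open>N n\<close> suffices.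
      For \<open>\<gamma> > 1\<close> one has \<open>\<epsilon> > t - 2\<close>, hence
      \<open>t / 2 - \<epsilon> \<le> 1 / 2\<close> as \<open>t \<ge> 3\<close>, and both
      \<open>s\<close> and \<open>k\<close> are at most the square root of \<open>n\<close>.\<close>
    have ks: "k * s \<le> n" if n: "n \<ge> max 1 (max (12 * L * k) (k * k))" and s: "s \<le> m n" "s \<le> N n" for n s
    proof (cases "\<gamma> \<le> 1")
      case True
      have n1: "1 \<le> real n" using n by simp
      have "real n powr \<gamma> \<le> real n powr 1" using n1 True by (intro powr_mono) auto
      then have p: "real n powr \<gamma> \<le> real n" using n1 by simp
      have "real (k * s) \<le> real k * real (N n)" using s by (simp add: mult_left_mono)
      also have "\<dots> \<le> real k * (3 * real L * (c * real n powr \<gamma> + 2))"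
        by (intro mult_left_mono N_le) auto
      also have "\<dots> = 1 / 2 * real n powr \<gamma> + 6 * real L * real k"
        using L0 assms(2) by (simp add: c_def field_simps)
      also have "\<dots> \<le> real n"
      proof -
        have "real (12 * L * k) \<le> real n" using n unfolding of_nat_le_iff by simp
        then show ?thesis using p by simp
      qed
      finally show ?thesis by (simp only: of_nat_le_iff)
    next
      case False
      then have "real t - 2 < \<epsilon>" using assms(3) by (simp add: \<gamma>_def field_simps)
      then have e: "real t / 2 - \<epsilon> \<le> 1 / 2" using assms(3) by simp
      have n1: "1 \<le> real n" using n by simp
      have "real s \<le> real n powr (real t / 2 - \<epsilon>)" using m s n by (metis max.bounded_iff of_nat_le_iff order_trans)
      also have "\<dots> \<le> real n powr (1 / 2)" using e n1 by (intro powr_mono) auto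
      also have "\<dots> = sqrt (real n)" using n1 by (simp add: powr_half_sqrt)
      finally have "real s \<le> sqrt (real n)" .
      moreover have "real k \<le> sqrt (real n)"
      proof (rule real_le_rsqrt)
        have "real (k * k) \<le> real n" using n unfolding of_nat_le_iff by simp
        then show "(real k)\<^sup>2 \<le> real n" by (simp add: power2_eq_square)
      qed
      ultimately have "real k * real s \<le> sqrt (real n) * sqrt (real n)" by (intro mult_mono) auto
      then show ?thesis by (simp flip: of_nat_mult)
    qed
    have "\<forall>\<^sub>F n in sequentially. \<rho> n < 1 / 2" using \<rho>_lim by (rule order_tendstoD) simp
    then have ev: "\<forall>\<^sub>F n in sequentially. 1 - 2 * \<rho> n
        \<le> measure_pmf.prob (random_instance q k n (m n)) {I. static_LS_plus q n (r n) (R_inst q k P I) \<noteq> {}}"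
      using eventually_ge_at_top[of "max 1 (max (12 * L * k) (k * k))"]
    proof eventually_elim
      case (elim n)
      have n: "0 < n" using elim(2) by simp
      let ?a = "\<lambda>s. nat \<lceil>(real t / 2 - 1 / real L) * real s\<rceil>"
      have "measure_pmf.prob (replicate_pmf (m n) (pmf_of_set (all_constraints q k n)))
          (nonexpanding k t (m n) L (N n))
          \<le> (\<Sum>s=1..N n. real (m n choose s) * (real (k * s choose ?a s) * real (k * s) ^ ?a s / real n ^ ?a s))"
        using assms n L0 by (intro prob_nonexpanding) auto
      also have "\<dots> \<le> (\<Sum>s=1..N n. \<rho> n ^ s)"
      proof (rule sum_mono)
        fix s assume s: "s \<in> {1..N n}"
        show "real (m n choose s) * (real (k * s choose ?a s) * real (k * s) ^ ?a s / real n ^ ?a s) \<le> \<rho> n ^ s"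
        \<comment> \<open>\<open>ks\<close> relies on \<open>s \<le> m n\<close>; for larger
          \<open>s\<close> the binomial coefficient is 0.\<close>
        proof (cases "s \<le> m n")
          case True
          have "real s \<le> B * real n powr (\<epsilon> / (real t - 2))"
            using s N_B[of n] n by (auto simp: \<gamma>_def)
          then show ?thesis
            unfolding \<rho>_def K_def using True s assms L0 L1 B m n elim(2)
            by (intro nonexpanding_term_le ks) auto
        next
          case False
          then show ?thesis using K by (simp add: \<rho>_def binomial_eq_0)
        qed
      qed
      also have "\<dots> \<le> 2 * \<rho> n"
        using elim(1) K by (intro sum_powers_le) (auto simp: \<rho>_def)
      finally show ?case
        using prob_static_LS_plus_ge[of q t L n k P "m n" "r n"] assms L0 n by (simp add: N_def)
    qed
    have "(\<lambda>n. 1 - 2 * \<rho> n) \<longlonglongrightarrow> 1 - 2 * 0" by (intro tendsto_intros \<rho>_lim)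
    then have l: "(\<lambda>n. 1 - 2 * \<rho> n) \<longlonglongrightarrow> 1" by simp
    show ?thesis
      by (rule tendsto_sandwich[OF ev _ l tendsto_const]) (simp add: measure_pmf.prob_le_1)
  qed
  have "(\<lambda>n. real (r n)) \<in> \<Omega>(\<lambda>n. real n powr \<gamma>)"
    using c r_ge by (intro landau_omega.bigI[of c]) auto
  then show ?thesis using lim unfolding \<gamma>_def by blast
qed

end
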